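(* Let $\mathbb{K}$ be a field and let $\mathcal{F}:\mathbb{P}^{r_1}_{\mathbb{K}}\times\cdots\times\mathbb{P}^{r_m}_{\mathbb{K}}\dashrightarrow\mathbb{P}^{r_1+\cdots+r_m}_{\mathbb{K}}$ be a rational map defined by multi-homogeneous polynomials $\mathbf{f}=(f_0,\ldots,f_{r_1+\cdots+r_m})$ of the same multi-degree, whose base ideal $I=(\mathbf{f})$ is of linear type. Let $\varphi_1$ be the linear part of the matrix of syzygies of $I$. Then the following conditions are equivalent: (i) $\mathcal{F}$ is birational. (ii) $\mathrm{rank}(\varphi_1)=r_1+\cdots+r_m$.
   Context: $R=\mathbb{K}[x_{i,j}\mid1\le i\le m,\ 0\le j\le r_i]$ is the $\mathbb{Z}^m$-graded coordinate ring of $\mathbb{P}^{r_1}\times\cdots\times\mathbb{P}^{r_m}$. $I$ is of linear type if the canonical surjection $\mathrm{Sym}_R(I)\to\mathcal{R}_R(I)=\bigoplus_{n\ge0}I^nt^n$ is an isomorphism. $\varphi$ is the matrix of syzygies of $I$ with respect to the generators $\mathbf{f}$: its columns form a minimal multi-homogeneous generating set of the module of syzygies of $\mathbf{f}$, and its entries are multi-homogeneous polynomials. The multi-degree of a syzygy is the common multi-degree of its entries. The linear part $\varphi_1$ of $\varphi$ is the submatrix consisting of the columns of $\varphi$ corresponding to syzygies of multi-degree $(1,0,\ldots,0),(0,1,0,\ldots,0),\ldots$, or $(0,\ldots,0,1)$. Rank is over the fraction field of $R$. $\mathcal{F}$ is birational if it is dominant with an inverse rational map.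
   Formalization: The matrix φ depends on a choice, and for K-linearly dependent f the equivalence can fail for one φ, e.g. f=(x0,x1,x2,0). Proved: for any f (not all zero), (i) iff (ii) holds for every choice of φ; for linearly independent f, (i) iff (ii) for each φ. *)

theory Defs
  imports
    "HOL-Library.Poly_Mapping"
    "HOL-Computational_Algebra.Polynomial"
    "HOL-Computational_Algebra.Fraction_Field"
    "Jordan_Normal_Form.DL_Rank"
begin

section \<open>Polynomial rings\<close>

text \<open>
  Polynomials with variables in \<open>'v\<close> and coefficients in \<open>'k\<close>. For a field \<open>'k\<close> and linearly
  ordered \<open>'v\<close> this type is an integral domain; the order on \<open>'v\<close> is only needed for that
  type class instance.
\<close>
type_synonym ('v, 'k) mpol = "('v \<Rightarrow>\<^sub>0 nat) \<Rightarrow>\<^sub>0 'k"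

definition Const :: "'k::comm_ring_1 \<Rightarrow> ('v, 'k) mpol" where
  "Const c = Poly_Mapping.single 0 c"

definition Var :: "'v \<Rightarrow> ('v, 'k::comm_ring_1) mpol" where
  "Var v = Poly_Mapping.single (Poly_Mapping.single v 1) 1"

text \<open>The value of \<open>p\<close> at \<open>u\<close>, with coefficients mapped along \<open>h\<close>.\<close>
definition eval_mpol ::
    "('k::comm_ring_1 \<Rightarrow> 'a::comm_ring_1) \<Rightarrow> ('v \<Rightarrow> 'a) \<Rightarrow> ('v, 'k) mpol \<Rightarrow> 'a" where
  "eval_mpol h u p =
     (\<Sum>\<alpha>\<in>Poly_Mapping.keys p. h (Poly_Mapping.lookup p \<alpha>) *
        (\<Prod>v\<in>Poly_Mapping.keys \<alpha>. u v ^ Poly_Mapping.lookup \<alpha> v))"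

abbreviation subst_mpol ::
    "('v \<Rightarrow> ('w, 'k::comm_ring_1) mpol) \<Rightarrow> ('v, 'k) mpol \<Rightarrow> ('w, 'k) mpol" where
  "subst_mpol \<equiv> eval_mpol Const"

definition mpol_in :: "'v set \<Rightarrow> ('v, 'k::comm_ring_1) mpol set" where
  "mpol_in A = {p. \<forall>\<alpha>\<in>Poly_Mapping.keys p. Poly_Mapping.keys \<alpha> \<subseteq> A}"

definition homogeneous :: "nat \<Rightarrow> ('v, 'k::comm_ring_1) mpol \<Rightarrow> bool" where
  "homogeneous d p \<longleftrightarrow>
     (\<forall>\<alpha>\<in>Poly_Mapping.keys p. (\<Sum>v\<in>Poly_Mapping.keys \<alpha>. Poly_Mapping.lookup \<alpha> v) = d)"

section \<open>The multigraded coordinate ring\<close>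

text \<open>
  \<open>multi_vars m r x\<close>: the variables in \<open>'v\<close> are exactly the pairwise distinct \<open>x i j\<close> with
  \<open>1 \<le> i \<le> m\<close> and \<open>0 \<le> j \<le> r i\<close>. Then the whole type \<open>('v, 'k) mpol\<close> is the coordinate ring
  \<open>R\<close> of the product of the projective spaces of dimensions \<open>r 1, \<dots>, r m\<close>. Since \<open>'v\<close> is
  nonempty, this entails \<open>m \<ge> 1\<close>.
\<close>
definition multi_vars :: "nat \<Rightarrow> (nat \<Rightarrow> nat) \<Rightarrow> (nat \<Rightarrow> nat \<Rightarrow> 'v) \<Rightarrow> bool" where
  "multi_vars m r x \<longleftrightarrow> bij_betw (\<lambda>(i, j). x i j) (SIGMA i:{1..m}. {..r i}) UNIV"

text \<open>Only the values \<open>d 1, \<dots>, d m\<close> of a multi-degree \<open>d\<close> matter; \<open>0\<close> has every multi-degree.\<close>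
definition multi_homogeneous ::
    "nat \<Rightarrow> (nat \<Rightarrow> nat) \<Rightarrow> (nat \<Rightarrow> nat \<Rightarrow> 'v) \<Rightarrow> (nat \<Rightarrow> nat) \<Rightarrow> ('v, 'k::comm_ring_1) mpol \<Rightarrow> bool"
where
  "multi_homogeneous m r x d p \<longleftrightarrow>
     (\<forall>\<alpha>\<in>Poly_Mapping.keys p. \<forall>i\<in>{1..m}. (\<Sum>j\<le>r i. Poly_Mapping.lookup \<alpha> (x i j)) = d i)"

definition unit_degree :: "nat \<Rightarrow> nat \<Rightarrow> nat" where
  "unit_degree i = (\<lambda>i'. if i' = i then 1 else 0)"

section \<open>Ideals of linear type\<close>

text \<open>The ideal generated by \<open>S\<close> in the subring \<open>A\<close>.\<close>
definition ideal_gen :: "'a::comm_ring_1 set \<Rightarrow> 'a set \<Rightarrow> 'a set" where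
  "ideal_gen A S = {(\<Sum>s\<in>T. c s * s) | c T. finite T \<and> T \<subseteq> S \<and> c ` T \<subseteq> A}"

definition ideal_power :: "'a::comm_ring_1 set \<Rightarrow> nat \<Rightarrow> 'a set" where
  "ideal_power I n = ideal_gen UNIV {(\<Prod>k<n. a k) | a. \<forall>k<n. a k \<in> I}"

text \<open>The Rees algebra \<open>\<Oplus>\<^sub>n I\<^sup>n t\<^sup>n\<close>, as a subring of \<open>R[t]\<close>.\<close>
definition Rees :: "'a::comm_ring_1 set \<Rightarrow> 'a poly set" where
  "Rees I = {p. \<forall>n. Polynomial.coeff p n \<in> ideal_power I n}"

text \<open>
  The symmetric algebra of the \<open>R\<close>-module \<open>I\<close>, where \<open>R\<close> is the type \<open>'a\<close>: the polynomial
  algebra over \<open>R\<close> with one variable \<open>Var a\<close> for each \<open>a \<in> I\<close>, modulo the ideal which makes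
  \<open>a \<mapsto> Var a\<close> an \<open>R\<close>-linear map. Its elements are residue classes.
\<close>
definition sym_relations :: "'a::comm_ring_1 set \<Rightarrow> ('a, 'a) mpol set" where
  "sym_relations I =
     {Var (a + b) - Var a - Var b | a b. a \<in> I \<and> b \<in> I} \<union>
     {Var (c * a) - Const c * Var a | c a. a \<in> I}"

definition sym_cong :: "'a::comm_ring_1 set \<Rightarrow> (('a, 'a) mpol \<times> ('a, 'a) mpol) set" where
  "sym_cong I = {(P, Q). P \<in> mpol_in I \<and> Q \<in> mpol_in I \<and>
     P - Q \<in> ideal_gen (mpol_in I) (sym_relations I)}"

definition Sym :: "'a::comm_ring_1 set \<Rightarrow> ('a, 'a) mpol set set" where
  "Sym I = mpol_in I // sym_cong I"

text \<open>
  The canonical map \<open>Sym I \<rightarrow> R[t]\<close> sends the class of \<open>Var a\<close> to \<open>a t\<close>. The evaluation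
  homomorphism is constant on each residue class, so that \<open>the_elem\<close> is applied to a singleton.
\<close>
definition sym_to_rees :: "('a::comm_ring_1, 'a) mpol set \<Rightarrow> 'a poly" where
  "sym_to_rees C = the_elem (eval_mpol (\<lambda>c. [:c:]) (\<lambda>a. Polynomial.monom a 1) ` C)"

text \<open>The canonical map is a ring homomorphism, so it is an isomorphism iff it is bijective.\<close>
definition linear_type :: "'a::comm_ring_1 set \<Rightarrow> bool" where
  "linear_type I \<longleftrightarrow> bij_betw sym_to_rees (Sym I) (Rees I)"

section \<open>Birational maps\<close>

text \<open>
  Two tuples of elements of an integral domain that are homogeneous coordinates of the same
  point over its fraction field. Two tuples of (multi-)homogeneous polynomials of the same degree
  define the same rational map to projective space iff they are related in this way.
\<close>
definition proj_eq :: "'i set \<Rightarrow> ('i \<Rightarrow> 'a::idom) \<Rightarrow> ('i \<Rightarrow> 'a) \<Rightarrow> bool" where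
  "proj_eq A u v \<longleftrightarrow> (\<exists>i\<in>A. u i \<noteq> 0) \<and> (\<exists>i\<in>A. v i \<noteq> 0) \<and> (\<forall>i\<in>A. \<forall>j\<in>A. u i * v j = u j * v i)"

text \<open>
  The homogeneous coordinate ring of the target is \<open>\<K>[y\<^sub>0, \<dots>, y\<^sub>N] = mpol_in {..N}\<close>. The map given
  by \<open>f\<close> is dominant iff its image lies in no proper Zariski closed subset of the target, i.e.
  iff no nonzero form \<open>P\<close> vanishes on the image. As the source is integral, \<open>P\<close> vanishes on the
  image iff \<open>P(f) = 0\<close> in \<open>R\<close>. (Over a finite field it would not suffice to consider rational points.)
\<close>
definition dominant_map :: "nat \<Rightarrow> (nat \<Rightarrow> ('v, 'k::field) mpol) \<Rightarrow> bool" where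
  "dominant_map N f \<longleftrightarrow>
     (\<forall>P\<in>mpol_in {..N}. (\<exists>d. homogeneous d P) \<and> subst_mpol f P = 0 \<longrightarrow> P = 0)"

text \<open>
  A rational map from the projective \<open>N\<close>-space to the product of projective spaces is given by
  polynomials \<open>g (x i j)\<close>, such that for each \<open>i\<close> the forms \<open>g (x i 0), \<dots>, g (x i (r i))\<close> have the
  same degree and are not all zero.
\<close>
definition rational_map_to_product ::
    "nat \<Rightarrow> (nat \<Rightarrow> nat) \<Rightarrow> (nat \<Rightarrow> nat \<Rightarrow> 'v) \<Rightarrow> nat \<Rightarrow> ('v \<Rightarrow> (nat, 'k::field) mpol) \<Rightarrow> bool" where
  "rational_map_to_product m r x N g \<longleftrightarrow>
     (\<forall>i\<in>{1..m}. (\<exists>e. \<forall>j\<le>r i. g (x i j) \<in> mpol_in {..N} \<and> homogeneous e (g (x i j))) \<and>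
        (\<exists>j\<le>r i. g (x i j) \<noteq> 0))"

text \<open>
  Both composites are defined and equal to the identity as rational maps. That they are defined,
  i.e. that the composed tuples are not identically zero, is part of \<^const>\<open>proj_eq\<close>.
\<close>
definition inverse_rational_map ::
    "nat \<Rightarrow> (nat \<Rightarrow> nat) \<Rightarrow> (nat \<Rightarrow> nat \<Rightarrow> 'v::linorder) \<Rightarrow> nat \<Rightarrow> (nat \<Rightarrow> ('v, 'k::field) mpol) \<Rightarrow>
     ('v \<Rightarrow> (nat, 'k) mpol) \<Rightarrow> bool" where
  "inverse_rational_map m r x N f g \<longleftrightarrow>
     rational_map_to_product m r x N g \<and>
     (\<forall>i\<in>{1..m}. proj_eq {..r i} (\<lambda>j. subst_mpol f (g (x i j))) (\<lambda>j. Var (x i j))) \<and>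
     proj_eq {..N} (\<lambda>k. subst_mpol g (f k)) Var"

definition birational ::
    "nat \<Rightarrow> (nat \<Rightarrow> nat) \<Rightarrow> (nat \<Rightarrow> nat \<Rightarrow> 'v::linorder) \<Rightarrow> nat \<Rightarrow> (nat \<Rightarrow> ('v, 'k::field) mpol) \<Rightarrow> bool"
where
  "birational m r x N f \<longleftrightarrow> dominant_map N f \<and> (\<exists>g. inverse_rational_map m r x N f g)"

section \<open>The matrix of syzygies\<close>

definition syzygies :: "nat \<Rightarrow> (nat \<Rightarrow> 'a::comm_ring_1) \<Rightarrow> 'a vec set" where
  "syzygies N f = {s \<in> carrier_vec (N + 1). (\<Sum>k\<le>N. s $ k * f k) = 0}"

definition cols_generate :: "'a::comm_ring_1 mat \<Rightarrow> nat set \<Rightarrow> 'a vec set \<Rightarrow> bool" where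
  "cols_generate \<phi> S M \<longleftrightarrow>
     (\<forall>c\<in>S. col \<phi> c \<in> M) \<and>
     (\<forall>s\<in>M. \<exists>a. \<forall>k<dim_row \<phi>. s $ k = (\<Sum>c\<in>S. a c * \<phi> $$ (k, c)))"

definition multi_homogeneous_vec ::
    "nat \<Rightarrow> (nat \<Rightarrow> nat) \<Rightarrow> (nat \<Rightarrow> nat \<Rightarrow> 'v) \<Rightarrow> (nat \<Rightarrow> nat) \<Rightarrow> ('v, 'k::comm_ring_1) mpol vec \<Rightarrow> bool"
where
  "multi_homogeneous_vec m r x d s \<longleftrightarrow> (\<forall>k<dim_vec s. multi_homogeneous m r x d (s $ k))"

text \<open>
  \<open>\<phi>\<close> is determined by \<open>f\<close> only up to the choice of a minimal multi-homogeneous generating set.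
  Minimality is with respect to inclusion, for the family of columns (so no column is repeated).
\<close>
definition syzygy_matrix ::
    "nat \<Rightarrow> (nat \<Rightarrow> nat) \<Rightarrow> (nat \<Rightarrow> nat \<Rightarrow> 'v) \<Rightarrow> nat \<Rightarrow> (nat \<Rightarrow> ('v, 'k::field) mpol) \<Rightarrow>
     ('v, 'k) mpol mat \<Rightarrow> bool" where
  "syzygy_matrix m r x N f \<phi> \<longleftrightarrow>
     dim_row \<phi> = N + 1 \<and>
     (\<forall>c<dim_col \<phi>. \<exists>d. multi_homogeneous_vec m r x d (col \<phi> c)) \<and>
     cols_generate \<phi> {..<dim_col \<phi>} (syzygies N f) \<and>
     (\<forall>S. S \<subset> {..<dim_col \<phi>} \<longrightarrow> \<not> cols_generate \<phi> S (syzygies N f))"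

definition linear_part ::
    "nat \<Rightarrow> (nat \<Rightarrow> nat) \<Rightarrow> (nat \<Rightarrow> nat \<Rightarrow> 'v) \<Rightarrow> ('v, 'k::field) mpol mat \<Rightarrow> ('v, 'k) mpol mat" where
  "linear_part m r x \<phi> = mat_of_cols (dim_row \<phi>)
     (filter (\<lambda>s. \<exists>i\<in>{1..m}. multi_homogeneous_vec m r x (unit_degree i) s) (cols \<phi>))"

definition fract_rank :: "'a::idom mat \<Rightarrow> nat" where
  "fract_rank A = vec_space.rank (dim_row A) (map_mat (\<lambda>a. Fract a 1) A)"

definition lin_indep_forms :: "nat \<Rightarrow> (nat \<Rightarrow> ('v, 'k::field) mpol) \<Rightarrow> bool" where
  "lin_indep_forms N f \<longleftrightarrow>
     (\<forall>c. (\<Sum>k\<le>N. Const (c k) * f k) = 0 \<longrightarrow> (\<forall>k\<le>N. c k = 0))"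

text \<open>
  If \<open>f\<close> is linearly dependent over the field, then the rank of the linear part may depend on the
  choice of \<open>\<phi>\<close>: a minimal generating set of the syzygies then contains constant syzygies, and
  multiples of these may be added to the linear ones. For example, for \<open>m = 1\<close>, \<open>r 1 = 3\<close>
  and \<open>f = (x\<^sub>0, x\<^sub>1, x\<^sub>2, 0)\<close> the columns
  \<open>(x\<^sub>1, -x\<^sub>0, 0, h)\<close>, \<open>(x\<^sub>2, 0, -x\<^sub>0, 0)\<close>, \<open>(0, x\<^sub>2, -x\<^sub>1, 0)\<close>, \<open>(0, 0, 0, 1)\<close>
  form such a matrix for every linear form \<open>h\<close>; its linear part has rank 2 for \<open>h = 0\<close> but rank
  3 for \<open>h = x\<^sub>3\<close>, although \<open>f\<close> is not dominant. So for arbitrary \<open>f\<close> a condition on this rank has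
  to be read as a condition on all choices of \<open>\<phi>\<close>; for linearly independent \<open>f\<close> (i.e. \<open>f\<close> minimally
  generates its ideal) it makes sense for each single choice.
\<close>

end

theory Submission
  imports Defs
begin

text \<open>
  Let \<open>R\<close> be the coordinate ring of the source and \<open>J \<subseteq> R[y\<^sub>0, \<dots>, y\<^sub>N]\<close> the ideal of the
  relations between \<open>f\<^sub>0 t, \<dots>, f\<^sub>N t\<close>, which defines the graph of the map. Linear type means that
  \<open>J\<close> is generated by the forms \<open>\<Sum>\<^sub>k s\<^sub>k y\<^sub>k\<close> for the syzygies \<open>s\<close> of \<open>f\<close>
  (\<open>linear_type_relations\<close>). If \<open>f\<close> is linearly independent over the ground field, then no
  syzygy has a constant term, so that all these forms vanish at \<open>x = 0\<close>. Hence \<open>J\<close> contains no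
  nonzero form in \<open>y\<close> alone, and the map is dominant (\<open>dominant_of_linear_type\<close>).

  Let \<open>g\<close> be inverse to the map. The equations \<open>g\<^sub>i\<^sub>j(y) x\<^sub>i\<^sub>l = g\<^sub>i\<^sub>l(y) x\<^sub>i\<^sub>j\<close> are
  in \<open>J\<close> and have the degree of a variable in \<open>x\<close>. So they are combinations, with coefficients in
  \<open>y\<close>, of the columns of the linear part \<open>\<phi>\<^sub>1\<close>. If \<open>h\<close> annihilates these columns, then so
  does \<open>f + t h\<close> for a new variable \<open>t\<close>; hence \<open>g(f + t h)\<close> is the point \<open>x\<close>, and applying \<open>f\<close>
  shows that \<open>f + t h\<close> is proportional to \<open>f\<close> (\<open>kernel_of_inverse\<close>). So the vectors that
  annihilate \<open>\<phi>\<^sub>1\<close> form a line, and \<open>\<phi>\<^sub>1\<close> has rank \<open>N\<close>.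

  Conversely let \<open>\<phi>\<^sub>1\<close> have \<open>N\<close> independent columns. Those of degree \<open>e\<^sub>i\<close> can be read as
  linear equations for \<open>(x\<^sub>i\<^sub>0, x\<^sub>i\<^sub>1, \<dots>)\<close> with coefficients linear in \<open>y\<close>. Differentiating a
  relation between them with respect to \<open>y\<close> at \<open>y = f\<close> gives a relation between the columns, so
  they are independent as equations too (\<open>independence_transfer\<close>). As \<open>x\<close> solves them at
  \<open>y = f\<close>, at most \<open>r\<^sub>i\<close> of them are independent; these bounds add up to \<open>N\<close>, so there are
  exactly \<open>r\<^sub>i\<close> for each \<open>i\<close>. Their solution \<open>g\<^sub>i\<close> over \<open>\<K>[y]\<close> is therefore unique up to a
  factor, and \<open>g\<^sub>i(f)\<close> is proportional to \<open>x\<^sub>i\<close> (\<open>linear_equations\<close>). By dominance \<open>g\<close> is an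
  inverse on the other side as well (\<open>inverse_of_left_inverse\<close>).

  Both arguments work for any choice of the syzygy matrix. To have a choice at all one needs that
  the syzygies are finitely generated (\<open>submodule_finitely_generated\<close>). If \<open>f\<close> is linearly
  dependent, then the map is not dominant, and the matrix can be chosen such that its linear part
  has a zero row and rank less than \<open>N\<close> (\<open>syzygy_matrix_of_dependent\<close>).
\<close>

section \<open>Evaluation of polynomials\<close>

definition monom_val :: "('v \<Rightarrow> 'a::comm_ring_1) \<Rightarrow> ('v \<Rightarrow>\<^sub>0 nat) \<Rightarrow> 'a" where
  "monom_val u \<alpha> = (\<Prod>v\<in>Poly_Mapping.keys \<alpha>. u v ^ Poly_Mapping.lookup \<alpha> v)"

lemma monom_val_superset:
  assumes "finite F" "Poly_Mapping.keys \<alpha> \<subseteq> F"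
  shows "monom_val u \<alpha> = (\<Prod>v\<in>F. u v ^ Poly_Mapping.lookup \<alpha> v)"
  unfolding monom_val_def
  by (rule prod.mono_neutral_left) (use assms in \<open>auto simp: in_keys_iff\<close>)

lemma monom_val_zero [simp]: "monom_val u 0 = 1"
  by (simp add: monom_val_def)

lemma monom_val_single [simp]: "monom_val u (Poly_Mapping.single v n) = u v ^ n"
  by (simp add: monom_val_superset[of "{v}"] keys_single)

lemma monom_val_add: "monom_val u (\<alpha> + \<beta>) = monom_val u \<alpha> * monom_val u \<beta>"
proof -
  let ?F = "Poly_Mapping.keys \<alpha> \<union> Poly_Mapping.keys \<beta>"
  have "Poly_Mapping.keys (\<alpha> + \<beta>) \<subseteq> ?F" by (rule keys_add)
  then show ?thesis
    by (simp add: monom_val_superset[of ?F] lookup_add power_add prod.distrib)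
qed

lemma eval_mpol_altdef:
  "eval_mpol h u p = (\<Sum>\<alpha>\<in>Poly_Mapping.keys p. h (Poly_Mapping.lookup p \<alpha>) * monom_val u \<alpha>)"
  by (simp add: eval_mpol_def monom_val_def)

lemma eval_mpol_superset:
  assumes "h 0 = 0" "finite F" "Poly_Mapping.keys p \<subseteq> F"
  shows "eval_mpol h u p = (\<Sum>\<alpha>\<in>F. h (Poly_Mapping.lookup p \<alpha>) * monom_val u \<alpha>)"
  unfolding eval_mpol_altdef
  by (rule sum.mono_neutral_left) (use assms in \<open>auto simp: in_keys_iff\<close>)

lemma eval_mpol_single:
  assumes "h 0 = 0"
  shows "eval_mpol h u (Poly_Mapping.single \<alpha> c) = h c * monom_val u \<alpha>"
  using assms by (simp add: eval_mpol_superset[of h "{\<alpha>}"])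

lemma Var_neq_zero [simp]: "Var v \<noteq> 0"
  unfolding Var_def by (metis lookup_single_eq lookup_zero one_neq_zero)

lemma additive_eval_mpol:
  fixes h :: "'a::comm_ring_1 \<Rightarrow> 'b::comm_ring_1" and u :: "'c \<Rightarrow> 'b"
  assumes "Modules.additive h"
  shows "Modules.additive (eval_mpol h u)"
proof
  fix p q :: "('c, 'a) mpol"
  interpret h: Modules.additive h by fact
  let ?F = "Poly_Mapping.keys p \<union> Poly_Mapping.keys q"
  have "Poly_Mapping.keys (p + q) \<subseteq> ?F" by (rule keys_add)
  then show "eval_mpol h u (p + q) = eval_mpol h u p + eval_mpol h u q"
    by (simp add: eval_mpol_superset[of h ?F] h.zero lookup_add h.add ring_distribs sum.distrib)
qed

lemma mpol_sum_singles:
  "p = (\<Sum>\<alpha>\<in>Poly_Mapping.keys p. Poly_Mapping.single \<alpha> (Poly_Mapping.lookup p \<alpha>))"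
  by (rule poly_mapping_eqI) (simp add: lookup_sum lookup_single when_def in_keys_iff)

lemma mpol_induct [case_names single add]:
  fixes p :: "('v, 'k::comm_ring_1) mpol"
  assumes "\<And>\<alpha> c. P (Poly_Mapping.single \<alpha> c)"
    and "\<And>p q. P p \<Longrightarrow> P q \<Longrightarrow> P (p + q)"
  shows "P p"
proof -
  have "P (\<Sum>\<alpha>\<in>F. Poly_Mapping.single \<alpha> (Poly_Mapping.lookup p \<alpha>))" if "finite F" for F
    using that
  proof induction
    case empty
    then show ?case using assms(1)[of 0 0] by simp
  qed (use assms in simp)
  from this[of "Poly_Mapping.keys p"] show ?thesis
    using mpol_sum_singles[of p] by simp
qed

lemma mpol_in_zero [simp]: "0 \<in> mpol_in A"
  and mpol_in_Const [simp]: "Const c \<in> mpol_in A"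
  and mpol_in_Var: "v \<in> A \<Longrightarrow> Var v \<in> mpol_in A"
  by (auto simp: mpol_in_def Const_def Var_def)

lemma mpol_in_add: "p \<in> mpol_in A \<Longrightarrow> q \<in> mpol_in A \<Longrightarrow> p + q \<in> mpol_in A"
  using keys_add[of p q] by (fastforce simp: mpol_in_def)

lemma mpol_in_uminus: "p \<in> mpol_in A \<Longrightarrow> - p \<in> mpol_in A"
  by (auto simp: mpol_in_def in_keys_iff)

lemma mpol_in_diff: "p \<in> mpol_in A \<Longrightarrow> q \<in> mpol_in A \<Longrightarrow> p - q \<in> mpol_in A"
  using mpol_in_add[OF _ mpol_in_uminus, of p A q] by simp

lemma mpol_in_mult:
  assumes "p \<in> mpol_in A" "q \<in> mpol_in A"
  shows "p * q \<in> mpol_in A"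
proof -
  have "Poly_Mapping.keys (\<beta> + \<gamma>) \<subseteq> A"
    if "\<beta> \<in> Poly_Mapping.keys p" "\<gamma> \<in> Poly_Mapping.keys q" for \<beta> \<gamma>
    using that assms keys_add[of \<beta> \<gamma>] unfolding mpol_in_def by blast
  then show ?thesis using keys_mult[of p q] by (fastforce simp: mpol_in_def)
qed

lemma mpol_in_sum: "(\<And>i. i \<in> I \<Longrightarrow> p i \<in> mpol_in A) \<Longrightarrow> sum p I \<in> mpol_in A"
  by (induction I rule: infinite_finite_induct) (auto intro: mpol_in_add)

lemma mpol_in_one [simp]: "1 \<in> mpol_in A"
  by (simp add: mpol_in_def)

lemma mpol_in_prod: "(\<And>i. i \<in> I \<Longrightarrow> p i \<in> mpol_in A) \<Longrightarrow> prod p I \<in> mpol_in A"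
  by (induction I rule: infinite_finite_induct) (auto intro: mpol_in_mult)

lemma mpol_in_power: "p \<in> mpol_in A \<Longrightarrow> p ^ n \<in> mpol_in A"
  by (induction n) (auto intro: mpol_in_mult)

lemma mpol_in_eval_mpol:
  assumes "\<And>c. h c \<in> mpol_in A" "\<And>v. v \<in> B \<Longrightarrow> u v \<in> mpol_in A" "p \<in> mpol_in B"
  shows "eval_mpol h u p \<in> mpol_in A"
  unfolding eval_mpol_def
  by (intro mpol_in_sum mpol_in_mult mpol_in_prod mpol_in_power)
    (use assms in \<open>auto simp: mpol_in_def[of B]\<close>)

text \<open>
  With \<open>D = D1 = D2\<close> and \<open>D3 = D4 = 0\<close> this is multiplicativity of the evaluation along a ring
  homomorphism. The general form also covers the product rule for maps \<open>D\<close> that extract a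
  homogeneous component of degree one from the coefficients.
\<close>
lemma eval_mpol_mult_bilinear:
  fixes p q :: "('v, 'k::comm_ring_1) mpol" and D1 :: "'k \<Rightarrow> 'a::comm_ring_1"
  assumes add: "Modules.additive D" "Modules.additive D1" "Modules.additive D2"
      "Modules.additive D3" "Modules.additive D4"
    and D: "\<And>a b. D (a * b) = D1 a * D2 b + D3 a * D4 b"
  shows "eval_mpol D u (p * q) =
    eval_mpol D1 u p * eval_mpol D2 u q + eval_mpol D3 u p * eval_mpol D4 u q"
proof -
  note zero = add[THEN additive.zero]
  note eval_add = add[THEN additive_eval_mpol, THEN additive.add]
  show ?thesis
  proof (induction p rule: mpol_induct)
    case (single \<alpha> c)
    show ?case
    proof (induction q rule: mpol_induct)
      case (single \<beta> d)
      show ?case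
        by (simp add: mult_single eval_mpol_single zero monom_val_add D algebra_simps)
    next
      case (add q1 q2)
      then show ?case by (simp add: distrib_left eval_add algebra_simps)
    qed
  next
    case (add p1 p2)
    then show ?case by (simp add: distrib_right eval_add algebra_simps)
  qed
qed

lemma additive_hom:
  assumes "comm_ring_hom h"
  shows "Modules.additive h"
proof -
  interpret comm_ring_hom h by fact
  show ?thesis by unfold_locales (rule hom_add)
qed

lemma eval_mpol_Const: "h 0 = 0 \<Longrightarrow> eval_mpol h u (Const c) = h c"
  by (simp add: Const_def eval_mpol_single)

lemma eval_mpol_Var: "h 0 = 0 \<Longrightarrow> eval_mpol h u (Var v) = h 1 * u v"
  by (simp add: Var_def eval_mpol_single)

lemma hom_eval_mpol:
  assumes "comm_ring_hom h"
  shows "comm_ring_hom (eval_mpol h u)"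
proof -
  interpret h: comm_ring_hom h by fact
  have a: "Modules.additive h" using assms by (rule additive_hom)
  have z: "Modules.additive (\<lambda>_. 0 :: 'b)" by unfold_locales simp
  note ea = additive_eval_mpol[OF a, of u]
  show ?thesis
  proof
    show "eval_mpol h u 0 = 0" using ea by (rule additive.zero)
    show "eval_mpol h u 1 = 1"
      using eval_mpol_single[of h u 0 1] by simp
    show "eval_mpol h u (p + q) = eval_mpol h u p + eval_mpol h u q" for p q
      using ea by (rule additive.add)
    show "eval_mpol h u (p * q) = eval_mpol h u p * eval_mpol h u q" for p q
      using eval_mpol_mult_bilinear[OF a a a z z, of u p q]
      by (simp add: h.hom_mult eval_mpol_altdef)
  qed
qed

lemma hom_Const: "comm_ring_hom (Const :: 'k::comm_ring_1 \<Rightarrow> ('v, 'k) mpol)"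
  by unfold_locales (simp_all add: Const_def single_add mult_single)

lemma hom_comp_eval_mpol:
  assumes "comm_ring_hom \<phi>"
  shows "\<phi> (eval_mpol h u p) = eval_mpol (\<lambda>c. \<phi> (h c)) (\<lambda>v. \<phi> (u v)) p"
proof -
  interpret comm_ring_hom \<phi> by fact
  show ?thesis by (simp add: eval_mpol_def hom_distribs)
qed

lemma eval_mpol_subst:
  assumes "comm_ring_hom h"
  shows "eval_mpol h u (subst_mpol g p) = eval_mpol h (\<lambda>v. eval_mpol h u (g v)) p"
proof -
  interpret h: comm_ring_hom h by fact
  show ?thesis
    by (simp add: hom_comp_eval_mpol[OF hom_eval_mpol[OF assms]] eval_mpol_Const)
qed

lemma subst_mpol_Var [simp]: "subst_mpol Var p = (p :: ('v, 'k::comm_ring_1) mpol)"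
proof -
  have "monom_val Var \<alpha> = Poly_Mapping.single \<alpha> (1 :: 'k)" for \<alpha> :: "'v \<Rightarrow>\<^sub>0 nat"
  proof -
    have pw: "Var v ^ n = (Poly_Mapping.single (Poly_Mapping.single v n) 1 :: ('v, 'k) mpol)" for v n
      by (induction n) (auto simp: Var_def mult_single single_add[symmetric])
    have "(\<Prod>v\<in>F. Poly_Mapping.single (Poly_Mapping.single v (Poly_Mapping.lookup \<alpha> v)) (1 :: 'k)) =
        Poly_Mapping.single (\<Sum>v\<in>F. Poly_Mapping.single v (Poly_Mapping.lookup \<alpha> v)) 1" if "finite F" for F
      using that by induction (auto simp: mult_single)
    moreover have "(\<Sum>v\<in>Poly_Mapping.keys \<alpha>. Poly_Mapping.single v (Poly_Mapping.lookup \<alpha> v)) = \<alpha>"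
      by (rule poly_mapping_eqI) (simp add: lookup_sum lookup_single when_def in_keys_iff)
    ultimately show ?thesis by (simp add: monom_val_def pw)
  qed
  then show ?thesis
    using mpol_sum_singles[of p] by (simp add: eval_mpol_altdef Const_def mult_single)
qed

section \<open>Gradings\<close>

text \<open>
  A grading is given by a weight function \<open>w\<close> on exponent vectors, so that total degrees and
  multi-degrees are treated together.
\<close>
definition graded :: "(('v \<Rightarrow>\<^sub>0 nat) \<Rightarrow> 'g) \<Rightarrow> 'g \<Rightarrow> ('v, 'k::comm_ring_1) mpol \<Rightarrow> bool" where
  "graded w d p \<longleftrightarrow> (\<forall>\<alpha>\<in>Poly_Mapping.keys p. w \<alpha> = d)"

definition part :: "(('v \<Rightarrow>\<^sub>0 nat) \<Rightarrow> 'g) \<Rightarrow> 'g \<Rightarrow> ('v, 'k::comm_ring_1) mpol \<Rightarrow> ('v, 'k) mpol" where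
  "part w d = Poly_Mapping.mapp (\<lambda>\<alpha> c. if w \<alpha> = d then c else 0)"

lemma lookup_part:
  "Poly_Mapping.lookup (part w d p) \<alpha> = (if w \<alpha> = d then Poly_Mapping.lookup p \<alpha> else 0)"
  by (auto simp: part_def lookup_mapp when_def in_keys_iff)

lemma part_add: "part w d (p + q) = part w d p + part w d q"
  by (rule poly_mapping_eqI) (simp add: lookup_part lookup_add)

lemma additive_part: "Modules.additive (part w d)"
  by unfold_locales (rule part_add)

lemmas part_zero [simp] = additive.zero[OF additive_part]
lemmas part_sum = additive.sum[OF additive_part]

lemma part_single:
  "part w d (Poly_Mapping.single \<alpha> c) = (if w \<alpha> = d then Poly_Mapping.single \<alpha> c else 0)"
  by (rule poly_mapping_eqI) (auto simp: lookup_part lookup_single when_def)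

lemma graded_part: "graded w d (part w d p)"
  by (auto simp: graded_def in_keys_iff lookup_part split: if_splits)

lemma part_of_graded: "graded w e p \<Longrightarrow> part w d p = (if d = e then p else 0)"
  by (rule poly_mapping_eqI) (auto simp: lookup_part graded_def in_keys_iff)

lemma sum_parts:
  assumes "finite F" "w ` Poly_Mapping.keys p \<subseteq> F"
  shows "(\<Sum>d\<in>F. part w d p) = p"
proof (rule poly_mapping_eqI)
  fix \<alpha>
  have "(\<Sum>d\<in>F. if w \<alpha> = d then Poly_Mapping.lookup p \<alpha> else 0) = Poly_Mapping.lookup p \<alpha>"
  proof (cases "\<alpha> \<in> Poly_Mapping.keys p")
    case True
    then show ?thesis using assms by (simp add: image_subset_iff)
  qed (simp add: in_keys_iff)
  then show "Poly_Mapping.lookup (\<Sum>d\<in>F. part w d p) \<alpha> = Poly_Mapping.lookup p \<alpha>"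
    by (simp add: lookup_sum lookup_part)
qed

lemma graded_zero [simp]: "graded w d 0"
  by (simp add: graded_def)

lemma graded_add: "graded w d p \<Longrightarrow> graded w d q \<Longrightarrow> graded w d (p + q)"
  using keys_add[of p q] by (auto simp: graded_def)

lemma graded_uminus: "graded w d p \<Longrightarrow> graded w d (- p)"
  by (auto simp: graded_def in_keys_iff)

lemma graded_diff: "graded w d p \<Longrightarrow> graded w d q \<Longrightarrow> graded w d (p - q)"
  using graded_add[OF _ graded_uminus, of w d p q] by simp

locale grading =
  fixes w :: "('v \<Rightarrow>\<^sub>0 nat) \<Rightarrow> 'g::cancel_comm_monoid_add"
  assumes weight_add: "w (\<alpha> + \<beta>) = w \<alpha> + w \<beta>"
begin

lemma weight_zero [simp]: "w 0 = 0"
  using weight_add[of 0 0] by simp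

lemma graded_one: "graded w 0 1" and graded_Const: "graded w 0 (Const c)"
  by (simp_all add: graded_def Const_def)

lemma graded_mult:
  assumes "graded w d p" "graded w e q"
  shows "graded w (d + e) (p * q)"
  using keys_mult[of p q] assms by (auto simp: graded_def weight_add)

lemma part_mult_graded:
  assumes "graded w e q"
  shows "part w (d + e) (p * q) = part w d p * q"
proof (induction p rule: mpol_induct)
  case (single \<alpha> c)
  have "graded w (w \<alpha> + e) (Poly_Mapping.single \<alpha> c * q)"
    using assms by (intro graded_mult) (auto simp: graded_def)
  then show ?case by (simp add: part_of_graded part_single)
next
  case (add p1 p2)
  then show ?case by (simp add: distrib_right part_add)
qed

lemma part_mult_zero:
  assumes "\<And>a b. a + b = (0 :: 'g) \<Longrightarrow> a = 0 \<and> b = 0"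
  shows "part w 0 (p * q) = part w 0 p * part w 0 q"
proof (induction p rule: mpol_induct)
  case (single \<alpha> c)
  show ?case
  proof (induction q rule: mpol_induct)
    case (single \<beta> d)
    then show ?case using assms[of "w \<alpha>" "w \<beta>"] by (auto simp: mult_single part_single weight_add)
  next
    case (add p1 p2)
    then show ?case by (simp add: distrib_left part_add)
  qed
next
  case (add p1 p2)
  then show ?case by (simp add: distrib_right part_add)
qed

text \<open>In an indecomposable degree, taking the component is a derivation over the degree zero part.\<close>
lemma part_mult_indecomposable:
  assumes "\<And>a b. a + b = e \<Longrightarrow> a = 0 \<and> b = e \<or> a = e \<and> b = 0" and "e \<noteq> 0"
  shows "part w e (p * q) = part w 0 p * part w e q + part w e p * part w 0 q"
proof (induction p rule: mpol_induct)
  case (single \<alpha> c)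
  show ?case
  proof (induction q rule: mpol_induct)
    case (single \<beta> d)
    then show ?case using assms(1)[of "w \<alpha>" "w \<beta>"] assms(2)
      by (auto simp: mult_single part_single weight_add)
  next
    case (add p1 p2)
    then show ?case by (simp add: distrib_left part_add algebra_simps)
  qed
next
  case (add p1 p2)
  then show ?case by (simp add: distrib_right part_add algebra_simps)
qed

end

subsection \<open>Total degree\<close>

definition tdeg :: "('v \<Rightarrow>\<^sub>0 nat) \<Rightarrow> nat" where
  "tdeg \<alpha> = (\<Sum>v\<in>Poly_Mapping.keys \<alpha>. Poly_Mapping.lookup \<alpha> v)"

lemma tdeg_superset:
  "finite F \<Longrightarrow> Poly_Mapping.keys \<alpha> \<subseteq> F \<Longrightarrow> tdeg \<alpha> = (\<Sum>v\<in>F. Poly_Mapping.lookup \<alpha> v)"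
  unfolding tdeg_def by (rule sum.mono_neutral_left) (auto simp: in_keys_iff)

interpretation tdeg: grading tdeg
proof
  fix \<alpha> \<beta> :: "'v \<Rightarrow>\<^sub>0 nat"
  let ?F = "Poly_Mapping.keys \<alpha> \<union> Poly_Mapping.keys \<beta>"
  have "Poly_Mapping.keys (\<alpha> + \<beta>) \<subseteq> ?F" by (rule keys_add)
  then show "tdeg (\<alpha> + \<beta>) = tdeg \<alpha> + tdeg \<beta>"
    by (simp add: tdeg_superset[of ?F] lookup_add sum.distrib)
qed

lemma homogeneous_iff_graded: "homogeneous d p \<longleftrightarrow> graded tdeg d p"
  by (simp add: homogeneous_def graded_def tdeg_def)

lemma graded_tdeg_Var: "graded tdeg 1 (Var v)"
  by (simp add: graded_def Var_def tdeg_def)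

definition forms :: "'v set \<Rightarrow> nat \<Rightarrow> ('v, 'k::comm_ring_1) mpol set" where
  "forms A d = {p \<in> mpol_in A. homogeneous d p}"

lemma forms_zero [simp]: "0 \<in> forms A d"
  and forms_one [simp]: "1 \<in> forms A 0"
  and forms_Const [simp]: "Const c \<in> forms A 0"
  and forms_Var: "v \<in> A \<Longrightarrow> Var v \<in> forms A 1"
  by (auto simp: forms_def homogeneous_iff_graded tdeg.graded_one tdeg.graded_Const graded_tdeg_Var
      intro: mpol_in_Var[simplified] graded_tdeg_Var[simplified])

lemma forms_add: "p \<in> forms A d \<Longrightarrow> q \<in> forms A d \<Longrightarrow> p + q \<in> forms A d"
  and forms_diff: "p \<in> forms A d \<Longrightarrow> q \<in> forms A d \<Longrightarrow> p - q \<in> forms A d"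
  and forms_mult: "p \<in> forms A d \<Longrightarrow> q \<in> forms A e \<Longrightarrow> p * q \<in> forms A (d + e)"
  by (auto simp: forms_def homogeneous_iff_graded intro: mpol_in_add mpol_in_diff mpol_in_uminus
      mpol_in_mult graded_add graded_diff graded_uminus tdeg.graded_mult)

lemma forms_sum: "(\<And>i. i \<in> I \<Longrightarrow> p i \<in> forms A d) \<Longrightarrow> sum p I \<in> forms A d"
  by (induction I rule: infinite_finite_induct) (auto intro: forms_add)

lemma forms_prod: "(\<And>i. i \<in> I \<Longrightarrow> p i \<in> forms A (d i)) \<Longrightarrow> prod p I \<in> forms A (sum d I)"
  by (induction I rule: infinite_finite_induct) (auto intro: forms_mult)

lemma forms_power: "p \<in> forms A d \<Longrightarrow> p ^ n \<in> forms A (n * d)"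
  using forms_prod[of "{..<n}" "\<lambda>_. p" A "\<lambda>_. d"] by simp

lemma monom_val_scale_const:
  "monom_val (\<lambda>v. c * u v) \<alpha> = c ^ tdeg \<alpha> * monom_val u \<alpha>"
  by (simp add: monom_val_def tdeg_def power_mult_distrib prod.distrib power_sum)

lemma eval_mpol_scale_homogeneous:
  assumes "homogeneous d p"
  shows "eval_mpol h (\<lambda>v. c * u v) p = c ^ d * eval_mpol h u p"
  using assms unfolding eval_mpol_altdef sum_distrib_left
  by (intro sum.cong) (auto simp: homogeneous_iff_graded graded_def monom_val_scale_const mult_ac)

lemma forms_Const_mult: "q \<in> forms A e \<Longrightarrow> Const c * q \<in> forms A e"
  using forms_mult[OF forms_Const, of q A e c] by simp

section \<open>Multi-degrees\<close>

lemma multi_vars_finite: "multi_vars m r x \<Longrightarrow> finite (UNIV :: 'v set)"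
  for x :: "nat \<Rightarrow> nat \<Rightarrow> 'v"
  unfolding multi_vars_def by (metis bij_betw_finite finite_SigmaI finite_atLeastAtMost finite_atMost)

lemma multi_vars_cases:
  assumes "multi_vars m r x"
  obtains i j where "i \<in> {1..m}" "j \<le> r i" "v = x i j"
proof -
  have "v \<in> (\<lambda>(i, j). x i j) ` (SIGMA i:{1..m}. {..r i})"
    using assms by (auto simp: multi_vars_def bij_betw_def)
  then show ?thesis using that by auto
qed

lemma multi_vars_inj:
  assumes "multi_vars m r x" "i \<in> {1..m}" "j \<le> r i" "i' \<in> {1..m}" "j' \<le> r i'"
  shows "x i j = x i' j' \<longleftrightarrow> i = i' \<and> j = j'"
proof -
  have "inj_on (\<lambda>(i, j). x i j) (SIGMA i:{1..m}. {..r i})"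
    using assms(1) by (simp add: multi_vars_def bij_betw_def)
  from inj_on_eq_iff[OF this, of "(i, j)" "(i', j')"] show ?thesis using assms by simp
qed

lemma multi_vars_prod:
  assumes "multi_vars m r x"
  shows "(\<Prod>v\<in>UNIV. F v) = (\<Prod>i=1..m. \<Prod>j\<le>r i. F (x i j))"
proof -
  have "(\<Prod>v\<in>UNIV. F v) = (\<Prod>a\<in>(SIGMA i:{1..m}. {..r i}). F ((\<lambda>(i, j). x i j) a))"
    using assms by (simp add: multi_vars_def prod.reindex_bij_betw)
  also have "\<dots> = (\<Prod>i=1..m. \<Prod>j\<le>r i. F (x i j))"
    by (simp add: prod.Sigma split_def)
  finally show ?thesis .
qed

text \<open>
  Multi-degrees are finitely supported functions, rather than functions of which only the values
  at \<open>1, \<dots>, m\<close> matter, since these form a cancellative monoid with extensional equality.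
\<close>
definition mdeg :: "nat \<Rightarrow> (nat \<Rightarrow> nat) \<Rightarrow> (nat \<Rightarrow> nat \<Rightarrow> 'v) \<Rightarrow> ('v \<Rightarrow>\<^sub>0 nat) \<Rightarrow> (nat \<Rightarrow>\<^sub>0 nat)" where
  "mdeg m r x \<alpha> =
     (\<Sum>i=1..m. Poly_Mapping.single i (\<Sum>j\<le>r i. Poly_Mapping.lookup \<alpha> (x i j)))"

definition mdegree :: "nat \<Rightarrow> (nat \<Rightarrow> nat) \<Rightarrow> (nat \<Rightarrow>\<^sub>0 nat)" where
  "mdegree m d = (\<Sum>i=1..m. Poly_Mapping.single i (d i))"

lemma lookup_mdegree: "Poly_Mapping.lookup (mdegree m d) i = (if i \<in> {1..m} then d i else 0)"
  by (auto simp: mdegree_def lookup_sum lookup_single when_def)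

lemma mdeg_altdef: "mdeg m r x \<alpha> = mdegree m (\<lambda>i. \<Sum>j\<le>r i. Poly_Mapping.lookup \<alpha> (x i j))"
  by (simp add: mdeg_def mdegree_def)

interpretation mdeg: grading "mdeg m r x" for m r x
  by unfold_locales
    (simp add: mdeg_def lookup_add sum.distrib single_add)

lemma multi_homogeneous_iff_graded:
  "multi_homogeneous m r x d p \<longleftrightarrow> graded (mdeg m r x) (mdegree m d) p"
proof -
  have "mdeg m r x \<alpha> = mdegree m d \<longleftrightarrow>
      (\<forall>i\<in>{1..m}. (\<Sum>j\<le>r i. Poly_Mapping.lookup \<alpha> (x i j)) = d i)" for \<alpha>
    unfolding poly_mapping_eq_iff mdeg_altdef fun_eq_iff lookup_mdegree by auto
  then show ?thesis by (simp add: multi_homogeneous_def graded_def)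
qed

lemma mdegree_unit: "i \<in> {1..m} \<Longrightarrow> mdegree m (unit_degree i) = Poly_Mapping.single i 1"
  by (rule poly_mapping_eqI) (auto simp: lookup_mdegree unit_degree_def lookup_single when_def)

lemma degree_sum_eq_zero:
  assumes "a + b = (0 :: nat \<Rightarrow>\<^sub>0 nat)"
  shows "a = 0 \<and> b = 0"
proof -
  have "Poly_Mapping.lookup a i + Poly_Mapping.lookup b i = 0" for i
    using assms by (simp flip: lookup_add)
  then show ?thesis by (auto simp: poly_mapping_eq_iff fun_eq_iff)
qed

lemma degree_sum_eq_single:
  assumes "a + b = Poly_Mapping.single i (1 :: nat)"
  shows "a = 0 \<and> b = Poly_Mapping.single i 1 \<or> a = Poly_Mapping.single i 1 \<and> b = 0"
proof -
  have *: "Poly_Mapping.lookup a k + Poly_Mapping.lookup b k = (if k = i then 1 else 0)" for k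
    using assms by (simp flip: lookup_add add: lookup_single when_def)
  have "Poly_Mapping.lookup a k = 0 \<and> Poly_Mapping.lookup b k = 0" if "k \<noteq> i" for k
    using *[of k] that by simp
  then have off: "Poly_Mapping.lookup a k = (Poly_Mapping.lookup a i when k = i)"
      "Poly_Mapping.lookup b k = (Poly_Mapping.lookup b i when k = i)" for k
    by (cases "k = i"; simp)+
  have "a = Poly_Mapping.single i (Poly_Mapping.lookup a i)"
      "b = Poly_Mapping.single i (Poly_Mapping.lookup b i)"
    by (rule poly_mapping_eqI, subst off, simp add: lookup_single when_def)+
  moreover have "Poly_Mapping.lookup a i = 0 \<and> Poly_Mapping.lookup b i = 1 \<or>
      Poly_Mapping.lookup a i = 1 \<and> Poly_Mapping.lookup b i = 0"
    using *[of i] by auto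
  ultimately show ?thesis by (metis single_zero)
qed

lemma part_mdeg_mult_zero:
  "part (mdeg m r x) 0 (p * q) = part (mdeg m r x) 0 p * part (mdeg m r x) 0 q"
  by (rule mdeg.part_mult_zero) (rule degree_sum_eq_zero)

lemma part_mdeg_mult_single:
  "part (mdeg m r x) (Poly_Mapping.single i 1) (p * q) =
     part (mdeg m r x) 0 p * part (mdeg m r x) (Poly_Mapping.single i 1) q +
     part (mdeg m r x) (Poly_Mapping.single i 1) p * part (mdeg m r x) 0 q"
proof (rule mdeg.part_mult_indecomposable)
  show "Poly_Mapping.single i (1 :: nat) \<noteq> 0"
    by (metis lookup_single_eq lookup_zero one_neq_zero)
qed (rule degree_sum_eq_single)

context
  fixes m :: nat and r :: "nat \<Rightarrow> nat" and x :: "nat \<Rightarrow> nat \<Rightarrow> 'v"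
  assumes vars: "multi_vars m r x"
begin

lemma lookup_le_mdeg:
  assumes "i \<in> {1..m}" "j \<le> r i"
  shows "Poly_Mapping.lookup \<alpha> (x i j) \<le> Poly_Mapping.lookup (mdeg m r x \<alpha>) i"
  using assms member_le_sum[of j "{..r i}" "\<lambda>j. Poly_Mapping.lookup \<alpha> (x i j)"]
  by (simp add: mdeg_altdef lookup_mdegree)

lemma mdeg_eq_zero_iff: "mdeg m r x \<alpha> = 0 \<longleftrightarrow> \<alpha> = 0"
proof
  assume 0: "mdeg m r x \<alpha> = 0"
  show "\<alpha> = 0"
  proof (rule poly_mapping_eqI)
    fix v
    obtain i j where "i \<in> {1..m}" "j \<le> r i" "v = x i j"
      using multi_vars_cases[OF vars] .
    then show "Poly_Mapping.lookup \<alpha> v = Poly_Mapping.lookup 0 v"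
      using lookup_le_mdeg[of i j \<alpha>] 0 by simp
  qed
qed simp

lemma part_mdeg_zero: "part (mdeg m r x) 0 p = Const (Poly_Mapping.lookup p 0)"
  by (rule poly_mapping_eqI)
    (auto simp: lookup_part mdeg_eq_zero_iff Const_def lookup_single when_def)

lemma mdeg_single:
  assumes "i \<in> {1..m}" "j \<le> r i"
  shows "mdeg m r x (Poly_Mapping.single (x i j) 1) = Poly_Mapping.single i 1"
proof (rule poly_mapping_eqI)
  fix k
  have "(\<Sum>l\<le>r k. Poly_Mapping.lookup (Poly_Mapping.single (x i j) (1 :: nat)) (x k l)) =
      (if k = i then 1 else 0)" if k: "k \<in> {1..m}"
  proof -
    have "(\<Sum>l\<le>r k. Poly_Mapping.lookup (Poly_Mapping.single (x i j) (1 :: nat)) (x k l)) =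
        (\<Sum>l\<le>r k. if l = j \<and> k = i then 1 else 0)"
      using multi_vars_inj[OF vars assms k] by (intro sum.cong) (auto simp: lookup_single when_def)
    then show ?thesis using assms by auto
  qed
  then show "Poly_Mapping.lookup (mdeg m r x (Poly_Mapping.single (x i j) 1)) k =
      Poly_Mapping.lookup (Poly_Mapping.single i 1) k"
    using assms by (auto simp: mdeg_altdef lookup_mdegree lookup_single when_def)
qed

lemma mdeg_eq_single:
  assumes i: "i \<in> {1..m}" and \<alpha>: "mdeg m r x \<alpha> = Poly_Mapping.single i 1"
  obtains j where "j \<le> r i" "\<alpha> = Poly_Mapping.single (x i j) 1"
proof -
  have "(\<Sum>j\<le>r i. Poly_Mapping.lookup \<alpha> (x i j)) = 1"
    using arg_cong[OF \<alpha>, of "\<lambda>w. Poly_Mapping.lookup w i"] i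
    by (simp add: mdeg_altdef lookup_mdegree)
  then obtain j where j: "j \<le> r i" "Poly_Mapping.lookup \<alpha> (x i j) \<noteq> 0"
    by (metis atMost_iff sum.neutral zero_neq_one)
  define \<beta> where "\<beta> = \<alpha> - Poly_Mapping.single (x i j) 1"
  have \<alpha>\<beta>: "\<alpha> = \<beta> + Poly_Mapping.single (x i j) 1"
    using j by (intro poly_mapping_eqI) (auto simp: \<beta>_def lookup_add lookup_minus lookup_single when_def)
  have "mdeg m r x \<beta> + Poly_Mapping.single i 1 = Poly_Mapping.single i 1"
    using \<alpha> unfolding \<alpha>\<beta> by (simp add: mdeg.weight_add mdeg_single[OF i j(1), simplified])
  then have "\<beta> = 0" by (simp add: mdeg_eq_zero_iff)
  then show ?thesis using that j \<alpha>\<beta> by simp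
qed

lemma graded_Var: "i \<in> {1..m} \<Longrightarrow> j \<le> r i \<Longrightarrow> graded (mdeg m r x) (Poly_Mapping.single i 1) (Var (x i j))"
  by (simp add: graded_def Var_def mdeg_single[simplified])

text \<open>An exponent vector of multi-degree \<open>e\<^sub>i\<close> is a single variable of the \<open>i\<close>-th block.\<close>
lemma linear_form_expansion:
  assumes i: "i \<in> {1..m}" and p: "graded (mdeg m r x) (Poly_Mapping.single i 1) p"
  shows "p = (\<Sum>j\<le>r i. Const (Poly_Mapping.lookup p (Poly_Mapping.single (x i j) 1)) * Var (x i j))"
proof (rule poly_mapping_eqI)
  fix \<alpha>
  let ?s = "\<lambda>j. Poly_Mapping.single (x i j) (1 :: nat)"
  have "Poly_Mapping.lookup p \<alpha> = (\<Sum>j\<le>r i. Poly_Mapping.lookup p (?s j) when ?s j = \<alpha>)"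
  proof (cases "\<exists>j\<le>r i. \<alpha> = ?s j")
    case True
    then obtain j where j: "j \<le> r i" "\<alpha> = ?s j" by blast
    have "?s l = ?s j \<longleftrightarrow> l = j" if "l \<le> r i" for l
      using multi_vars_inj[OF vars i that i j(1)]
      by (metis lookup_single_eq lookup_single_not_eq zero_neq_one)
    then have "(\<Sum>l\<le>r i. Poly_Mapping.lookup p (?s l) when ?s l = ?s j) =
        (\<Sum>l\<le>r i. if l = j then Poly_Mapping.lookup p (?s j) else 0)"
      by (intro sum.cong) (auto simp: when_def)
    then show ?thesis using j by simp
  next
    case False
    then have "\<alpha> \<notin> Poly_Mapping.keys p"
      using p mdeg_eq_single[OF i] unfolding graded_def by metis
    moreover have "(\<Sum>j\<le>r i. Poly_Mapping.lookup p (?s j) when ?s j = \<alpha>) = 0"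
      using False by (intro sum.neutral) (auto simp: when_def)
    ultimately show ?thesis by (simp add: in_keys_iff)
  qed
  then show "Poly_Mapping.lookup p \<alpha> =
      Poly_Mapping.lookup (\<Sum>j\<le>r i. Const (Poly_Mapping.lookup p (?s j)) * Var (x i j)) \<alpha>"
    by (simp add: lookup_sum Const_def Var_def mult_single lookup_single)
qed

lemma monom_val_multi:
  "monom_val u \<alpha> = (\<Prod>i=1..m. \<Prod>j\<le>r i. u (x i j) ^ Poly_Mapping.lookup \<alpha> (x i j))"
  by (subst monom_val_superset[of UNIV])
    (auto simp: multi_vars_finite[OF vars] multi_vars_prod[OF vars])

text \<open>
  For tuples \<open>u\<close> and \<open>u'\<close> that represent the same point of the product of projective spaces. The
  factors on both sides avoid division, as the ring is not a field in general.
\<close>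
lemma eval_mpol_rescale:
  assumes p: "multi_homogeneous m r x d p"
    and u: "\<And>i j. i \<in> {1..m} \<Longrightarrow> j \<le> r i \<Longrightarrow> a i * u (x i j) = b i * u' (x i j)"
  shows "(\<Prod>i=1..m. a i ^ d i) * eval_mpol h u p = (\<Prod>i=1..m. b i ^ d i) * eval_mpol h u' p"
proof -
  have scale: "(\<Prod>i=1..m. c i ^ d i) * monom_val w \<alpha> =
      (\<Prod>i=1..m. \<Prod>j\<le>r i. (c i * w (x i j)) ^ Poly_Mapping.lookup \<alpha> (x i j))"
    if "\<alpha> \<in> Poly_Mapping.keys p" for \<alpha> c w
  proof -
    have "(\<Prod>i=1..m. c i ^ d i) =
        (\<Prod>i=1..m. c i ^ (\<Sum>j\<le>r i. Poly_Mapping.lookup \<alpha> (x i j)))"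
      using p that by (intro prod.cong) (auto simp: multi_homogeneous_def)
    then show ?thesis by (simp add: monom_val_multi power_mult_distrib prod.distrib power_sum)
  qed
  have "(\<Prod>i=1..m. a i ^ d i) * monom_val u \<alpha> = (\<Prod>i=1..m. b i ^ d i) * monom_val u' \<alpha>"
    if "\<alpha> \<in> Poly_Mapping.keys p" for \<alpha>
    unfolding scale[OF that] using u by simp
  then show ?thesis
    unfolding eval_mpol_altdef sum_distrib_left by (intro sum.cong) (auto simp: mult.left_commute)
qed

lemma subst_mpol_forms:
  assumes p: "multi_homogeneous m r x d p"
    and g: "\<And>i j. i \<in> {1..m} \<Longrightarrow> j \<le> r i \<Longrightarrow> g (x i j) \<in> forms A (e i)"
  shows "subst_mpol g p \<in> forms A (\<Sum>i=1..m. d i * e i)"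
proof -
  have "monom_val g \<alpha> \<in> forms A (\<Sum>i=1..m. d i * e i)" if "\<alpha> \<in> Poly_Mapping.keys p" for \<alpha>
  proof -
    have "monom_val g \<alpha> \<in> forms A (\<Sum>i=1..m. \<Sum>j\<le>r i. Poly_Mapping.lookup \<alpha> (x i j) * e i)"
      unfolding monom_val_multi using g by (intro forms_prod forms_power) auto
    also have "(\<Sum>i=1..m. \<Sum>j\<le>r i. Poly_Mapping.lookup \<alpha> (x i j) * e i) = (\<Sum>i=1..m. d i * e i)"
      using p that by (intro sum.cong) (auto simp: multi_homogeneous_def simp flip: sum_distrib_right)
    finally show ?thesis .
  qed
  then show ?thesis
    unfolding eval_mpol_altdef by (intro forms_sum forms_Const_mult)
qed

end

section \<open>Linear dependence over integral domains\<close>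

text \<open>
  The homogeneous parts of a graded subring. The subring matters as the coefficients of linear
  dependences between vectors over \<open>\<K>[y\<^sub>0, \<dots>, y\<^sub>N]\<close> have to be in this ring again, and the
  grading as dominance only concerns forms.
\<close>
locale graded_family =
  fixes F :: "nat \<Rightarrow> 'a::idom set"
  assumes zero_mem: "0 \<in> F d" and one_mem: "1 \<in> F 0"
    and diff_mem: "a \<in> F d \<Longrightarrow> b \<in> F d \<Longrightarrow> a - b \<in> F d"
    and mult_mem: "a \<in> F d \<Longrightarrow> b \<in> F e \<Longrightarrow> a * b \<in> F (d + e)"
begin

lemma uminus_mem: "a \<in> F d \<Longrightarrow> - a \<in> F d"
  using diff_mem[OF zero_mem, of a d] by simp

lemma sum_mem: "(\<And>i. i \<in> I \<Longrightarrow> a i \<in> F d) \<Longrightarrow> sum a I \<in> F d"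
proof (induction I rule: infinite_finite_induct)
  case (insert i I)
  have "a i - (- sum a I) \<in> F d" using insert by (intro diff_mem uminus_mem) auto
  then show ?case using insert by simp
qed (simp_all add: zero_mem)

text \<open>
  Fraction-free Gaussian elimination: eliminating one coordinate replaces vectors with entries of
  degree \<open>d\<close> by vectors with entries of degree \<open>2 d\<close>, so that the coefficients of the dependence
  that is found are all of one degree.
\<close>
lemma linear_dependence:
  assumes "finite J" "finite B" "card J < card B"
    and "\<And>c j. c \<in> B \<Longrightarrow> j \<in> J \<Longrightarrow> v c j \<in> F d"
  shows "\<exists>e b. (\<forall>c\<in>B. b c \<in> F e) \<and> (\<exists>c\<in>B. b c \<noteq> 0) \<and> (\<forall>j\<in>J. (\<Sum>c\<in>B. b c * v c j) = 0)"
  using assms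
proof (induction J arbitrary: B v d rule: finite_induct)
  case empty
  then show ?case
    by (intro exI[of _ 0] exI[of _ "\<lambda>_. 1"]) (auto simp: one_mem card_gt_0_iff)
next
  case (insert j J)
  show ?case
  proof (cases "\<exists>c0\<in>B. v c0 j \<noteq> 0")
    case False
    have "\<exists>e b. (\<forall>c\<in>B. b c \<in> F e) \<and> (\<exists>c\<in>B. b c \<noteq> 0) \<and> (\<forall>j\<in>J. (\<Sum>c\<in>B. b c * v c j) = 0)"
      using insert.prems insert.hyps by (intro insert.IH[of B v d]) auto
    then show ?thesis using False by auto
  next
    case True
    then obtain c0 where c0: "c0 \<in> B" "v c0 j \<noteq> 0" by blast
    define v' where "v' = (\<lambda>c k. v c0 j * v c k - v c j * v c0 k)"
    let ?B = "B - {c0}"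
    have "\<exists>e b. (\<forall>c\<in>?B. b c \<in> F e) \<and> (\<exists>c\<in>?B. b c \<noteq> 0) \<and>
        (\<forall>k\<in>J. (\<Sum>c\<in>?B. b c * v' c k) = 0)"
    proof (rule insert.IH[of ?B v' "d + d"])
      show "card J < card ?B" using insert.prems insert.hyps c0 by simp
    qed (use insert.prems c0 in \<open>auto simp: v'_def intro!: diff_mem mult_mem\<close>)
    then obtain e b where b: "\<And>c. c \<in> ?B \<Longrightarrow> b c \<in> F e" "\<exists>c\<in>?B. b c \<noteq> 0"
        "\<And>k. k \<in> J \<Longrightarrow> (\<Sum>c\<in>?B. b c * v' c k) = 0"
      by blast
    define b' where "b' = (\<lambda>c. if c = c0 then - (\<Sum>c\<in>?B. b c * v c j) else b c * v c0 j)"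
    have "b' c \<in> F (e + d)" if "c \<in> B" for c
      unfolding b'_def using that b(1) insert.prems(3) c0
      by (auto intro!: uminus_mem sum_mem mult_mem)
    moreover have "\<exists>c\<in>B. b' c \<noteq> 0"
      using b(2) c0 by (auto simp: b'_def)
    moreover have "(\<Sum>c\<in>B. b' c * v c k) = 0" if "k \<in> insert j J" for k
    proof -
      have "(\<Sum>c\<in>B. b' c * v c k) = b' c0 * v c0 k + (\<Sum>c\<in>?B. b' c * v c k)"
        using insert.prems c0 by (intro sum.remove) auto
      also have "(\<Sum>c\<in>?B. b' c * v c k) = (\<Sum>c\<in>?B. b c * v c0 j * v c k)"
        by (intro sum.cong) (auto simp: b'_def)
      also have "b' c0 * v c0 k = - (\<Sum>c\<in>?B. b c * (v c j * v c0 k))"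
        by (simp add: b'_def sum_distrib_right mult.assoc)
      also have "- (\<Sum>c\<in>?B. b c * (v c j * v c0 k)) + (\<Sum>c\<in>?B. b c * v c0 j * v c k) =
          (\<Sum>c\<in>?B. b c * v' c k)"
        by (simp add: v'_def sum_subtractf right_diff_distrib mult.assoc)
      also have "\<dots> = 0"
        using that b(3) by (cases "k = j") (auto simp: v'_def mult_ac)
      finally show ?thesis .
    qed
    ultimately show ?thesis by blast
  qed
qed

lemma card_le_of_independent:
  assumes "finite J" "finite B"
    and "\<And>c j. c \<in> B \<Longrightarrow> j \<in> J \<Longrightarrow> v c j \<in> F d"
    and "\<And>e b. (\<And>c. c \<in> B \<Longrightarrow> b c \<in> F e) \<Longrightarrow> (\<And>j. j \<in> J \<Longrightarrow> (\<Sum>c\<in>B. b c * v c j) = 0) \<Longrightarrow>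
      (\<And>c. c \<in> B \<Longrightarrow> b c = 0)"
  shows "card B \<le> card J"
proof (rule ccontr)
  assume "\<not> card B \<le> card J"
  then have less: "card J < card B" by simp
  have "\<exists>e b. (\<forall>c\<in>B. b c \<in> F e) \<and> (\<exists>c\<in>B. b c \<noteq> 0) \<and> (\<forall>j\<in>J. (\<Sum>c\<in>B. b c * v c j) = 0)"
    by (rule linear_dependence[OF assms(1,2) less assms(3)])
  then obtain e b c where "\<And>c. c \<in> B \<Longrightarrow> b c \<in> F e" "c \<in> B" "b c \<noteq> 0"
      "\<And>j. j \<in> J \<Longrightarrow> (\<Sum>c\<in>B. b c * v c j) = 0"
    by (elim exE conjE bexE) (rule that, auto)
  then show False using assms(4)[of b e c] by blast
qed

end

interpretation ungraded: graded_family "\<lambda>_. UNIV :: 'a::idom set"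
  by unfold_locales auto

lemma graded_family_forms: "graded_family (forms A :: nat \<Rightarrow> ('v::linorder, 'k::field) mpol set)"
  by unfold_locales (auto intro: forms_diff forms_mult)

section \<open>The rank over the fraction field\<close>

lemma hom_Fract: "comm_ring_hom (\<lambda>a :: 'a::idom. Fract a 1)"
proof
  show "Fract (0 :: 'a) 1 = 0" by (rule Zero_fract_def[symmetric])
  show "Fract (1 :: 'a) 1 = 1" by (rule One_fract_def[symmetric])
  show "Fract (a + b) 1 = Fract a 1 + Fract b 1" for a b :: 'a by (subst add_fract) simp_all
  show "Fract (a * b) 1 = Fract a 1 * Fract b 1" for a b :: 'a by (subst mult_fract) simp_all
qed

text \<open>
  A maximal independent set of columns, described without the fraction field. Of maximality only
  the consequence is recorded that a vector which annihilates these columns annihilates all.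
\<close>
lemma fract_rank_witness:
  fixes A :: "'a::idom mat"
  shows "\<exists>S\<subseteq>{..<dim_col A}. card S = fract_rank A \<and>
    (\<forall>b. (\<forall>k<dim_row A. (\<Sum>c\<in>S. b c * A $$ (k, c)) = 0) \<longrightarrow> (\<forall>c\<in>S. b c = 0)) \<and>
    (\<forall>h. (\<forall>c\<in>S. (\<Sum>k<dim_row A. h k * A $$ (k, c)) = 0) \<longrightarrow>
      (\<forall>c<dim_col A. (\<Sum>k<dim_row A. h k * A $$ (k, c)) = 0))"
proof -
  let ?\<iota> = "\<lambda>a. Fract a (1 :: 'a)"
  interpret \<iota>: comm_ring_hom ?\<iota> by (rule hom_Fract)
  have \<iota>0: "?\<iota> a = 0 \<longleftrightarrow> a = 0" for a
    unfolding Zero_fract_def by (subst eq_fract) simp_all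
  define n where "n = dim_row A"
  define Q where "Q = map_mat ?\<iota> A"
  interpret V: vec_space "TYPE('a fract)" n .
  have Q: "Q \<in> carrier_mat n (dim_col A)" by (auto simp: Q_def n_def)
  have colsQ: "set (cols Q) \<subseteq> carrier_vec n" using Q cols_dim by blast
  let ?P = "\<lambda>T. T \<subseteq> set (cols Q) \<and> V.lin_indpt T"
  have "?P {}" unfolding V.lin_dep_def by simp
  then obtain T where T: "finite T" "maximal T ?P"
    using maximal_exists_superset[of "set (cols Q)" ?P "{}"] by auto
  have Tsub: "T \<subseteq> set (cols Q)" and Tind: "V.lin_indpt T"
    using T(2) by (auto simp: maximal_def)
  have rank: "card T = fract_rank A"
    using V.rank_card_indpt[OF Q T(2)] by (simp add: fract_rank_def n_def Q_def)
  have "\<exists>c. c < dim_col A \<and> col Q c = v" if "v \<in> T" for v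
  proof -
    have "v \<in> col Q ` {0..<dim_col A}" using that Tsub Q by (auto simp: cols_def)
    then show ?thesis by auto
  qed
  then obtain g where g: "\<And>v. v \<in> T \<Longrightarrow> g v < dim_col A" "\<And>v. v \<in> T \<Longrightarrow> col Q (g v) = v"
    by metis
  have inj: "inj_on g T" by (rule inj_on_inverseI[of _ "col Q"]) (use g in auto)
  have entry: "v $ k = ?\<iota> (A $$ (k, g v))" if "v \<in> T" "k < n" for v k
  proof -
    have "v $ k = col Q (g v) $ k" by (simp only: g(2)[OF that(1)])
    also have "\<dots> = Q $$ (k, g v)" using that g(1)[OF that(1)] Q by (intro index_col) auto
    finally show ?thesis using that g(1)[OF that(1)] by (simp add: Q_def n_def)
  qed
  show ?thesis
  proof (intro exI[of _ "g ` T"] conjI allI impI ballI)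
    show "g ` T \<subseteq> {..<dim_col A}" using g by auto
    show "card (g ` T) = fract_rank A" using rank by (simp add: card_image inj)
  next
    fix b c
    assume rel: "\<forall>k<dim_row A. (\<Sum>c\<in>g ` T. b c * A $$ (k, c)) = 0" and c: "c \<in> g ` T"
    obtain v where v: "v \<in> T" "c = g v" using c by blast
    show "b c = 0"
    proof (rule ccontr)
      assume nz: "b c \<noteq> 0"
      have "V.lincomb (\<lambda>v. ?\<iota> (b (g v))) T = 0\<^sub>v n"
      proof (rule eq_vecI)
        show "dim_vec (V.lincomb (\<lambda>v. ?\<iota> (b (g v))) T) = dim_vec (0\<^sub>v n)"
          using Tsub colsQ by (auto intro: V.lincomb_dim T(1))
      next
        fix k assume "k < dim_vec (0\<^sub>v n :: 'a fract vec)"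
        then have k: "k < n" by simp
        have "V.lincomb (\<lambda>v. ?\<iota> (b (g v))) T $ k = (\<Sum>v\<in>T. ?\<iota> (b (g v)) * v $ k)"
          using Tsub colsQ by (intro V.lincomb_index k) auto
        also have "\<dots> = (\<Sum>v\<in>T. ?\<iota> (b (g v) * A $$ (k, g v)))"
          by (intro sum.cong) (auto simp: entry k \<iota>.hom_mult simp del: mult_fract)
        also have "\<dots> = ?\<iota> (\<Sum>v\<in>T. b (g v) * A $$ (k, g v))"
          by (simp only: \<iota>.hom_sum)
        also have "(\<Sum>v\<in>T. b (g v) * A $$ (k, g v)) = 0"
          using rel k by (simp add: sum.reindex inj n_def)
        finally show "V.lincomb (\<lambda>v. ?\<iota> (b (g v))) T $ k = 0\<^sub>v n $ k"
          using k by (simp add: \<iota>0)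
      qed
      then have "V.lin_dep T"
        using v nz T(1) by (intro V.lin_dep_crit[where A = T and a = "\<lambda>v. ?\<iota> (b (g v))" and v = v])
            (auto simp: \<iota>0)
      then show False using Tind by simp
    qed
  next
    fix h c
    assume orth: "\<forall>c\<in>g ` T. (\<Sum>k<dim_row A. h k * A $$ (k, c)) = 0" and c: "c < dim_col A"
    have "col Q c \<in> V.span T"
    proof (rule ccontr)
      assume n: "col Q c \<notin> V.span T"
      have Tc: "T \<subseteq> carrier_vec n" using Tsub colsQ by blast
      have cc: "col Q c \<in> carrier_vec n" using Q c by auto
      have "col Q c \<notin> T" using n V.span_mem[OF Tc] by blast
      then have "V.lin_indpt (T \<union> {col Q c})"
        using V.lin_dep_iff_in_span[OF Tc Tind cc] n by blast
      moreover have "col Q c \<in> set (cols Q)" using c Q by (auto simp: cols_def)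
      ultimately have "T \<union> {col Q c} = T"
        using T(2) Tsub unfolding maximal_def by blast
      then show False using \<open>col Q c \<notin> T\<close> by blast
    qed
    then obtain a U where U: "col Q c = V.lincomb a U" "finite U" "U \<subseteq> T"
      using V.in_spanE by blast
    have "?\<iota> (\<Sum>k<n. h k * A $$ (k, c)) = (\<Sum>k<n. ?\<iota> (h k) * ?\<iota> (A $$ (k, c)))"
      by (simp only: \<iota>.hom_sum \<iota>.hom_mult)
    also have "\<dots> = (\<Sum>k<n. ?\<iota> (h k) * (\<Sum>v\<in>U. a v * ?\<iota> (A $$ (k, g v))))"
    proof (intro sum.cong refl)
      fix k assume "k \<in> {..<n}"
      then have k: "k < n" by simp
      have "?\<iota> (A $$ (k, c)) = col Q c $ k" using k c by (simp add: Q_def n_def)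
      also have "\<dots> = (\<Sum>v\<in>U. a v * v $ k)"
        unfolding U(1) using U Tsub colsQ by (intro V.lincomb_index k) auto
      also have "\<dots> = (\<Sum>v\<in>U. a v * ?\<iota> (A $$ (k, g v)))"
        using U k by (intro sum.cong) (auto simp: entry)
      finally show "?\<iota> (h k) * ?\<iota> (A $$ (k, c)) =
          ?\<iota> (h k) * (\<Sum>v\<in>U. a v * ?\<iota> (A $$ (k, g v)))" by simp
    qed
    also have "\<dots> = (\<Sum>v\<in>U. a v * (\<Sum>k<n. ?\<iota> (h k) * ?\<iota> (A $$ (k, g v))))"
      unfolding sum_distrib_left by (subst sum.swap) (simp only: mult_ac)
    also have "\<dots> = (\<Sum>v\<in>U. a v * ?\<iota> (\<Sum>k<n. h k * A $$ (k, g v)))"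
      by (simp only: \<iota>.hom_sum \<iota>.hom_mult)
    also have "\<dots> = 0"
    proof (intro sum.neutral ballI)
      fix v assume "v \<in> U"
      then have "(\<Sum>k<n. h k * A $$ (k, g v)) = 0" using orth U by (auto simp: n_def)
      then show "a v * ?\<iota> (\<Sum>k<n. h k * A $$ (k, g v)) = 0" by (simp add: \<iota>0)
    qed
    finally show "(\<Sum>k<dim_row A. h k * A $$ (k, c)) = 0" by (simp add: \<iota>0 n_def)
  qed
qed

text \<open>
  A column relation has \<open>f\<close>-weighted sum zero and vanishes at the rows in \<open>Z\<close>, so if it vanishes at
  all rows other than \<open>k1\<close> then it vanishes at \<open>k1\<close> as well.
\<close>
lemma fract_rank_le:
  fixes A :: "'a::idom mat"
  assumes row: "dim_row A = N + 1" and f: "k1 \<le> N" "f k1 \<noteq> 0"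
    and orth: "\<And>c. c < dim_col A \<Longrightarrow> (\<Sum>k\<le>N. f k * A $$ (k, c)) = 0"
    and Z: "Z \<subseteq> {..N} - {k1}" and zero: "\<And>k c. k \<in> Z \<Longrightarrow> c < dim_col A \<Longrightarrow> A $$ (k, c) = 0"
  shows "fract_rank A + card Z \<le> N"
proof -
  obtain S where S: "S \<subseteq> {..<dim_col A}" "card S = fract_rank A"
    and ind: "\<forall>b. (\<forall>k<dim_row A. (\<Sum>c\<in>S. b c * A $$ (k, c)) = 0) \<longrightarrow> (\<forall>c\<in>S. b c = 0)"
    using fract_rank_witness[of A] by blast
  have fin: "finite S" "finite Z" using S Z finite_subset by blast+
  have "card S \<le> card ({..N} - {k1} - Z)"
  proof (rule ungraded.card_le_of_independent[where v = "\<lambda>c k. A $$ (k, c)"])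
    fix b c
    assume rel: "\<And>k. k \<in> {..N} - {k1} - Z \<Longrightarrow> (\<Sum>c\<in>S. b c * A $$ (k, c)) = 0" and c: "c \<in> S"
    have rel': "(\<Sum>c\<in>S. b c * A $$ (k, c)) = 0" if "k \<in> {..N} - {k1}" for k
    proof (cases "k \<in> Z")
      case True
      then show ?thesis using zero S by (intro sum.neutral) auto
    qed (use rel that in blast)
    have "(\<Sum>k\<le>N. f k * (\<Sum>c\<in>S. b c * A $$ (k, c))) = (\<Sum>c\<in>S. b c * (\<Sum>k\<le>N. f k * A $$ (k, c)))"
      unfolding sum_distrib_left by (subst sum.swap) (simp only: mult_ac)
    also have "\<dots> = 0" using S orth by (intro sum.neutral) auto
    finally have "f k1 * (\<Sum>c\<in>S. b c * A $$ (k1, c)) +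
        (\<Sum>k\<in>{..N} - {k1}. f k * (\<Sum>c\<in>S. b c * A $$ (k, c))) = 0"
      using f by (simp add: sum.remove[of "{..N}" k1])
    moreover have "(\<Sum>k\<in>{..N} - {k1}. f k * (\<Sum>c\<in>S. b c * A $$ (k, c))) = 0"
      using rel' by (intro sum.neutral) simp
    ultimately have "(\<Sum>c\<in>S. b c * A $$ (k1, c)) = 0" using f by simp
    then have "(\<Sum>c\<in>S. b c * A $$ (k, c)) = 0" if "k < dim_row A" for k
      using rel'[of k] that row by (cases "k = k1") auto
    then show "b c = 0" using ind c by blast
  qed (use fin in auto)
  also have "\<dots> = N - card Z" using f Z fin by (simp add: card_Diff_subset)
  finally have "card S \<le> N - card Z" .
  moreover have "card Z \<le> card ({..N} - {k1})" using Z by (intro card_mono) auto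
  ultimately show ?thesis using S f by simp
qed

text \<open>
  With fewer than \<open>N\<close> independent columns, the linear system for a vector that annihilates them
  and has coordinate \<open>k1\<close> zero would have a nontrivial solution, which is not proportional to \<open>f\<close>.
\<close>
lemma fract_rank_ge:
  fixes A :: "'a::idom mat"
  assumes row: "dim_row A = N + 1" and f: "k1 \<le> N" "f k1 \<noteq> 0"
    and kernel: "\<And>h k l. (\<And>c. c < dim_col A \<Longrightarrow> (\<Sum>k\<le>N. h k * A $$ (k, c)) = 0) \<Longrightarrow>
      k \<le> N \<Longrightarrow> l \<le> N \<Longrightarrow> f k * h l = f l * h k"
  shows "N \<le> fract_rank A"
proof -
  obtain S where S: "S \<subseteq> {..<dim_col A}" "card S = fract_rank A"
    and ind: "\<forall>b. (\<forall>k<dim_row A. (\<Sum>c\<in>S. b c * A $$ (k, c)) = 0) \<longrightarrow> (\<forall>c\<in>S. b c = 0)"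
    and ext: "\<forall>h. (\<forall>c\<in>S. (\<Sum>k<dim_row A. h k * A $$ (k, c)) = 0) \<longrightarrow>
      (\<forall>c<dim_col A. (\<Sum>k<dim_row A. h k * A $$ (k, c)) = 0)"
    using fract_rank_witness[of A] by blast
  have fin: "finite S" using S finite_subset by blast
  have rows: "{..<dim_row A} = {..N}" using row by auto
  have "card ({..N} - {k1}) \<le> card S"
  proof (rule ungraded.card_le_of_independent[where v = "\<lambda>k c. A $$ (k, c)"])
    fix b k
    assume rel: "\<And>c. c \<in> S \<Longrightarrow> (\<Sum>k\<in>{..N} - {k1}. b k * A $$ (k, c)) = 0" and k: "k \<in> {..N} - {k1}"
    define h where "h = (\<lambda>k. if k = k1 then 0 else b k)"
    have "(\<Sum>k<dim_row A. h k * A $$ (k, c)) = 0" if "c \<in> S" for c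
      using rel[OF that] f unfolding rows
      by (subst sum.remove[of "{..N}" k1]) (auto simp: h_def cong: sum.cong_simp)
    then have "(\<Sum>k<dim_row A. h k * A $$ (k, c)) = 0" if "c < dim_col A" for c
      using ext that by blast
    then have "f k1 * h k = f k * h k1"
      using kernel[of h k1 k] f k unfolding rows by auto
    then show "b k = 0" using f k by (simp add: h_def)
  qed (use fin in auto)
  then show ?thesis using S f by simp
qed

section \<open>Ideals of linear type\<close>

interpretation ideal: Modules.module "(*) :: 'a::comm_ring_1 \<Rightarrow> 'a \<Rightarrow> 'a"
  by unfold_locales (simp_all add: algebra_simps)

text \<open>For the ring as a module over itself this rewrite rule undoes \<open>mult.assoc\<close>.\<close>
declare ideal.scale_scale [simp del]

lemma ideal_gen_UNIV: "ideal_gen UNIV S = ideal.span S"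
  by (auto simp: ideal_gen_def ideal.span_explicit)

lemma additive_vanishes_on_span:
  assumes "Modules.additive E" "\<And>c s. s \<in> S \<Longrightarrow> E (c * s) = 0" "p \<in> ideal.span S"
  shows "E p = 0"
proof -
  interpret Modules.additive E by fact
  show ?thesis using assms(3)
    by (induction rule: ideal.span_induct_alt) (auto simp: zero add assms(2))
qed

lemma prod_diff_in_span:
  assumes "\<And>i. i \<in> F \<Longrightarrow> a i - b i \<in> ideal.span S"
  shows "prod a F - prod b F \<in> ideal.span S"
  using assms
proof (induction F rule: infinite_finite_induct)
  case (insert i F)
  have "a i * prod a F - b i * prod b F =
      a i * (prod a F - prod b F) + prod b F * (a i - b i)"
    by (simp add: algebra_simps)
  also have "\<dots> \<in> ideal.span S"
    using insert by (intro ideal.span_add ideal.span_scale) auto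
  finally show ?case using insert by simp
qed (auto simp: ideal.span_zero)

lemma eval_mpol_diff_in_span:
  assumes "\<And>v. v \<in> A \<Longrightarrow> u v - u' v \<in> ideal.span S" "p \<in> mpol_in A"
  shows "eval_mpol h u p - eval_mpol h u' p \<in> ideal.span S"
proof -
  have pow: "u v ^ n - u' v ^ n \<in> ideal.span S" if "v \<in> A" for v n
    using prod_diff_in_span[of "{..<n}" "\<lambda>_. u v" "\<lambda>_. u' v" S] assms(1)[OF that] by simp
  have "monom_val u \<alpha> - monom_val u' \<alpha> \<in> ideal.span S" if "\<alpha> \<in> Poly_Mapping.keys p" for \<alpha>
    unfolding monom_val_def using that assms(2)
    by (intro prod_diff_in_span pow) (auto simp: mpol_in_def)
  then show ?thesis
    unfolding eval_mpol_altdef sum_subtractf[symmetric] right_diff_distrib[symmetric]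
    by (intro ideal.span_sum ideal.span_scale)
qed

definition lin_form :: "nat \<Rightarrow> (nat \<Rightarrow> 'a::comm_ring_1) \<Rightarrow> (nat, 'a) mpol" where
  "lin_form N s = (\<Sum>k\<le>N. Const (s k) * Var k)"

text \<open>
  The symmetric algebra of the ideal generated by \<open>f\<close> is the quotient of \<open>R[y\<^sub>0, \<dots>, y\<^sub>N]\<close> by the
  ideal that these linear forms generate.
\<close>
definition relation_forms :: "nat \<Rightarrow> (nat \<Rightarrow> 'a::comm_ring_1) \<Rightarrow> (nat, 'a) mpol set" where
  "relation_forms N f = {lin_form N s | s. (\<Sum>k\<le>N. s k * f k) = 0}"

lemma lin_form_diff: "lin_form N s - lin_form N t = lin_form N (\<lambda>k. s k - t k)"
proof -
  interpret C: comm_ring_hom "Const :: 'a \<Rightarrow> (nat, 'a) mpol" by (rule hom_Const)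
  show ?thesis by (simp add: lin_form_def C.hom_minus left_diff_distrib sum_subtractf)
qed

lemma Const_mult_lin_form: "Const c * lin_form N s = lin_form N (\<lambda>k. c * s k)"
proof -
  interpret C: comm_ring_hom "Const :: 'a \<Rightarrow> (nat, 'a) mpol" by (rule hom_Const)
  show ?thesis by (simp add: lin_form_def C.hom_mult sum_distrib_left mult_ac)
qed

lemma Var_eq_lin_form: "k \<le> N \<Longrightarrow> Var k = lin_form N (\<lambda>l. if l = k then 1 else 0)"
proof -
  assume "k \<le> N"
  have "lin_form N (\<lambda>l. if l = k then 1 else 0 :: 'a) = (\<Sum>l\<le>N. if l = k then Var k else 0)"
    unfolding lin_form_def by (intro sum.cong) (auto simp: Const_def)
  with \<open>k \<le> N\<close> show ?thesis by simp
qed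

lemma hom_const_poly: "comm_ring_hom (\<lambda>c :: 'a::comm_ring_1. [:c:])"
  by unfold_locales (auto simp: one_pCons)

lemma hom_id: "comm_ring_hom (\<lambda>c :: 'a::comm_ring_1. c)"
  by unfold_locales auto

text \<open>
  Each \<open>a \<in> I\<close> has coordinates \<open>\<rho> a\<close> with respect to \<open>f\<close>. They need not depend linearly on \<open>a\<close>,
  but the failure of linearity is a syzygy. So sending the variable of \<open>a\<close> to \<open>\<Sum>\<^sub>k \<rho> a k y\<^sub>k\<close>
  maps the defining relations of the symmetric algebra to forms given by syzygies.
\<close>
lemma sym_cong_to_span:
  assumes I: "I = ideal_gen UNIV (f ` {..N})"
    and gen: "\<And>a. a \<in> I \<Longrightarrow> (\<Sum>k\<le>N. \<rho> a k * f k) = a"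
    and D: "D \<in> ideal_gen A (sym_relations I)"
  shows "eval_mpol Const (\<lambda>a. lin_form N (\<rho> a)) D \<in> ideal.span (relation_forms N f)"
proof -
  let ?\<theta> = "eval_mpol Const (\<lambda>a. lin_form N (\<rho> a))"
  interpret C: comm_ring_hom "Const :: 'a \<Rightarrow> (nat, 'a) mpol" by (rule hom_Const)
  interpret \<theta>: comm_ring_hom ?\<theta> by (rule hom_eval_mpol[OF hom_Const])
  have add: "a + b \<in> I" if "a \<in> I" "b \<in> I" for a b
    using that unfolding I ideal_gen_UNIV by (rule ideal.span_add)
  have mult: "c * a \<in> I" if "a \<in> I" for a c
    using that unfolding I ideal_gen_UNIV by (rule ideal.span_scale)
  have \<theta>V: "?\<theta> (Var a) = lin_form N (\<rho> a)" for a by (simp add: eval_mpol_Var)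
  have "?\<theta> R \<in> relation_forms N f" if "R \<in> sym_relations I" for R
  proof -
    consider a b where "a \<in> I" "b \<in> I" "R = Var (a + b) - Var a - Var b"
      | c a where "a \<in> I" "R = Var (c * a) - Const c * Var a"
      using \<open>R \<in> sym_relations I\<close> by (auto simp: sym_relations_def)
    then show ?thesis
    proof cases
      case (1 a b)
      have "?\<theta> R = lin_form N (\<lambda>k. \<rho> (a + b) k - \<rho> a k - \<rho> b k)"
        by (simp add: 1 \<theta>.hom_minus \<theta>V lin_form_diff)
      moreover have "(\<Sum>k\<le>N. (\<rho> (a + b) k - \<rho> a k - \<rho> b k) * f k) = 0"
        by (simp add: left_diff_distrib sum_subtractf gen 1 add)
      ultimately show ?thesis by (auto simp: relation_forms_def)
    next
      case (2 c a)
      have "?\<theta> R = lin_form N (\<lambda>k. \<rho> (c * a) k - c * \<rho> a k)"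
        by (simp add: 2 \<theta>.hom_minus \<theta>.hom_mult \<theta>V lin_form_diff eval_mpol_Const Const_mult_lin_form)
      moreover have "(\<Sum>k\<le>N. (\<rho> (c * a) k - c * \<rho> a k) * f k) = 0"
        by (simp add: left_diff_distrib sum_subtractf gen 2 mult mult.assoc flip: sum_distrib_left)
      ultimately show ?thesis by (auto simp: relation_forms_def)
    qed
  qed
  moreover obtain c T where "D = (\<Sum>s\<in>T. c s * s)" "T \<subseteq> sym_relations I"
    using D by (auto simp: ideal_gen_def)
  ultimately show ?thesis
    by (auto simp: \<theta>.hom_sum \<theta>.hom_mult
        intro!: ideal.span_sum[of _ "\<lambda>s. ?\<theta> (c s) * ?\<theta> s"] ideal.span_scale intro: ideal.span_base)
qed

text \<open>
  Replacing \<open>y\<^sub>k\<close> by the variable of \<open>f\<^sub>k\<close> turns \<open>P\<close> into a representative of an element of the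
  symmetric algebra that is mapped to \<open>P(f) t\<^sup>n = 0\<close> in the Rees algebra, and so is zero by
  injectivity. Going back through coordinates of the elements of the ideal changes \<open>y\<^sub>k\<close> only
  modulo forms given by syzygies.
\<close>
theorem linear_type_relations:
  fixes f :: "nat \<Rightarrow> 'a::comm_ring_1"
  assumes lt: "linear_type (ideal_gen UNIV (f ` {..N}))"
    and P: "P \<in> mpol_in {..N}" "homogeneous n P" "eval_mpol (\<lambda>c. c) f P = 0"
  shows "P \<in> ideal.span (relation_forms N f)"
proof -
  define I where "I = ideal_gen UNIV (f ` {..N})"
  define ev :: "('a, 'a) mpol \<Rightarrow> 'a poly"
    where "ev = eval_mpol (\<lambda>c. [:c:]) (\<lambda>a. Polynomial.monom a 1)"
  interpret ev: comm_ring_hom ev unfolding ev_def by (rule hom_eval_mpol[OF hom_const_poly])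
  have evV: "ev (Var a) = Polynomial.monom a 1" and evC: "ev (Const a) = [:a:]" for a
    by (simp_all add: ev_def eval_mpol_Var eval_mpol_Const one_pCons[symmetric])
  have "ev R = 0" if "R \<in> sym_relations I" for R
    using that by (auto simp: sym_relations_def ev.hom_minus ev.hom_mult evV evC smult_monom
        simp flip: add_monom)
  then have ev0: "ev D = 0" if gen: "D \<in> ideal_gen A (sym_relations I)" for D A
  proof -
    obtain c T where D: "D = (\<Sum>s\<in>T. c s * s)" "T \<subseteq> sym_relations I"
      using gen by (auto simp: ideal_gen_def)
    have "c s * s \<in> {q. ev q = 0}" if "s \<in> T" for s
      using that D(2) \<open>\<And>R. R \<in> sym_relations I \<Longrightarrow> ev R = 0\<close> by (auto simp: ev.hom_mult)
    then show ?thesis unfolding D(1) ev.hom_sum by (intro sum.neutral) auto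
  qed
  have class_value: "sym_to_rees (sym_cong I `` {Q}) = ev Q" if "Q \<in> mpol_in I" for Q
  proof -
    have "0 \<in> ideal_gen (mpol_in I) (sym_relations I)"
      unfolding ideal_gen_def by (auto intro!: exI[of _ "{}"])
    then have "(Q, Q) \<in> sym_cong I" using that by (simp add: sym_cong_def)
    then have "Q \<in> sym_cong I `` {Q}" by blast
    moreover have "ev Q' = ev Q" if "Q' \<in> sym_cong I `` {Q}" for Q'
    proof -
      have "Q - Q' \<in> ideal_gen (mpol_in I) (sym_relations I)"
        using that by (simp add: sym_cong_def)
      then have "ev (Q - Q') = 0" by (rule ev0)
      then show ?thesis by (simp add: ev.hom_minus)
    qed
    ultimately have "ev ` (sym_cong I `` {Q}) = {ev Q}" by blast
    then show ?thesis by (simp add: sym_to_rees_def ev_def)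
  qed
  define P' where "P' = eval_mpol Const (\<lambda>k. Var (f k) :: ('a, 'a) mpol) P"
  have fI: "f k \<in> I" if "k \<le> N" for k
    using that unfolding I_def ideal_gen_UNIV by (intro ideal.span_base) auto
  have P'in: "P' \<in> mpol_in I"
    unfolding P'_def by (rule mpol_in_eval_mpol[OF _ _ P(1)]) (auto intro: mpol_in_Var fI)
  have "ev P' = eval_mpol (\<lambda>c. [:c:]) (\<lambda>k. [:0, 1:] * [:f k:]) P"
    unfolding P'_def hom_comp_eval_mpol[OF ev.comm_ring_hom_axioms] evV evC by (simp add: monom_altdef)
  also have "\<dots> = [:0, 1:] ^ n * eval_mpol (\<lambda>c. [:c:]) (\<lambda>k. [:f k:]) P"
    by (rule eval_mpol_scale_homogeneous[OF P(2)])
  also have "eval_mpol (\<lambda>c. [:c:]) (\<lambda>k. [:f k:]) P = [:eval_mpol (\<lambda>c. c) f P:]"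
    by (rule hom_comp_eval_mpol[OF hom_const_poly, symmetric])
  finally have "ev P' = ev 0" using P(3) by simp
  then have "sym_to_rees (sym_cong I `` {P'}) = sym_to_rees (sym_cong I `` {0})"
    using class_value P'in by simp
  moreover have "inj_on sym_to_rees (Sym I)"
    using lt unfolding linear_type_def I_def bij_betw_def by blast
  moreover have "sym_cong I `` {P'} \<in> Sym I" "sym_cong I `` {0} \<in> Sym I"
    using P'in by (auto simp: Sym_def intro: quotientI)
  ultimately have "sym_cong I `` {P'} = sym_cong I `` {0}" by (meson inj_onD)
  moreover have "(0, 0) \<in> sym_cong I"
    unfolding sym_cong_def ideal_gen_def by (auto intro!: exI[of _ "{}"])
  ultimately have "(P', 0) \<in> sym_cong I" by blast
  then have D: "P' \<in> ideal_gen (mpol_in I) (sym_relations I)" by (simp add: sym_cong_def)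
  have "\<exists>\<rho>. (\<Sum>k\<le>N. \<rho> k * f k) = a" if "a \<in> I" for a
  proof -
    let ?L = "{a. \<exists>\<rho>. (\<Sum>k\<le>N. \<rho> k * f k) = a}"
    have "ideal.subspace ?L"
    proof (rule ideal.subspaceI)
      show "0 \<in> ?L" by (auto intro!: exI[of _ "\<lambda>_. 0"])
    next
      fix a b assume "a \<in> ?L" "b \<in> ?L"
      then obtain \<rho> \<sigma> where "(\<Sum>k\<le>N. \<rho> k * f k) = a" "(\<Sum>k\<le>N. \<sigma> k * f k) = b" by blast
      then have "(\<Sum>k\<le>N. (\<rho> k + \<sigma> k) * f k) = a + b" by (simp add: distrib_right sum.distrib)
      then show "a + b \<in> ?L" by (intro CollectI exI)
    next
      fix c a assume "a \<in> ?L"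
      then obtain \<rho> where "(\<Sum>k\<le>N. \<rho> k * f k) = a" by blast
      then have "(\<Sum>k\<le>N. (c * \<rho> k) * f k) = c * a" by (auto simp: sum_distrib_left mult_ac)
      then show "c * a \<in> ?L" by (intro CollectI exI)
    qed
    moreover have "f ` {..N} \<subseteq> ?L"
    proof clarsimp
      fix k assume "k \<le> N"
      then have "(\<Sum>l\<le>N. (if l = k then 1 else 0) * f l) = f k"
        by (simp add: if_distrib[of "\<lambda>c. c * _"] cong: if_cong)
      then show "\<exists>\<rho>. (\<Sum>k\<le>N. \<rho> k * f k) = f k" by (intro exI)
    qed
    ultimately show ?thesis using that ideal.span_minimal[of "f ` {..N}" ?L]
      unfolding I_def ideal_gen_UNIV by blast
  qed
  then obtain \<rho> where \<rho>: "\<And>a. a \<in> I \<Longrightarrow> (\<Sum>k\<le>N. \<rho> a k * f k) = a" by metis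
  let ?\<theta> = "eval_mpol Const (\<lambda>a. lin_form N (\<rho> a))"
  interpret \<theta>: comm_ring_hom ?\<theta> by (rule hom_eval_mpol[OF hom_Const])
  have \<theta>P': "?\<theta> P' = eval_mpol Const (\<lambda>k. lin_form N (\<rho> (f k))) P"
    unfolding P'_def eval_mpol_subst[OF hom_Const]
    by (simp add: eval_mpol_Var comm_ring_hom.axioms[OF hom_Const] Const_def)
  \<comment> \<open>\<open>\<rho> (f k)\<close> may differ from the \<open>k\<close>-th unit vector, but only by a syzygy\<close>
  have "P - ?\<theta> P' = subst_mpol Var P - eval_mpol Const (\<lambda>k. lin_form N (\<rho> (f k))) P"
    by (simp add: \<theta>P')
  also have "\<dots> \<in> ideal.span (relation_forms N f)"
  proof (rule eval_mpol_diff_in_span[OF _ P(1)])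
    fix k assume "k \<in> {..N}"
    then have k: "k \<le> N" by simp
    have "Var k - lin_form N (\<rho> (f k)) = lin_form N (\<lambda>l. (if l = k then 1 else 0) - \<rho> (f k) l)"
      using k by (simp add: Var_eq_lin_form lin_form_diff)
    moreover have "(\<Sum>l\<le>N. ((if l = k then 1 else 0) - \<rho> (f k) l) * f l) = 0"
      using k by (simp add: left_diff_distrib sum_subtractf \<rho> fI if_distrib[of "\<lambda>c. c * _"] cong: if_cong)
    ultimately show "Var k - lin_form N (\<rho> (f k)) \<in> ideal.span (relation_forms N f)"
      by (auto simp: relation_forms_def intro!: ideal.span_base)
  qed
  finally have "P - ?\<theta> P' \<in> ideal.span (relation_forms N f)" .
  moreover have "?\<theta> P' \<in> ideal.span (relation_forms N f)"
    by (rule sym_cong_to_span[OF I_def \<rho> D])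
  ultimately have "P - ?\<theta> P' + ?\<theta> P' \<in> ideal.span (relation_forms N f)"
    by (rule ideal.span_add)
  then show ?thesis by simp
qed

lemma forms_eval_mpol:
  assumes "\<And>c. h c \<in> forms A 0" "\<And>v. v \<in> B \<Longrightarrow> u v \<in> forms A 1" "p \<in> forms B d"
  shows "eval_mpol h u p \<in> forms A d"
proof -
  have "monom_val u \<alpha> \<in> forms A d" if "\<alpha> \<in> Poly_Mapping.keys p" for \<alpha>
  proof -
    have "monom_val u \<alpha> \<in> forms A (\<Sum>v\<in>Poly_Mapping.keys \<alpha>. Poly_Mapping.lookup \<alpha> v * 1)"
      unfolding monom_val_def using that assms(2,3)
      by (intro forms_prod forms_power) (auto simp: forms_def[of B] mpol_in_def)
    then show ?thesis using that assms(3) by (simp add: forms_def[of B] homogeneous_def)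
  qed
  then show ?thesis
    unfolding eval_mpol_altdef
    by (intro forms_sum) (use forms_mult[OF assms(1)] in fastforce)
qed

lemma Const_eq_iff [simp]: "Const c = Const d \<longleftrightarrow> c = d"
  unfolding Const_def by (metis lookup_single_eq)

lemma lookup_Const_zero [simp]: "Poly_Mapping.lookup (Const c) 0 = c"
  by (simp add: Const_def)

text \<open>The syzygies of forms of one degree form a graded module.\<close>
lemma (in grading) part_syzygy:
  assumes "\<And>k. k \<in> K \<Longrightarrow> graded w d (f k)" "(\<Sum>k\<in>K. s k * f k) = 0"
  shows "(\<Sum>k\<in>K. part w e (s k) * f k) = 0"
proof -
  have "(\<Sum>k\<in>K. part w e (s k) * f k) = (\<Sum>k\<in>K. part w (e + d) (s k * f k))"
    using assms by (intro sum.cong) (auto simp: part_mult_graded)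
  also have "\<dots> = part w (e + d) (\<Sum>k\<in>K. s k * f k)" by (simp add: part_sum)
  finally show ?thesis using assms by simp
qed

lemma single_eq_iff: "Poly_Mapping.single k (1 :: nat) = Poly_Mapping.single l 1 \<longleftrightarrow> k = l"
  by (metis lookup_single_eq lookup_single_not_eq zero_neq_one)

lemma lin_indep_of_dominant:
  fixes f :: "nat \<Rightarrow> ('v, 'k::field) mpol"
  assumes "dominant_map N f"
  shows "lin_indep_forms N f"
  unfolding lin_indep_forms_def
proof (intro allI impI)
  fix c k assume c: "(\<Sum>k\<le>N. Const (c k) * f k) = 0" and k: "k \<le> N"
  interpret C: comm_ring_hom "Const :: 'k \<Rightarrow> ('v, 'k) mpol" by (rule hom_Const)
  interpret S: comm_ring_hom "subst_mpol f" by (rule hom_eval_mpol[OF hom_Const])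
  have "lin_form N c \<in> forms {..N} 1"
    unfolding lin_form_def by (intro forms_sum forms_Const_mult forms_Var)
  moreover have "subst_mpol f (lin_form N c) = 0"
    using c by (simp add: lin_form_def S.hom_sum S.hom_mult eval_mpol_Const eval_mpol_Var)
  ultimately have "lin_form N c = 0"
    using assms unfolding dominant_map_def forms_def by blast
  then have "Poly_Mapping.lookup (lin_form N c) (Poly_Mapping.single k 1) = 0" by simp
  moreover have "Poly_Mapping.lookup (lin_form N c) (Poly_Mapping.single k 1) =
      (\<Sum>l\<le>N. if l = k then c l else 0)"
    unfolding lin_form_def lookup_sum Const_def Var_def mult_single lookup_single
    by (intro sum.cong) (simp_all add: single_eq_iff[simplified] when_def)
  ultimately show "c k = 0" using k by simp
qed

context
  fixes m N :: nat and r :: "nat \<Rightarrow> nat" and x :: "nat \<Rightarrow> nat \<Rightarrow> 'v::linorder"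
    and f :: "nat \<Rightarrow> ('v, 'k::field) mpol" and d :: "nat \<Rightarrow> nat"
  assumes vars: "multi_vars m r x"
    and homog: "\<And>k. k \<le> N \<Longrightarrow> multi_homogeneous m r x d (f k)"
begin

lemma hom_constant_term: "comm_ring_hom (\<lambda>p :: ('v, 'k) mpol. Poly_Mapping.lookup p 0)"
proof
  fix p q :: "('v, 'k) mpol"
  interpret C: comm_ring_hom "Const :: 'k \<Rightarrow> ('v, 'k) mpol" by (rule hom_Const)
  have "Const (Poly_Mapping.lookup (p * q) 0) =
      (Const (Poly_Mapping.lookup p 0 * Poly_Mapping.lookup q 0) :: ('v, 'k) mpol)"
    using part_mdeg_mult_zero[of m r x p q]
    unfolding part_mdeg_zero[OF vars] by (simp add: C.hom_mult)
  then show "Poly_Mapping.lookup (p * q) 0 = Poly_Mapping.lookup p 0 * Poly_Mapping.lookup q 0"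
    by simp
qed (auto simp: lookup_add)

lemma part_syzygy_mdeg:
  "(\<Sum>k\<le>N. s k * f k) = 0 \<Longrightarrow> (\<Sum>k\<le>N. part (mdeg m r x) e (s k) * f k) = 0"
  using homog by (intro mdeg.part_syzygy) (auto simp: multi_homogeneous_iff_graded)

lemma syzygy_constant_term:
  assumes "lin_indep_forms N f" "(\<Sum>k\<le>N. s k * f k) = 0" "k \<le> N"
  shows "Poly_Mapping.lookup (s k) 0 = 0"
  using part_syzygy_mdeg[OF assms(2), of 0] assms(3)
    assms(1)[unfolded lin_indep_forms_def, rule_format, of "\<lambda>k. Poly_Mapping.lookup (s k) 0" k]
  unfolding part_mdeg_zero[OF vars] by blast

text \<open>
  If a form vanishes at \<open>f\<close> then it is a combination of relations \<open>\<Sum>s\<^sub>k y\<^sub>k\<close>. Setting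
  \<open>x = 0\<close> kills these relations, as \<open>s(0)\<close> is a syzygy over the ground field, but not the form.
\<close>
lemma dominant_of_linear_type:
  assumes lt: "linear_type (ideal_gen UNIV (f ` {..N}))" and li: "lin_indep_forms N f"
  shows "dominant_map N f"
  unfolding dominant_map_def
proof (intro ballI impI)
  fix P :: "(nat, 'k) mpol"
  assume Pin: "P \<in> mpol_in {..N}" and "(\<exists>n. homogeneous n P) \<and> subst_mpol f P = 0"
  then obtain n where P: "P \<in> forms {..N} n" and P0: "subst_mpol f P = 0"
    by (auto simp: forms_def)
  define PR where "PR = eval_mpol (\<lambda>c. Const (Const c :: ('v, 'k) mpol)) Var P"
  have "PR \<in> forms {..N} n"
    unfolding PR_def
    by (rule forms_eval_mpol[OF _ _ P]) (auto intro: forms_Var[unfolded One_nat_def])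
  then have PR: "PR \<in> mpol_in {..N}" "homogeneous n PR" by (auto simp: forms_def)
  have "eval_mpol (\<lambda>c. c) f PR = eval_mpol Const f P"
    unfolding PR_def hom_comp_eval_mpol[OF hom_eval_mpol[OF hom_id]]
    by (simp add: eval_mpol_Const eval_mpol_Var)
  then have PR0: "eval_mpol (\<lambda>c. c) f PR = 0" using P0 by simp
  define E where "E = eval_mpol (\<lambda>p :: ('v, 'k) mpol. Const (Poly_Mapping.lookup p 0)) (Var :: nat \<Rightarrow> (nat, 'k) mpol)"
  interpret C: comm_ring_hom "Const :: 'k \<Rightarrow> (nat, 'k) mpol" by (rule hom_Const)
  interpret c: comm_ring_hom "\<lambda>p :: ('v, 'k) mpol. Poly_Mapping.lookup p 0" by (rule hom_constant_term)
  have hom: "comm_ring_hom (\<lambda>p :: ('v, 'k) mpol. Const (Poly_Mapping.lookup p 0) :: (nat, 'k) mpol)"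
    by unfold_locales (simp_all add: C.hom_add C.hom_mult c.hom_mult c.hom_add)
  have E: "comm_ring_hom E" unfolding E_def by (rule hom_eval_mpol[OF hom])
  interpret E: comm_ring_hom E by (rule E)
  have EC: "E (Const a) = Const (Poly_Mapping.lookup a 0)" and EV: "E (Var k) = Var k" for a k
    by (simp_all add: E_def eval_mpol_Const eval_mpol_Var)
  have "E PR = 0"
  proof (rule additive_vanishes_on_span[OF additive_hom[OF E]])
    show "PR \<in> ideal.span (relation_forms N f)" by (rule linear_type_relations[OF lt PR PR0])
  next
    fix q L assume "L \<in> relation_forms N f"
    then obtain s where L: "L = lin_form N s" "(\<Sum>k\<le>N. s k * f k) = 0"
      by (auto simp: relation_forms_def)
    have "E L = 0"
      unfolding L(1) lin_form_def E.hom_sum E.hom_mult EC EV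
      using syzygy_constant_term[OF li L(2)] by (intro sum.neutral) simp
    then show "E (q * L) = 0" by (simp add: E.hom_mult)
  qed
  moreover have "E PR = P"
    unfolding PR_def hom_comp_eval_mpol[OF E] EC EV by simp
  ultimately show "P = 0" by simp
qed

end

section \<open>The linear part of the syzygy matrix\<close>

lemma dim_row_linear_part [simp]: "dim_row (linear_part m r x \<phi>) = dim_row \<phi>"
  by (simp add: linear_part_def)

lemma linear_part_column:
  assumes "c < dim_col (linear_part m r x \<phi>)"
  obtains c' i where "c' < dim_col \<phi>" "i \<in> {1..m}"
    "multi_homogeneous_vec m r x (unit_degree i) (col \<phi> c')"
    "\<forall>k<dim_row \<phi>. linear_part m r x \<phi> $$ (k, c) = \<phi> $$ (k, c')"
proof -
  let ?l = "filter (\<lambda>s. \<exists>i\<in>{1..m}. multi_homogeneous_vec m r x (unit_degree i) s) (cols \<phi>)"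
  have c: "c < length ?l" using assms by (simp add: linear_part_def)
  then have "?l ! c \<in> set ?l" by (rule nth_mem)
  then obtain c' i where c': "c' < dim_col \<phi>" "?l ! c = col \<phi> c'" "i \<in> {1..m}"
      "multi_homogeneous_vec m r x (unit_degree i) (?l ! c)"
    by (auto simp: cols_def)
  show ?thesis
    by (rule that[of c' i]) (use c c' in \<open>auto simp: linear_part_def mat_of_cols_index\<close>)
qed

lemma linear_part_contains:
  assumes "c' < dim_col \<phi>" "i \<in> {1..m}" "multi_homogeneous_vec m r x (unit_degree i) (col \<phi> c')"
  obtains c where "c < dim_col (linear_part m r x \<phi>)"
    "\<forall>k<dim_row \<phi>. linear_part m r x \<phi> $$ (k, c) = \<phi> $$ (k, c')"
proof -
  let ?l = "filter (\<lambda>s. \<exists>i\<in>{1..m}. multi_homogeneous_vec m r x (unit_degree i) s) (cols \<phi>)"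
  have "col \<phi> c' \<in> set ?l" using assms by (auto simp: cols_def)
  then obtain c where "c < length ?l" "?l ! c = col \<phi> c'" unfolding in_set_conv_nth by blast
  then show ?thesis using assms by (intro that[of c]) (auto simp: linear_part_def mat_of_cols_index)
qed

lemma syzygy_matrix_column:
  assumes "syzygy_matrix m r x N f \<phi>" "c < dim_col \<phi>"
  shows "(\<Sum>k\<le>N. \<phi> $$ (k, c) * f k) = 0"
proof -
  have "col \<phi> c \<in> syzygies N f" "dim_row \<phi> = N + 1"
    using assms by (auto simp: syzygy_matrix_def cols_generate_def)
  then show ?thesis using assms(2) by (simp add: syzygies_def)
qed

lemma linear_part_syzygy:
  assumes "syzygy_matrix m r x N f \<phi>" "c < dim_col (linear_part m r x \<phi>)"
  shows "(\<Sum>k\<le>N. f k * linear_part m r x \<phi> $$ (k, c)) = 0"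
proof -
  obtain c' where c': "c' < dim_col \<phi>"
      "\<And>k. k < dim_row \<phi> \<Longrightarrow> linear_part m r x \<phi> $$ (k, c) = \<phi> $$ (k, c')"
    using linear_part_column[OF assms(2)] by metis
  moreover have "dim_row \<phi> = N + 1" using assms(1) by (simp add: syzygy_matrix_def)
  ultimately show ?thesis using syzygy_matrix_column[OF assms(1) c'(1)] by (simp add: mult.commute)
qed

lemma eval_mpol_lin_form:
  assumes "Modules.additive h"
  shows "eval_mpol h u (lin_form N s) = (\<Sum>k\<le>N. h (s k) * u k)"
proof -
  have "eval_mpol h u (Const c * Var k) = h c * u k" for c k
    using eval_mpol_single[of h u, OF additive.zero[OF assms], of "Poly_Mapping.single k 1" c]
    by (simp add: Const_def Var_def mult_single)
  then show ?thesis
    by (simp add: lin_form_def additive.sum[OF additive_eval_mpol[OF assms]])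
qed

lemma hom_pCons_Const: "comm_ring_hom (\<lambda>c :: 'k::comm_ring_1. [:Const c :: ('v, 'k) mpol:])"
proof -
  interpret C: comm_ring_hom "Const :: 'k \<Rightarrow> ('v, 'k) mpol" by (rule hom_Const)
  show ?thesis by unfold_locales (simp_all add: C.hom_add C.hom_mult one_pCons)
qed

lemma poly_eval_mpol_line:
  fixes f h :: "'a \<Rightarrow> ('v, 'k::comm_ring_1) mpol"
  shows "poly (eval_mpol (\<lambda>c. [:Const c:]) (\<lambda>k. [:f k, h k:]) q) 0 = subst_mpol f q"
proof -
  have "comm_ring_hom (\<lambda>p :: ('v, 'k) mpol poly. poly p 0)" by unfold_locales auto
  from hom_comp_eval_mpol[OF this, of "\<lambda>c. [:Const c:]" "\<lambda>k. [:f k, h k:]" q]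
  show ?thesis by simp
qed

lemma sum_linear_poly: "(\<Sum>k\<in>K. [:a k, b k:]) = [:\<Sum>k\<in>K. a k, \<Sum>k\<in>K. b k:]"
  by (induction K rule: infinite_finite_induct) auto

context
  fixes m N :: nat and r :: "nat \<Rightarrow> nat" and x :: "nat \<Rightarrow> nat \<Rightarrow> 'v::linorder"
    and f :: "nat \<Rightarrow> ('v, 'k::field) mpol" and d :: "nat \<Rightarrow> nat"
  assumes vars: "multi_vars m r x"
    and homog: "\<And>k. k \<le> N \<Longrightarrow> multi_homogeneous m r x d (f k)"
begin

text \<open>
  Linear independence of \<open>f\<close> excludes columns of multi-degree zero other than the zero column. So
  a syzygy of multi-degree \<open>e\<^sub>i\<close> is a combination of columns of the linear part, with constant
  coefficients, and a vector that annihilates the latter annihilates all linear syzygies.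
\<close>
lemma linear_syzygy_kernel:
  assumes li: "lin_indep_forms N f" and \<phi>: "syzygy_matrix m r x N f \<phi>"
    and h: "\<And>c. c < dim_col (linear_part m r x \<phi>) \<Longrightarrow> (\<Sum>k\<le>N. h k * linear_part m r x \<phi> $$ (k, c)) = 0"
    and s: "(\<Sum>k\<le>N. s k * f k) = 0" and i: "i \<in> {1..m}"
  shows "(\<Sum>k\<le>N. part (mdeg m r x) (Poly_Mapping.single i 1) (s k) * h k) = 0"
proof -
  let ?w = "mdeg m r x" and ?e = "Poly_Mapping.single i (1 :: nat)"
  have rows: "dim_row \<phi> = N + 1" using \<phi> by (simp add: syzygy_matrix_def)
  have "vec (N + 1) s \<in> syzygies N f" using s by (simp add: syzygies_def)
  then obtain a where "\<forall>k<dim_row \<phi>. vec (N + 1) s $ k = (\<Sum>c<dim_col \<phi>. a c * \<phi> $$ (k, c))"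
    using \<phi> unfolding syzygy_matrix_def cols_generate_def by blast
  then have a: "s k = (\<Sum>c<dim_col \<phi>. a c * \<phi> $$ (k, c))" if "k \<le> N" for k
    using that rows by auto
  have const: "part ?w 0 (\<phi> $$ (k, c)) = 0" if "k \<le> N" "c < dim_col \<phi>" for k c
    using syzygy_constant_term[OF vars homog li syzygy_matrix_column[OF \<phi> that(2)] that(1)]
    by (simp add: part_mdeg_zero[OF vars] Const_def)
  have col: "(\<Sum>k\<le>N. part ?w ?e (\<phi> $$ (k, c)) * h k) = 0" if c: "c < dim_col \<phi>" for c
  proof -
    obtain \<delta> where \<delta>: "multi_homogeneous_vec m r x \<delta> (col \<phi> c)"
      using \<phi> c by (auto simp: syzygy_matrix_def)
    then have gr: "graded ?w (mdegree m \<delta>) (\<phi> $$ (k, c))" if "k \<le> N" for k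
      using that rows c by (auto simp: multi_homogeneous_vec_def multi_homogeneous_iff_graded)
    show ?thesis
    proof (cases "mdegree m \<delta> = ?e")
      case True
      then have "multi_homogeneous_vec m r x (unit_degree i) (col \<phi> c)"
        using \<delta> mdegree_unit[OF i]
        by (simp add: multi_homogeneous_vec_def multi_homogeneous_iff_graded)
      then obtain c' where c': "c' < dim_col (linear_part m r x \<phi>)"
          "\<And>k. k < dim_row \<phi> \<Longrightarrow> linear_part m r x \<phi> $$ (k, c') = \<phi> $$ (k, c)"
        using linear_part_contains[OF c i] by metis
      have "part ?w ?e (\<phi> $$ (k, c)) = linear_part m r x \<phi> $$ (k, c')" if "k \<le> N" for k
        using part_of_graded[OF gr[OF that], of ?e] True that rows c'(2)[of k] by simp
      then have "(\<Sum>k\<le>N. part ?w ?e (\<phi> $$ (k, c)) * h k) =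
          (\<Sum>k\<le>N. h k * linear_part m r x \<phi> $$ (k, c'))"
        by (intro sum.cong) (simp_all add: mult.commute)
      then show ?thesis using h[OF c'(1)] by simp
    next
      case False
      have "part ?w ?e (\<phi> $$ (k, c)) = 0" if "k \<le> N" for k
        using part_of_graded[OF gr[OF that], of ?e] False by simp
      then show ?thesis by simp
    qed
  qed
  have "(\<Sum>k\<le>N. part ?w ?e (s k) * h k) =
      (\<Sum>k\<le>N. \<Sum>c<dim_col \<phi>. part ?w 0 (a c) * (part ?w ?e (\<phi> $$ (k, c)) * h k))"
  proof (intro sum.cong refl)
    fix k assume "k \<in> {..N}"
    then have k: "k \<le> N" by simp
    have "part ?w ?e (s k) = (\<Sum>c<dim_col \<phi>. part ?w 0 (a c) * part ?w ?e (\<phi> $$ (k, c)))"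
      unfolding a[OF k] part_sum part_mdeg_mult_single using const[OF k] by simp
    then show "part ?w ?e (s k) * h k =
        (\<Sum>c<dim_col \<phi>. part ?w 0 (a c) * (part ?w ?e (\<phi> $$ (k, c)) * h k))"
      by (simp add: sum_distrib_right mult.assoc)
  qed
  also have "\<dots> = (\<Sum>c<dim_col \<phi>. part ?w 0 (a c) * (\<Sum>k\<le>N. part ?w ?e (\<phi> $$ (k, c)) * h k))"
    unfolding sum_distrib_left by (rule sum.swap)
  also have "\<dots> = 0" using col by simp
  finally show ?thesis .
qed

section \<open>Birationality implies maximal rank\<close>

text \<open>
  For an inverse \<open>g\<close> the form \<open>g\<^sub>i\<^sub>j(y) x\<^sub>i\<^sub>l - g\<^sub>i\<^sub>l(y) x\<^sub>i\<^sub>j\<close> vanishes at \<open>y = f\<close>, hence is a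
  combination of forms given by syzygies. Being of degree \<open>e\<^sub>i\<close> in \<open>x\<close>, it equals the component
  of that degree of the combination, to which only the linear components of the syzygies contribute.
  Those vanish on the line \<open>y = f + t h\<close>, which is encoded by polynomials in \<open>t\<close> over \<open>R\<close>.
\<close>
lemma graph_equation_on_line:
  assumes lt: "linear_type (ideal_gen UNIV (f ` {..N}))" and li: "lin_indep_forms N f"
    and \<phi>: "syzygy_matrix m r x N f \<phi>"
    and h: "\<And>c. c < dim_col (linear_part m r x \<phi>) \<Longrightarrow> (\<Sum>k\<le>N. h k * linear_part m r x \<phi> $$ (k, c)) = 0"
    and i: "i \<in> {1..m}" and j: "j \<le> r i" "l \<le> r i"
    and g: "g j \<in> forms {..N} e" "g l \<in> forms {..N} e"
    and inv: "subst_mpol f (g j) * Var (x i l) = subst_mpol f (g l) * Var (x i j)"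
  shows "eval_mpol (\<lambda>c. [:Const c:]) (\<lambda>k. [:f k, h k:]) (g j) * [:Var (x i l):] =
    eval_mpol (\<lambda>c. [:Const c:]) (\<lambda>k. [:f k, h k:]) (g l) * [:Var (x i j):]"
proof -
  let ?w = "mdeg m r x" and ?e = "Poly_Mapping.single i (1 :: nat)"
  let ?u = "\<lambda>k. [:f k, h k:]"
  \<comment> \<open>\<open>D\<close> extracts the component of degree \<open>e\<^sub>i\<close> and \<open>\<epsilon>\<close> the constant term of a coefficient\<close>
  define D where "D = (\<lambda>p. [:part ?w ?e p:] :: ('v, 'k) mpol poly)"
  define \<epsilon> where "\<epsilon> = (\<lambda>p. [:part ?w 0 p:] :: ('v, 'k) mpol poly)"
  have D: "Modules.additive D" by unfold_locales (simp add: D_def part_add)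
  have \<epsilon>: "comm_ring_hom \<epsilon>"
    by unfold_locales
      (simp_all add: \<epsilon>_def part_add part_mdeg_mult_zero one_pCons part_of_graded[OF mdeg.graded_one])
  have leibniz: "eval_mpol D ?u (p * q) =
      eval_mpol \<epsilon> ?u p * eval_mpol D ?u q + eval_mpol D ?u p * eval_mpol \<epsilon> ?u q" for p q
    by (rule eval_mpol_mult_bilinear[OF D additive_hom[OF \<epsilon>] D D additive_hom[OF \<epsilon>]])
      (unfold D_def \<epsilon>_def part_mdeg_mult_single, simp)
  define emb where "emb = eval_mpol (\<lambda>c. Const (Const c :: ('v, 'k) mpol)) (Var :: nat \<Rightarrow> _)"
  have emb_forms: "emb q \<in> forms {..N} e" if "q \<in> forms {..N} e" for q e
    unfolding emb_def by (rule forms_eval_mpol[OF _ _ that]) (auto intro: forms_Var[unfolded One_nat_def])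
  define P where "P = emb (g j) * Const (Var (x i l)) - emb (g l) * Const (Var (x i j))"
  have "P \<in> forms {..N} (e + 0)"
    unfolding P_def by (intro forms_diff forms_mult emb_forms g forms_Const)
  then have P: "P \<in> mpol_in {..N}" "homogeneous e P" by (simp_all add: forms_def)
  interpret ev: comm_ring_hom "eval_mpol (\<lambda>c. c) f" by (rule hom_eval_mpol[OF hom_id])
  have "eval_mpol (\<lambda>c. c) f (emb q) = subst_mpol f q" for q
    unfolding emb_def hom_comp_eval_mpol[OF ev.comm_ring_hom_axioms]
    by (simp add: eval_mpol_Const eval_mpol_Var)
  then have P0: "eval_mpol (\<lambda>c. c) f P = 0"
    using inv by (simp add: P_def ev.hom_minus ev.hom_mult eval_mpol_Const)
  have "eval_mpol D ?u P = 0"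
  proof (rule additive_vanishes_on_span[OF additive_eval_mpol[OF D]])
    show "P \<in> ideal.span (relation_forms N f)" by (rule linear_type_relations[OF lt P P0])
  next
    fix q L assume "L \<in> relation_forms N f"
    then obtain s where L: "L = lin_form N s" and s: "(\<Sum>k\<le>N. s k * f k) = 0"
      by (auto simp: relation_forms_def)
    have "eval_mpol D ?u L = [:\<Sum>k\<le>N. part ?w ?e (s k) * f k, \<Sum>k\<le>N. part ?w ?e (s k) * h k:]"
      unfolding L eval_mpol_lin_form[OF D] by (simp add: D_def sum_linear_poly mult.commute)
    also have "\<dots> = 0"
      using part_syzygy_mdeg[OF vars homog s] linear_syzygy_kernel[OF li \<phi> h s i] by simp
    finally have "eval_mpol D ?u L = 0" .
    moreover have "eval_mpol \<epsilon> ?u L = 0"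
      unfolding L eval_mpol_lin_form[OF additive_hom[OF \<epsilon>]]
      using syzygy_constant_term[OF vars homog li s]
      by (intro sum.neutral) (simp add: \<epsilon>_def part_mdeg_zero[OF vars] Const_def)
    ultimately show "eval_mpol D ?u (q * L) = 0" by (simp add: leibniz)
  qed
  moreover have "eval_mpol D ?u (emb q * Const (Var (x i a))) =
      eval_mpol (\<lambda>c. [:Const c:]) ?u q * [:Var (x i a):]" if "a \<le> r i" for q a
  proof -
    interpret \<epsilon>: comm_ring_hom \<epsilon> by (rule \<epsilon>)
    have ne: "?e \<noteq> 0" by (metis lookup_single_eq lookup_zero one_neq_zero)
    have "eval_mpol \<epsilon> ?u (emb q) = eval_mpol (\<lambda>c. [:Const c:]) ?u q"
      unfolding emb_def hom_comp_eval_mpol[OF hom_eval_mpol[OF \<epsilon>]]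
      by (simp add: eval_mpol_Const eval_mpol_Var) (simp add: \<epsilon>_def part_mdeg_zero[OF vars])
    moreover have "eval_mpol D ?u (Const (Var (x i a))) = [:Var (x i a):]"
      using part_of_graded[OF graded_Var[OF vars i that], of ?e]
      by (simp add: eval_mpol_Const additive.zero[OF D]) (simp add: D_def)
    moreover have "eval_mpol \<epsilon> ?u (Const (Var (x i a))) = 0"
      using part_of_graded[OF graded_Var[OF vars i that], of 0] ne
      by (simp add: eval_mpol_Const) (simp add: \<epsilon>_def)
    ultimately show ?thesis by (simp add: leibniz)
  qed
  ultimately show ?thesis
    using j unfolding P_def by (simp add: additive.diff[OF additive_eval_mpol[OF D]])
qed

text \<open>
  By the equations of the graph, \<open>g(f + t h)\<close> represents the point \<open>x\<close>. Applying \<open>f\<close>, the tuple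
  \<open>f(g(f + t h))\<close> is proportional to \<open>f\<close>, but also to \<open>f + t h\<close> as \<open>f(g(y))\<close> is to \<open>y\<close>.
\<close>
lemma kernel_of_inverse:
  assumes lt: "linear_type (ideal_gen UNIV (f ` {..N}))" and li: "lin_indep_forms N f"
    and \<phi>: "syzygy_matrix m r x N f \<phi>"
    and inv: "inverse_rational_map m r x N f g"
    and h: "\<And>c. c < dim_col (linear_part m r x \<phi>) \<Longrightarrow> (\<Sum>k\<le>N. h k * linear_part m r x \<phi> $$ (k, c)) = 0"
    and kl: "k \<le> N" "l \<le> N"
  shows "f k * h l = f l * h k"
proof -
  let ?u = "\<lambda>k. [:f k, h k:]"
  define G where "G = eval_mpol (\<lambda>c :: 'k. [:Const c :: ('v, 'k) mpol:]) ?u"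
  interpret G: comm_ring_hom G unfolding G_def by (rule hom_eval_mpol[OF hom_pCons_Const])
  have at0: "poly (G q) 0 = subst_mpol f q" for q
    unfolding G_def by (rule poly_eval_mpol_line)
  have proj: "proj_eq {..r i} (\<lambda>j. subst_mpol f (g (x i j))) (\<lambda>j. Var (x i j))" if "i \<in> {1..m}" for i
    using inv that by (auto simp: inverse_rational_map_def)
  then have "\<exists>j\<le>r i. subst_mpol f (g (x i j)) \<noteq> 0" if "i \<in> {1..m}" for i
    using that unfolding proj_eq_def by fast
  then obtain j0 where j0: "\<And>i. i \<in> {1..m} \<Longrightarrow> j0 i \<le> r i"
      "\<And>i. i \<in> {1..m} \<Longrightarrow> subst_mpol f (g (x i (j0 i))) \<noteq> 0"
    by metis
  have graph: "[:Var (x i (j0 i)):] * G (g (x i j)) = G (g (x i (j0 i))) * [:Var (x i j):]"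
    if i: "i \<in> {1..m}" and j: "j \<le> r i" for i j
  proof -
    obtain e where e: "\<forall>j\<le>r i. g (x i j) \<in> forms {..N} e"
      using inv i unfolding inverse_rational_map_def rational_map_to_product_def forms_def by blast
    have "subst_mpol f (g (x i j)) * Var (x i (j0 i)) = subst_mpol f (g (x i (j0 i))) * Var (x i j)"
      using proj[OF i] j j0(1)[OF i] unfolding proj_eq_def by simp
    then have "G (g (x i j)) * [:Var (x i (j0 i)):] = G (g (x i (j0 i))) * [:Var (x i j):]"
      unfolding G_def using e j j0(1)[OF i]
      by (intro graph_equation_on_line[OF lt li \<phi> h i, where g = "\<lambda>j. g (x i j)" and e = e]) auto
    then show ?thesis by (simp add: mult.commute)
  qed
  define a b where "a = (\<Prod>i=1..m. [:Var (x i (j0 i)) :: ('v, 'k) mpol:] ^ d i)"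
    and "b = (\<Prod>i=1..m. G (g (x i (j0 i))) ^ d i)"
  \<comment> \<open>nonzero since it is nonzero at \<open>t = 0\<close>\<close>
  have b: "b \<noteq> 0"
  proof -
    have "G (g (x i (j0 i))) \<noteq> 0" if "i \<in> {1..m}" for i
      using at0[of "g (x i (j0 i))"] j0(2)[OF that] by auto
    then show ?thesis by (simp add: b_def)
  qed
  have composite: "a * G (subst_mpol g (f k)) = b * [:f k:]" if "k \<le> N" for k
  proof -
    have "a * eval_mpol (\<lambda>c. [:Const c:]) (\<lambda>v. G (g v)) (f k) =
        b * eval_mpol (\<lambda>c. [:Const c:]) (\<lambda>v. [:Var v:]) (f k)"
      unfolding a_def b_def by (rule eval_mpol_rescale[OF vars homog[OF that]]) (rule graph)
    moreover have "G (subst_mpol g (f k)) = eval_mpol (\<lambda>c. [:Const c:]) (\<lambda>v. G (g v)) (f k)"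
      unfolding G_def by (rule eval_mpol_subst[OF hom_pCons_Const])
    moreover have "eval_mpol (\<lambda>c. [:Const c:]) (\<lambda>v. [:Var v:]) (f k) = [:f k:]"
      using hom_comp_eval_mpol[OF hom_const_poly, of Const Var "f k"] by simp
    ultimately show ?thesis by simp
  qed
  have "subst_mpol g (f k) * Var l = subst_mpol g (f l) * Var k"
    using inv kl by (auto simp: inverse_rational_map_def proj_eq_def)
  then have "G (subst_mpol g (f k) * Var l) = G (subst_mpol g (f l) * Var k)" by simp
  then have "G (subst_mpol g (f k)) * ?u l = G (subst_mpol g (f l)) * ?u k"
    unfolding G.hom_mult by (simp add: G_def eval_mpol_Var one_pCons[symmetric] Const_def)
  then have "a * G (subst_mpol g (f k)) * ?u l = a * G (subst_mpol g (f l)) * ?u k"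
    by (simp only: mult.assoc)
  then have "b * ([:f k:] * ?u l) = b * ([:f l:] * ?u k)"
    unfolding composite[OF kl(1)] composite[OF kl(2)] by (simp only: mult.assoc)
  then have "[:f k:] * ?u l = [:f l:] * ?u k" by (simp only: mult_left_cancel[OF b])
  then show ?thesis by (simp add: mult.commute)
qed

theorem rank_of_birational:
  assumes lt: "linear_type (ideal_gen UNIV (f ` {..N}))" and nz: "\<exists>k\<le>N. f k \<noteq> 0"
    and \<phi>: "syzygy_matrix m r x N f \<phi>" and bir: "birational m r x N f"
  shows "fract_rank (linear_part m r x \<phi>) = N"
proof -
  have rows: "dim_row (linear_part m r x \<phi>) = N + 1" using \<phi> by (simp add: syzygy_matrix_def)
  obtain k1 where k1: "k1 \<le> N" "f k1 \<noteq> 0" using nz by blast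
  have dom: "dominant_map N f" using bir by (simp add: birational_def)
  then have li: "lin_indep_forms N f" by (rule lin_indep_of_dominant)
  obtain g where g: "inverse_rational_map m r x N f g" using bir by (auto simp: birational_def)
  show ?thesis
  proof (rule antisym)
    show "fract_rank (linear_part m r x \<phi>) \<le> N"
      using fract_rank_le[where f = f and Z = "{}", OF rows k1 linear_part_syzygy[OF \<phi>]] by simp
    show "N \<le> fract_rank (linear_part m r x \<phi>)"
      by (rule fract_rank_ge[where f = f, OF rows k1]) (rule kernel_of_inverse[OF lt li \<phi> g])
  qed
qed

end

section \<open>Maximal rank implies birationality\<close>

context
  fixes m N :: nat and r :: "nat \<Rightarrow> nat" and x :: "nat \<Rightarrow> nat \<Rightarrow> 'v::linorder"
    and f :: "nat \<Rightarrow> ('v, 'k::field) mpol" and d :: "nat \<Rightarrow> nat"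
  assumes vars: "multi_vars m r x"
    and homog: "\<And>k. k \<le> N \<Longrightarrow> multi_homogeneous m r x d (f k)"
begin

text \<open>A linear form in the variables \<open>x\<^sub>i\<^sub>0, x\<^sub>i\<^sub>1, \<dots>\<close> and in \<open>y\<close> can be sorted by either set of variables.\<close>
lemma bilinear_form_eval:
  fixes s :: "nat \<Rightarrow> ('v, 'k) mpol" and h :: "'k \<Rightarrow> 'a::comm_ring_1"
  assumes i: "i \<in> {1..m}" and s: "\<And>k. k \<le> N \<Longrightarrow> graded (mdeg m r x) (Poly_Mapping.single i 1) (s k)"
    and h: "comm_ring_hom h"
  shows "(\<Sum>j\<le>r i. eval_mpol h u (lin_form N (\<lambda>k. Poly_Mapping.lookup (s k) (Poly_Mapping.single (x i j) 1)))
      * X (x i j)) = (\<Sum>k\<le>N. eval_mpol h X (s k) * u k)"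
proof -
  interpret h: comm_ring_hom h by fact
  interpret hX: comm_ring_hom "eval_mpol h X" by (rule hom_eval_mpol[OF h])
  let ?c = "\<lambda>k j. Poly_Mapping.lookup (s k) (Poly_Mapping.single (x i j) 1)"
  have "eval_mpol h X (s k) = (\<Sum>j\<le>r i. h (?c k j) * X (x i j))" if "k \<le> N" for k
  proof -
    have "eval_mpol h X (s k) = eval_mpol h X (\<Sum>j\<le>r i. Const (?c k j) * Var (x i j))"
      using linear_form_expansion[OF vars i s[OF that]] by simp
    also have "\<dots> = (\<Sum>j\<le>r i. h (?c k j) * X (x i j))"
      unfolding hX.hom_sum hX.hom_mult by (simp add: eval_mpol_Const eval_mpol_Var)
    finally show ?thesis .
  qed
  then have "(\<Sum>k\<le>N. eval_mpol h X (s k) * u k) =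
      (\<Sum>k\<le>N. \<Sum>j\<le>r i. h (?c k j) * X (x i j) * u k)"
    by (simp add: sum_distrib_right)
  also have "\<dots> = (\<Sum>j\<le>r i. (\<Sum>k\<le>N. h (?c k j) * u k) * X (x i j))"
    unfolding sum_distrib_right by (subst sum.swap) (simp only: mult_ac)
  finally show ?thesis unfolding eval_mpol_lin_form[OF additive_hom[OF h]] by simp
qed

lemma dominant_forms:
  assumes "dominant_map N f" "P \<in> forms {..N} n" "subst_mpol f P = 0"
  shows "P = 0"
  using assms unfolding dominant_map_def forms_def by blast

text \<open>
  Let \<open>\<Sum>\<^sub>c b\<^sub>c(y) \<Sum>\<^sub>k s\<^sub>c\<^sub>k(x) y\<^sub>k = 0\<close> identically, where the \<open>s\<^sub>c\<close> are linear syzygies. At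
  \<open>y = f + t \<epsilon>\<^sub>l\<close>, with a new variable \<open>t\<close> and the \<open>l\<close>-th unit vector \<open>\<epsilon>\<^sub>l\<close>, the sums over \<open>k\<close> reduce to \<open>t s\<^sub>c\<^sub>l(x)\<close>; the linear
  term in \<open>t\<close> is a relation with coefficients \<open>b\<^sub>c(f)\<close> between the syzygies themselves. So
  independence over the fraction field in \<open>x\<close> implies independence over the one in \<open>y\<close>.
\<close>
lemma independence_transfer:
  fixes s :: "'c \<Rightarrow> nat \<Rightarrow> ('v, 'k) mpol"
  assumes i: "i \<in> {1..m}"
    and s: "\<And>c k. c \<in> B \<Longrightarrow> k \<le> N \<Longrightarrow> graded (mdeg m r x) (Poly_Mapping.single i 1) (s c k)"
    and syz: "\<And>c. c \<in> B \<Longrightarrow> (\<Sum>k\<le>N. s c k * f k) = 0"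
    and ind: "\<And>b. (\<And>k. k \<le> N \<Longrightarrow> (\<Sum>c\<in>B. b c * s c k) = 0) \<Longrightarrow> (\<And>c. c \<in> B \<Longrightarrow> b c = 0)"
    and dom: "dominant_map N f"
    and b: "\<And>c. c \<in> B \<Longrightarrow> b c \<in> forms {..N} e"
    and rel: "\<And>j. j \<le> r i \<Longrightarrow> (\<Sum>c\<in>B. b c * lin_form N (\<lambda>k. Poly_Mapping.lookup (s c k) (Poly_Mapping.single (x i j) 1))) = 0"
    and c: "c \<in> B"
  shows "b c = 0"
proof -
  let ?A = "\<lambda>c j. lin_form N (\<lambda>k. Poly_Mapping.lookup (s c k) (Poly_Mapping.single (x i j) 1))"
  have "(\<Sum>c\<in>B. subst_mpol f (b c) * s c l) = 0" if l: "l \<le> N" for l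
  proof -
    define u where "u = (\<lambda>k. [:f k, if k = l then 1 else 0:])"
    let ?G = "eval_mpol (\<lambda>c. [:Const c:]) u" and ?X = "\<lambda>v. [:Var v:] :: ('v, 'k) mpol poly"
    interpret G: comm_ring_hom ?G by (rule hom_eval_mpol[OF hom_pCons_Const])
    have at0: "poly (?G q) 0 = subst_mpol f q" for q
      unfolding u_def by (rule poly_eval_mpol_line)
    have inner: "(\<Sum>j\<le>r i. ?G (?A c j) * ?X (x i j)) = [:0, s c l:]" if "c \<in> B" for c
    proof -
      have X: "eval_mpol (\<lambda>c. [:Const c:]) ?X p = [:p:]" for p
        using hom_comp_eval_mpol[OF hom_const_poly, of Const Var p] by simp
      have "(\<Sum>j\<le>r i. ?G (?A c j) * ?X (x i j)) = (\<Sum>k\<le>N. [:s c k:] * u k)"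
        using bilinear_form_eval[OF i s[OF that] hom_pCons_Const, where u = u and X = ?X] unfolding X .
      also have "\<dots> = (\<Sum>k\<le>N. [:s c k * f k, if k = l then s c k else 0:])"
        by (intro sum.cong) (auto simp: u_def)
      also have "\<dots> = [:0, s c l:]"
        unfolding sum_linear_poly using l by (simp add: syz[OF that])
      finally show ?thesis .
    qed
    have "0 = (\<Sum>j\<le>r i. ?G (\<Sum>c\<in>B. b c * ?A c j) * ?X (x i j))"
      using rel by (simp add: G.hom_zero)
    also have "\<dots> = (\<Sum>j\<le>r i. \<Sum>c\<in>B. ?G (b c) * (?G (?A c j) * ?X (x i j)))"
      unfolding G.hom_sum G.hom_mult sum_distrib_right mult.assoc ..
    also have "\<dots> = (\<Sum>c\<in>B. ?G (b c) * (\<Sum>j\<le>r i. ?G (?A c j) * ?X (x i j)))"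
      unfolding sum_distrib_left by (rule sum.swap)
    also have "\<dots> = (\<Sum>c\<in>B. ?G (b c) * [:0, s c l:])" using inner by (intro sum.cong) auto
    finally have "poly.coeff (\<Sum>c\<in>B. ?G (b c) * [:0, s c l:]) 1 = 0" by simp
    then have "(\<Sum>c\<in>B. poly.coeff (?G (b c) * [:0, s c l:]) 1) = 0" by (simp add: coeff_sum)
    moreover have "poly.coeff (?G (b c) * [:0, s c l:]) 1 = subst_mpol f (b c) * s c l" for c
      by (simp add: at0[unfolded poly_0_coeff_0] mult.commute)
    ultimately show ?thesis by (simp only:)
  qed
  then have "subst_mpol f (b c) = 0" using ind[of "\<lambda>c. subst_mpol f (b c)"] c by blast
  then show ?thesis using dominant_forms[OF dom b[OF c]] by blast
qed

text \<open>
  The linear syzygies of degree \<open>e\<^sub>i\<close> define linear equations over \<open>\<K>[y]\<close> which at \<open>y = f\<close> have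
  the solution \<open>(x\<^sub>i\<^sub>0, x\<^sub>i\<^sub>1, \<dots>)\<close>. So there are at most \<open>r\<^sub>i\<close> independent ones, and if there are
  \<open>r\<^sub>i\<close> of them then a solution over \<open>\<K>[y]\<close> specializes to a multiple of that one.
\<close>
lemma linear_equations:
  fixes A :: "'c \<Rightarrow> nat \<Rightarrow> (nat, 'k) mpol"
  assumes dom: "dominant_map N f" and i: "i \<in> {1..m}" and fin: "finite B"
    and A: "\<And>c j. c \<in> B \<Longrightarrow> j \<le> r i \<Longrightarrow> A c j \<in> forms {..N} 1"
    and sol: "\<And>c. c \<in> B \<Longrightarrow> (\<Sum>j\<le>r i. subst_mpol f (A c j) * Var (x i j)) = 0"
    and ind: "\<And>e b. (\<And>c. c \<in> B \<Longrightarrow> b c \<in> forms {..N} e) \<Longrightarrow>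
      (\<And>j. j \<le> r i \<Longrightarrow> (\<Sum>c\<in>B. b c * A c j) = 0) \<Longrightarrow> (\<And>c. c \<in> B \<Longrightarrow> b c = 0)"
  shows "card B \<le> r i"
    and "card B = r i \<Longrightarrow> \<exists>e g. (\<forall>j\<le>r i. g j \<in> forms {..N} e) \<and> (\<exists>j\<le>r i. g j \<noteq> 0) \<and>
      (\<forall>j\<le>r i. \<forall>l\<le>r i. subst_mpol f (g j) * Var (x i l) = subst_mpol f (g l) * Var (x i j))"
proof -
  interpret F: graded_family "forms {..N} :: nat \<Rightarrow> (nat, 'k) mpol set" by (rule graded_family_forms)
  interpret S: comm_ring_hom "subst_mpol f" by (rule hom_eval_mpol[OF hom_Const])
  have swap: "(\<Sum>j\<le>r i. subst_mpol f (\<Sum>c\<in>B. b c * A c j) * z j) = 0"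
    if "\<And>c. c \<in> B \<Longrightarrow> (\<Sum>j\<le>r i. subst_mpol f (A c j) * z j) = 0" for b z
  proof -
    have "(\<Sum>j\<le>r i. subst_mpol f (\<Sum>c\<in>B. b c * A c j) * z j) =
        (\<Sum>j\<le>r i. \<Sum>c\<in>B. subst_mpol f (b c) * (subst_mpol f (A c j) * z j))"
      unfolding S.hom_sum S.hom_mult sum_distrib_right mult.assoc ..
    also have "\<dots> = (\<Sum>c\<in>B. subst_mpol f (b c) * (\<Sum>j\<le>r i. subst_mpol f (A c j) * z j))"
      unfolding sum_distrib_left by (rule sum.swap)
    finally show ?thesis using that by simp
  qed
  \<comment> \<open>a solution with nonzero coordinate \<open>j\<close> allows to complete a relation at \<open>j\<close>\<close>
  have complete: "(\<Sum>c\<in>B. b c * A c j) = 0"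
    if b: "\<And>c. c \<in> B \<Longrightarrow> b c \<in> forms {..N} e"
      and z: "\<And>c. c \<in> B \<Longrightarrow> (\<Sum>j\<le>r i. subst_mpol f (A c j) * z j) = 0"
      and j: "j \<le> r i" "z j \<noteq> 0"
      and other: "\<And>l. l \<le> r i \<Longrightarrow> l \<noteq> j \<Longrightarrow> (\<Sum>c\<in>B. b c * A c l) = 0 \<or> z l = 0"
    for b e z j
  proof -
    have "(\<Sum>l\<in>{..r i} - {j}. subst_mpol f (\<Sum>c\<in>B. b c * A c l) * z l) = 0"
    proof (rule sum.neutral, rule ballI)
      fix l assume "l \<in> {..r i} - {j}"
      then have "l \<le> r i" "l \<noteq> j" by auto
      from other[OF this] show "subst_mpol f (\<Sum>c\<in>B. b c * A c l) * z l = 0"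
        by (elim disjE) (simp_all only: S.hom_zero mult_zero_left mult_zero_right)
    qed
    moreover have total: "(\<Sum>l\<le>r i. subst_mpol f (\<Sum>c\<in>B. b c * A c l) * z l) = 0"
      by (rule swap) (rule z)
    ultimately have "subst_mpol f (\<Sum>c\<in>B. b c * A c j) * z j = 0"
      using total j by (subst (asm) sum.remove[of "{..r i}" j]) simp_all
    then have "subst_mpol f (\<Sum>c\<in>B. b c * A c j) = 0" using j by simp
    moreover have "(\<Sum>c\<in>B. b c * A c j) \<in> forms {..N} (e + 1)"
      using b A j by (intro forms_sum forms_mult) auto
    ultimately show ?thesis using dominant_forms[OF dom] by blast
  qed
  have "card B \<le> card ({..r i} - {0})"
  proof (rule F.card_le_of_independent[where v = A and d = 1])
    fix e b c
    assume b: "\<And>c. c \<in> B \<Longrightarrow> b c \<in> forms {..N} e" and c: "c \<in> B"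
      and rel: "\<And>j. j \<in> {..r i} - {0} \<Longrightarrow> (\<Sum>c\<in>B. b c * A c j) = 0"
    have "(\<Sum>c\<in>B. b c * A c 0) = 0"
      by (rule complete[where z = "\<lambda>j. Var (x i j)" and e = e]) (use b sol rel in auto)
    then have "(\<Sum>c\<in>B. b c * A c j) = 0" if "j \<le> r i" for j
      using rel[of j] that by (cases "j = 0") auto
    then show "b c = 0" using ind[of b e] b c by blast
  qed (use fin A in auto)
  then show "card B \<le> r i" by simp
  assume card: "card B = r i"
  have "\<exists>e g. (\<forall>j\<in>{..r i}. g j \<in> forms {..N} e) \<and> (\<exists>j\<in>{..r i}. g j \<noteq> 0) \<and>
      (\<forall>c\<in>B. (\<Sum>j\<in>{..r i}. g j * A c j) = 0)"
    by (rule F.linear_dependence[where v = "\<lambda>j c. A c j" and d = 1]) (use fin card A in auto)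
  then obtain e g where g: "\<forall>j\<in>{..r i}. g j \<in> forms {..N} e" "\<exists>j\<in>{..r i}. g j \<noteq> 0"
      "\<forall>c\<in>B. (\<Sum>j\<le>r i. g j * A c j) = 0"
    by blast
  have gsol: "(\<Sum>j\<le>r i. subst_mpol f (A c j) * subst_mpol f (g j)) = 0" if "c \<in> B" for c
  proof -
    have "subst_mpol f (\<Sum>j\<le>r i. g j * A c j) = 0" using g(3) that S.hom_zero by simp
    then show ?thesis by (simp add: S.hom_sum S.hom_mult mult.commute)
  qed
  have "subst_mpol f (g j) * Var (x i l) = subst_mpol f (g l) * Var (x i j)"
    if j: "j \<le> r i" and l: "l \<le> r i" for j l
  proof (rule ccontr)
    assume ne: "subst_mpol f (g j) * Var (x i l) \<noteq> subst_mpol f (g l) * Var (x i j)"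
    then have jl: "j \<noteq> l" by auto
    \<comment> \<open>the combination of the two solutions that vanishes at \<open>l\<close> but not at \<open>j\<close>\<close>
    define z where "z = (\<lambda>k. Var (x i l) * subst_mpol f (g k) - subst_mpol f (g l) * Var (x i k))"
    have z: "z l = 0" "z j \<noteq> 0" using ne by (auto simp: z_def mult.commute)
    have zsol: "(\<Sum>k\<le>r i. subst_mpol f (A c k) * z k) = 0" if "c \<in> B" for c
    proof -
      have "(\<Sum>k\<le>r i. subst_mpol f (A c k) * z k) =
          Var (x i l) * (\<Sum>k\<le>r i. subst_mpol f (A c k) * subst_mpol f (g k)) -
          subst_mpol f (g l) * (\<Sum>k\<le>r i. subst_mpol f (A c k) * Var (x i k))"
        unfolding sum_distrib_left sum_subtractf[symmetric]
        by (intro sum.cong) (auto simp: z_def algebra_simps)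
      then show ?thesis using gsol[OF that] sol[OF that] by simp
    qed
    have "card B \<le> card ({..r i} - {j, l})"
    proof (rule F.card_le_of_independent[where v = A and d = 1])
      fix e b c
      assume b: "\<And>c. c \<in> B \<Longrightarrow> b c \<in> forms {..N} e" and c: "c \<in> B"
        and rel: "\<And>k. k \<in> {..r i} - {j, l} \<Longrightarrow> (\<Sum>c\<in>B. b c * A c k) = 0"
      have relj: "(\<Sum>c\<in>B. b c * A c j) = 0"
        by (rule complete[where z = z and e = e]) (use b zsol z rel j in auto)
      have "(\<Sum>c\<in>B. b c * A c l) = 0"
      proof (rule complete[where z = "\<lambda>j. Var (x i j)" and e = e])
        fix k assume "k \<le> r i" "k \<noteq> l"
        then show "(\<Sum>c\<in>B. b c * A c k) = 0 \<or> Var (x i k) = (0 :: ('v, 'k) mpol)"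
          using relj rel[of k] by (cases "k = j") auto
      qed (use b sol l in auto)
      then have "(\<Sum>c\<in>B. b c * A c k) = 0" if "k \<le> r i" for k
        using rel[of k] relj that by (cases "k = j"; cases "k = l") auto
      then show "b c = 0" using ind[of b e] b c by blast
    qed (use fin A in auto)
    moreover have "card ({..r i} - {j, l}) < r i"
      using j l jl by (simp add: card_Diff_subset)
    ultimately show False using card by simp
  qed
  then show "\<exists>e g. (\<forall>j\<le>r i. g j \<in> forms {..N} e) \<and> (\<exists>j\<le>r i. g j \<noteq> 0) \<and>
      (\<forall>j\<le>r i. \<forall>l\<le>r i. subst_mpol f (g j) * Var (x i l) = subst_mpol f (g l) * Var (x i j))"
    using g by blast
qed

text \<open>
  If the maps \<open>g\<^sub>i\<close> invert \<open>f\<close> on the source then also \<open>f(g(f))\<close> is proportional to \<open>f\<close>, and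
  dominance allows to replace the argument \<open>f\<close> by \<open>y\<close>.
\<close>
lemma inverse_of_left_inverse:
  assumes dom: "dominant_map N f" and nz: "\<exists>k\<le>N. f k \<noteq> 0"
    and g: "\<And>i j. i \<in> {1..m} \<Longrightarrow> j \<le> r i \<Longrightarrow> g (x i j) \<in> forms {..N} (e i)"
      "\<And>i. i \<in> {1..m} \<Longrightarrow> \<exists>j\<le>r i. g (x i j) \<noteq> 0"
    and left: "\<And>i j l. i \<in> {1..m} \<Longrightarrow> j \<le> r i \<Longrightarrow> l \<le> r i \<Longrightarrow>
      subst_mpol f (g (x i j)) * Var (x i l) = subst_mpol f (g (x i l)) * Var (x i j)"
  shows "inverse_rational_map m r x N f g"
proof -
  interpret S: comm_ring_hom "subst_mpol f" by (rule hom_eval_mpol[OF hom_Const])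
  have subst_Var: "subst_mpol f (Var k) = f k" for k
    by (simp add: eval_mpol_Var Const_def)
  have "\<exists>j\<le>r i. subst_mpol f (g (x i j)) \<noteq> 0" if "i \<in> {1..m}" for i
    using g(2)[OF that] g(1)[OF that] dominant_forms[OF dom] by blast
  then obtain j0 where j0: "\<And>i. i \<in> {1..m} \<Longrightarrow> j0 i \<le> r i"
      "\<And>i. i \<in> {1..m} \<Longrightarrow> subst_mpol f (g (x i (j0 i))) \<noteq> 0"
    by metis
  define a b where "a = (\<Prod>i=1..m. Var (x i (j0 i)) ^ d i :: ('v, 'k) mpol)"
    and "b = (\<Prod>i=1..m. subst_mpol f (g (x i (j0 i))) ^ d i)"
  have a: "a \<noteq> 0" by (simp add: a_def)
  have b: "b \<noteq> 0" using j0 by (simp add: b_def)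
  have composite: "a * subst_mpol f (subst_mpol g (f k)) = b * f k" if k: "k \<le> N" for k
  proof -
    have "a * eval_mpol Const (\<lambda>v. subst_mpol f (g v)) (f k) = b * subst_mpol Var (f k)"
      unfolding a_def b_def
      by (rule eval_mpol_rescale[OF vars homog[OF k]]) (metis left j0(1) mult.commute)
    then show ?thesis by (simp add: eval_mpol_subst[OF hom_Const])
  qed
  have "subst_mpol g (f k) * Var l = subst_mpol g (f l) * Var k" if kl: "k \<le> N" "l \<le> N" for k l
  proof -
    let ?P = "subst_mpol g (f k) * Var l - subst_mpol g (f l) * Var k"
    have "a * subst_mpol f ?P = a * subst_mpol f (subst_mpol g (f k)) * f l -
        a * subst_mpol f (subst_mpol g (f l)) * f k"
      by (simp add: S.hom_minus S.hom_mult subst_Var right_diff_distrib mult.assoc)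
    also have "\<dots> = 0" by (simp add: composite kl mult_ac)
    finally have "subst_mpol f ?P = 0" using a by simp
    moreover have "?P \<in> forms {..N} ((\<Sum>i=1..m. d i * e i) + 1)"
      using kl by (intro forms_diff forms_mult subst_mpol_forms[OF vars homog] g(1) forms_Var) auto
    ultimately have "?P = 0" by (intro dominant_forms[OF dom])
    then show ?thesis by simp
  qed
  moreover have "\<exists>k\<le>N. subst_mpol g (f k) \<noteq> 0"
  proof -
    obtain k where "k \<le> N" "f k \<noteq> 0" using nz by blast
    then have "subst_mpol f (subst_mpol g (f k)) \<noteq> 0" using composite[of k] b by auto
    then show ?thesis using \<open>k \<le> N\<close> S.hom_zero by metis
  qed
  ultimately have "proj_eq {..N} (\<lambda>k. subst_mpol g (f k)) Var"
    by (auto simp: proj_eq_def)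
  moreover have "proj_eq {..r i} (\<lambda>j. subst_mpol f (g (x i j))) (\<lambda>j. Var (x i j))"
    if "i \<in> {1..m}" for i
    using j0[OF that] left[OF that] by (auto simp: proj_eq_def)
  moreover have "rational_map_to_product m r x N g"
    using g unfolding rational_map_to_product_def forms_def by blast
  ultimately show ?thesis by (simp add: inverse_rational_map_def)
qed

text \<open>
  The \<open>N\<close> independent columns are sorted by the block \<open>i\<close> of variables in which they are linear.
  Block \<open>i\<close> has at most \<open>r\<^sub>i\<close> of them, hence exactly \<open>r\<^sub>i\<close> as \<open>N\<close> is the sum of the \<open>r\<^sub>i\<close>.
\<close>
theorem birational_of_rank:
  assumes lt: "linear_type (ideal_gen UNIV (f ` {..N}))" and nz: "\<exists>k\<le>N. f k \<noteq> 0"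
    and li: "lin_indep_forms N f" and N: "N = (\<Sum>i=1..m. r i)"
    and \<phi>: "syzygy_matrix m r x N f \<phi>" and rank: "fract_rank (linear_part m r x \<phi>) = N"
  shows "birational m r x N f"
proof -
  have dom: "dominant_map N f" by (rule dominant_of_linear_type[OF vars homog lt li])
  define M where "M = linear_part m r x \<phi>"
  have rows: "dim_row M = N + 1" using \<phi> by (simp add: M_def syzygy_matrix_def)
  obtain S where S: "S \<subseteq> {..<dim_col M}" "card S = fract_rank M"
    and ind: "\<forall>b. (\<forall>k<dim_row M. (\<Sum>c\<in>S. b c * M $$ (k, c)) = 0) \<longrightarrow> (\<forall>c\<in>S. b c = 0)"
    using fract_rank_witness[of M] by blast
  have fin: "finite S" using S finite_subset by blast
  have syz: "(\<Sum>k\<le>N. M $$ (k, c) * f k) = 0" if "c \<in> S" for c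
    using linear_part_syzygy[OF \<phi>, of c] S(1) that by (auto simp: M_def mult.commute)
  have "\<exists>i\<in>{1..m}. \<forall>k\<le>N. graded (mdeg m r x) (Poly_Mapping.single i 1) (M $$ (k, c))"
    if "c \<in> S" for c
  proof -
    have "c < dim_col (linear_part m r x \<phi>)" using that S(1) by (auto simp: M_def)
    then obtain c' i where c': "c' < dim_col \<phi>" "i \<in> {1..m}"
        "multi_homogeneous_vec m r x (unit_degree i) (col \<phi> c')"
        "\<forall>k<dim_row \<phi>. M $$ (k, c) = \<phi> $$ (k, c')"
      unfolding M_def by (rule linear_part_column)
    have "graded (mdeg m r x) (Poly_Mapping.single i 1) (M $$ (k, c))" if "k \<le> N" for k
    proof -
      have k: "k < dim_row \<phi>" using that rows by (simp add: M_def)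
      then have "multi_homogeneous m r x (unit_degree i) (\<phi> $$ (k, c'))"
        using c' by (simp add: multi_homogeneous_vec_def)
      then show ?thesis
        unfolding multi_homogeneous_iff_graded mdegree_unit[OF c'(2)] c'(4)[rule_format, OF k] .
    qed
    then show ?thesis using c'(2) by blast
  qed
  then obtain \<iota> where \<iota>: "\<And>c. c \<in> S \<Longrightarrow> \<iota> c \<in> {1..m}"
      "\<And>c k. c \<in> S \<Longrightarrow> k \<le> N \<Longrightarrow> graded (mdeg m r x) (Poly_Mapping.single (\<iota> c) 1) (M $$ (k, c))"
    by metis
  define B where "B = (\<lambda>i. {c \<in> S. \<iota> c = i})"
  define A where "A = (\<lambda>i c j. lin_form N (\<lambda>k. Poly_Mapping.lookup (M $$ (k, c)) (Poly_Mapping.single (x i j) 1)))"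
  have finB: "finite (B i)" for i using fin by (simp add: B_def)
  have A: "A i c j \<in> forms {..N} 1" for i c j
    unfolding A_def lin_form_def by (intro forms_sum forms_Const_mult forms_Var)
  have gr: "graded (mdeg m r x) (Poly_Mapping.single i 1) (M $$ (k, c))" if "c \<in> B i" "k \<le> N" for i c k
    using \<iota>(2)[of c k] that by (auto simp: B_def)
  have sol: "(\<Sum>j\<le>r i. subst_mpol f (A i c j) * Var (x i j)) = 0" if "i \<in> {1..m}" "c \<in> B i" for i c
  proof -
    have "(\<Sum>j\<le>r i. subst_mpol f (A i c j) * Var (x i j)) = (\<Sum>k\<le>N. subst_mpol Var (M $$ (k, c)) * f k)"
      unfolding A_def by (rule bilinear_form_eval[OF that(1) gr[OF that(2)] hom_Const])
    then show ?thesis using syz[of c] that by (simp add: B_def)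
  qed
  have indB: "b c = 0" if i: "i \<in> {1..m}" and b: "\<And>c. c \<in> B i \<Longrightarrow> b c \<in> forms {..N} e"
      and rel: "\<And>j. j \<le> r i \<Longrightarrow> (\<Sum>c\<in>B i. b c * A i c j) = 0" and c: "c \<in> B i" for i b e c
  proof (rule independence_transfer[where s = "\<lambda>c k. M $$ (k, c)" and B = "B i" and b = b and e = e, OF i _ _ _ dom])
    fix b c
    assume b: "\<And>k. k \<le> N \<Longrightarrow> (\<Sum>c\<in>B i. b c * M $$ (k, c)) = 0" and c: "c \<in> B i"
    define b' where "b' = (\<lambda>c. if c \<in> B i then b c else 0)"
    have "(\<Sum>c\<in>S. b' c * M $$ (k, c)) = (\<Sum>c\<in>B i. b c * M $$ (k, c))" for k
      by (rule sum.mono_neutral_cong_right) (auto simp: fin b'_def B_def)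
    then have "\<forall>c\<in>S. b' c = 0" using ind rows b by simp
    then show "b c = 0" using c by (auto simp: b'_def B_def)
  qed (use gr syz b rel c in \<open>auto simp: A_def B_def\<close>)
  note equations = linear_equations[where A = "A i" and B = "B i" for i, OF dom _ finB A sol]
  have le: "card (B i) \<le> r i" if i: "i \<in> {1..m}" for i
    by (rule equations(1)[OF i i]) (auto intro: indB[OF i])
  have "(\<Sum>i=1..m. card (B i)) = card S"
  proof -
    have "S = (\<Union>i\<in>{1..m}. B i)" using \<iota>(1) by (auto simp: B_def)
    moreover have "card (\<Union>i\<in>{1..m}. B i) = (\<Sum>i=1..m. card (B i))"
      by (rule card_UN_disjoint) (use finB in \<open>auto simp: B_def\<close>)
    ultimately show ?thesis by simp
  qed
  then have sums: "(\<Sum>i=1..m. card (B i)) = (\<Sum>i=1..m. r i)" using S(2) rank N by (simp add: M_def)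
  have card: "card (B i) = r i" if "i \<in> {1..m}" for i
  proof (rule ccontr)
    assume "card (B i) \<noteq> r i"
    then have "(\<Sum>i=1..m. card (B i)) < (\<Sum>i=1..m. r i)"
      using le that by (intro sum_strict_mono_ex1) (auto intro!: bexI[of _ i] simp: order_less_le)
    then show False using sums by simp
  qed
  have "\<exists>e g. (\<forall>j\<le>r i. g j \<in> forms {..N} e) \<and> (\<exists>j\<le>r i. g j \<noteq> 0) \<and>
      (\<forall>j\<le>r i. \<forall>l\<le>r i. subst_mpol f (g j) * Var (x i l) = subst_mpol f (g l) * Var (x i j))"
    if "i \<in> {1..m}" for i
    by (rule equations(2)[OF that that]) (auto intro: indB[OF that] card[OF that])
  then obtain e gg where gg: "\<And>i j. i \<in> {1..m} \<Longrightarrow> j \<le> r i \<Longrightarrow> gg i j \<in> forms {..N} (e i)"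
      "\<And>i. i \<in> {1..m} \<Longrightarrow> \<exists>j\<le>r i. gg i j \<noteq> 0"
      "\<And>i j l. i \<in> {1..m} \<Longrightarrow> j \<le> r i \<Longrightarrow> l \<le> r i \<Longrightarrow>
        subst_mpol f (gg i j) * Var (x i l) = subst_mpol f (gg i l) * Var (x i j)"
    by metis
  define g where "g = (\<lambda>v. case_prod gg (inv_into (SIGMA i:{1..m}. {..r i}) (\<lambda>(i, j). x i j) v))"
  have g: "g (x i j) = gg i j" if "i \<in> {1..m}" "j \<le> r i" for i j
  proof -
    have "inj_on (\<lambda>(i, j). x i j) (SIGMA i:{1..m}. {..r i})"
      using vars by (simp add: multi_vars_def bij_betw_def)
    from inv_into_f_f[OF this, of "(i, j)"] that show ?thesis by (simp add: g_def)
  qed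
  have "inverse_rational_map m r x N f g"
  proof (rule inverse_of_left_inverse[OF dom nz, where e = e])
    fix i assume i: "i \<in> {1..m}"
    then obtain j where "j \<le> r i" "gg i j \<noteq> 0" using gg(2) by blast
    then show "\<exists>j\<le>r i. g (x i j) \<noteq> 0" using g[OF i] by auto
  qed (use gg g in simp_all)
  then show ?thesis using dom by (auto simp: birational_def)
qed

end

section \<open>Finite generation of modules over polynomial rings\<close>

lemma monotone_subsequence_nat:
  fixes p :: "nat \<Rightarrow> nat"
  obtains \<phi> :: "nat \<Rightarrow> nat" where "strict_mono \<phi>" "mono (p \<circ> \<phi>)"
proof -
  obtain g :: "nat \<Rightarrow> nat" where g: "strict_mono g" "monoseq (\<lambda>n. p (g n))"
    using seq_monosub[of p] by blast
  show ?thesis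
  proof (cases "incseq (\<lambda>n. p (g n))")
    case True
    then show ?thesis using g(1) that[of g] by (simp add: incseq_def mono_def)
  next
    case False
    then have dec: "p (g n) \<le> p (g k)" if "k \<le> n" for k n
      using g(2) that by (auto simp: monoseq_iff decseq_def)
    define M where "M = (LEAST v. v \<in> range (\<lambda>n. p (g n)))"
    have "M \<in> range (\<lambda>n. p (g n))" unfolding M_def by (rule LeastI[of _ "p (g 0)"]) blast
    then obtain n0 where n0: "M = p (g n0)" by blast
    have "p (g n) = M" if "n \<ge> n0" for n
    proof (rule antisym)
      show "p (g n) \<le> M" using dec[OF that] n0 by simp
      show "M \<le> p (g n)" unfolding M_def by (rule Least_le) blast
    qed
    then have "mono (p \<circ> (\<lambda>n. g (n0 + n)))" by (simp add: mono_def)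
    moreover have "strict_mono (\<lambda>n. g (n0 + n))"
      using g(1) by (simp add: strict_mono_def)
    ultimately show ?thesis by (rule that[rotated])
  qed
qed

text \<open>Dickson's lemma, by passing to a subsequence once for each of the sequences.\<close>
lemma dickson:
  assumes "finite F"
  shows "\<exists>\<phi> :: nat \<Rightarrow> nat. strict_mono \<phi> \<and> (\<forall>p\<in>F. mono ((p :: nat \<Rightarrow> nat) \<circ> \<phi>))"
  using assms
proof (induction F rule: finite_induct)
  case empty
  then show ?case by (intro exI[of _ id]) (auto simp: strict_mono_def)
next
  case (insert p F)
  then obtain \<phi> :: "nat \<Rightarrow> nat" where \<phi>: "strict_mono \<phi>" "\<And>q. q \<in> F \<Longrightarrow> mono (q \<circ> \<phi>)" by blast
  obtain \<psi> :: "nat \<Rightarrow> nat" where \<psi>: "strict_mono \<psi>" "mono ((p \<circ> \<phi>) \<circ> \<psi>)"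
    by (rule monotone_subsequence_nat[of "p \<circ> \<phi>"])
  have "mono (q \<circ> (\<phi> \<circ> \<psi>))" if "q \<in> F" for q
    using \<phi>(2)[OF that] strict_mono_mono[OF \<psi>(1)] by (simp add: mono_def)
  then show ?case
    using \<phi>(1) \<psi> by (intro exI[of _ "\<phi> \<circ> \<psi>"]) (auto simp: strict_mono_def comp_def)
qed

text \<open>The order on exponent vectors is lexicographic: the least variable where they differ decides.\<close>
lemma le_of_lookup_le:
  fixes \<alpha> \<beta> :: "'v::linorder \<Rightarrow>\<^sub>0 nat"
  assumes "\<And>v. Poly_Mapping.lookup \<alpha> v \<le> Poly_Mapping.lookup \<beta> v"
  shows "\<alpha> \<le> \<beta>"
proof (cases "\<alpha> = \<beta>")
  case False
  let ?D = "{v. Poly_Mapping.lookup \<alpha> v \<noteq> Poly_Mapping.lookup \<beta> v}"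
  have sub: "?D \<subseteq> Poly_Mapping.keys \<alpha> \<union> Poly_Mapping.keys \<beta>" by (auto simp: in_keys_iff)
  have fin: "finite ?D" by (rule finite_subset[OF sub]) simp
  have ne: "?D \<noteq> {}" using False by (auto simp: poly_mapping_eq_iff fun_eq_iff)
  define k where "k = Min ?D"
  have k: "k \<in> ?D" unfolding k_def by (rule Min_in[OF fin ne])
  have "Poly_Mapping.lookup \<alpha> k' = Poly_Mapping.lookup \<beta> k'" if "k' < k" for k'
    using Min_le[OF fin, of k'] that unfolding k_def by (meson leD mem_Collect_eq)
  moreover have "Poly_Mapping.lookup \<alpha> k < Poly_Mapping.lookup \<beta> k" using k assms[of k] by auto
  ultimately have "\<alpha> < \<beta>" by (auto simp: less_poly_mapping.rep_eq less_fun_def)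
  then show ?thesis by simp
qed simp

lemma wf_monomials:
  assumes "finite (UNIV :: 'v::linorder set)"
  shows "wf {(\<alpha>, \<beta>). \<alpha> < (\<beta> :: 'v \<Rightarrow>\<^sub>0 nat)}"
  unfolding wf_iff_no_infinite_down_chain
proof
  assume "\<exists>a. \<forall>i. (a (Suc i), a i) \<in> {(\<alpha>, \<beta>). \<alpha> < (\<beta> :: 'v \<Rightarrow>\<^sub>0 nat)}"
  then obtain a :: "nat \<Rightarrow> 'v \<Rightarrow>\<^sub>0 nat" where a: "\<And>i. a (Suc i) < a i" by auto
  have "finite (range (\<lambda>v n. Poly_Mapping.lookup (a n) v))" using assms by simp
  from dickson[OF this] obtain \<phi> :: "nat \<Rightarrow> nat" where \<phi>: "strict_mono \<phi>"
      "\<And>v. mono ((\<lambda>n. Poly_Mapping.lookup (a n) v) \<circ> \<phi>)"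
    by auto
  have "a (\<phi> 0) \<le> a (\<phi> 1)"
    using monoD[OF \<phi>(2), of 0 1] by (intro le_of_lookup_le) simp
  moreover have "a j \<le> a i" if "i \<le> j" for i j
    by (rule lift_Suc_antimono_le[of a, OF less_imp_le[OF a] that])
  then have "a (\<phi> 1) \<le> a (Suc (\<phi> 0))" using strict_monoD[OF \<phi>(1), of 0 1] by simp
  moreover note a[of "\<phi> 0"]
  ultimately show False by simp
qed

lemma lookup_single_mult:
  fixes p :: "('v, 'k::comm_ring_1) mpol"
  shows "Poly_Mapping.lookup (Poly_Mapping.single \<delta> c * p) (\<delta> + \<alpha>) = c * Poly_Mapping.lookup p \<alpha>"
  by (induction p rule: mpol_induct)
    (auto simp: mult_single lookup_single when_def distrib_left lookup_add)

interpretation vect: Modules.module "Polynomial.smult :: 'a::comm_ring_1 \<Rightarrow> 'a poly \<Rightarrow> 'a poly"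
  by unfold_locales (simp_all add: smult_add_right smult_add_left)

text \<open>
  The leading exponent vector in the last nonzero coordinate of a vector, which is coded as a
  polynomial in one more variable with the coordinates as coefficients.
\<close>
definition lead_monom :: "('v::linorder, 'k::comm_ring_1) mpol poly \<Rightarrow> 'v \<Rightarrow>\<^sub>0 nat" where
  "lead_monom p = Max (Poly_Mapping.keys (lead_coeff p))"

lemma lead_monom_in: "p \<noteq> 0 \<Longrightarrow> lead_monom p \<in> Poly_Mapping.keys (lead_coeff p)"
  unfolding lead_monom_def by (rule Max_in) (auto simp: poly_mapping_eq_iff fun_eq_iff in_keys_iff
      simp flip: leading_coeff_0_iff)

text \<open>
  Otherwise one could choose successively vectors \<open>s n\<close> in \<open>M\<close> outside of the span of the earlier
  ones, each with a minimal leading term. By Dickson's lemma some leading term is a multiple of an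
  earlier one; cancelling it gives a smaller vector outside of the span.
\<close>
lemma submodule_finitely_generated:
  fixes M :: "('v::linorder, 'k::field) mpol poly set"
  assumes fin: "finite (UNIV :: 'v set)" and M: "vect.subspace M"
    and deg: "\<And>p. p \<in> M \<Longrightarrow> Polynomial.degree p \<le> N"
  shows "\<exists>T. finite T \<and> T \<subseteq> M \<and> vect.span T = M"
proof (rule ccontr)
  assume "\<nexists>T. finite T \<and> T \<subseteq> M \<and> vect.span T = M"
  then have not_gen: "M - vect.span T \<noteq> {}" if "finite T" "T \<subseteq> M" for T
    using that vect.span_minimal[OF that(2) M] by blast
  define R where "R = inv_image (less_than <*lex*> {(\<alpha>, \<beta>). \<alpha> < \<beta>})
    (\<lambda>p :: ('v, 'k) mpol poly. (Polynomial.degree p, lead_monom p))"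
  have wfR: "wf R" unfolding R_def by (intro wf_inv_image wf_lex_prod wf_less_than wf_monomials fin)
  define good where "good = (\<lambda>T p. finite T \<and> T \<subseteq> M \<and> p \<in> M - vect.span T \<and>
    (\<forall>q. (q, p) \<in> R \<longrightarrow> q \<notin> M - vect.span T))"
  have pick: "\<exists>p. good T p" if T: "finite T" "T \<subseteq> M" for T
  proof -
    obtain p0 where "p0 \<in> M - vect.span T" using not_gen[OF T] by blast
    then obtain p where "p \<in> M - vect.span T" "\<And>q. (q, p) \<in> R \<Longrightarrow> q \<notin> M - vect.span T"
      using wfE_min[OF wfR] by metis
    then show ?thesis using T by (auto simp: good_def)
  qed
  have "\<exists>F. \<forall>n. (case F n of (T, p) \<Rightarrow> good T p) \<and> fst (F (Suc n)) = insert (snd (F n)) (fst (F n))"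
  proof (rule dependent_nat_choice)
    obtain p where "good {} p" using pick[of "{}"] by auto
    then show "\<exists>F. case F of (T, p) \<Rightarrow> good T p" by (intro exI[of _ "({}, p)"]) simp
  next
    fix F :: "('v, 'k) mpol poly set \<times> ('v, 'k) mpol poly" and n :: nat
    assume F: "case F of (T, p) \<Rightarrow> good T p"
    let ?T = "insert (snd F) (fst F)"
    have "finite ?T" "?T \<subseteq> M" using F by (auto simp: good_def)
    then obtain q where "good ?T q" using pick by blast
    then show "\<exists>F'. (case F' of (T, p) \<Rightarrow> good T p) \<and> fst F' = ?T"
      by (intro exI[of _ "(?T, q)"]) simp
  qed
  then obtain F where F: "\<forall>n. (case F n of (T, p) \<Rightarrow> good T p) \<and>
      fst (F (Suc n)) = insert (snd (F n)) (fst (F n))"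
    by (rule exE)
  define T s where "T = (\<lambda>n. fst (F n))" and "s = (\<lambda>n. snd (F n))"
  have good: "good (T n) (s n)" for n using F by (simp add: T_def s_def case_prod_beta)
  have T_Suc: "T (Suc n) = insert (s n) (T n)" for n using F by (simp add: T_def s_def)
  have in_T: "s i \<in> T j" if "i < j" for i j
    using that by (induction j) (auto simp: T_Suc less_Suc_eq)
  have sM: "s n \<in> M" and sT: "s n \<notin> vect.span (T n)" and s0: "s n \<noteq> 0" for n
    using good[of n] by (auto simp: good_def vect.span_zero)
  let ?deg = "\<lambda>n. Polynomial.degree (s n)"
  \<comment> \<open>monotonicity of both \<open>?deg\<close> and \<open>N - ?deg\<close> forces equality of the positions of the leading terms\<close>
  let ?F = "{?deg, \<lambda>n. N - ?deg n} \<union> range (\<lambda>v n. Poly_Mapping.lookup (lead_monom (s n)) v)"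
  have "finite ?F" using fin by simp
  from dickson[OF this] obtain \<phi> :: "nat \<Rightarrow> nat" where \<phi>: "strict_mono \<phi>" "\<forall>p\<in>?F. mono (p \<circ> \<phi>)"
    by blast
  define i j where "i = \<phi> 0" and "j = \<phi> 1"
  have ij: "i < j" using \<phi>(1) by (simp add: i_def j_def strict_mono_def)
  have le: "p i \<le> p j" if "p \<in> ?F" for p
    using bspec[OF \<phi>(2) that] monoD[of "p \<circ> \<phi>" 0 1] by (simp add: i_def j_def)
  have "?deg i \<le> ?deg j" "N - ?deg i \<le> N - ?deg j" by (rule le, simp)+
  then have deg_eq: "?deg i = ?deg j" using deg[OF sM, of i] deg[OF sM, of j] by linarith
  have lm_le: "Poly_Mapping.lookup (lead_monom (s i)) v \<le> Poly_Mapping.lookup (lead_monom (s j)) v" for v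
    by (rule le) blast
  define \<delta> where "\<delta> = lead_monom (s j) - lead_monom (s i)"
  have \<delta>: "lead_monom (s j) = \<delta> + lead_monom (s i)"
    using lm_le by (intro poly_mapping_eqI) (simp add: \<delta>_def lookup_add lookup_minus)
  let ?a = "\<lambda>n. Poly_Mapping.lookup (lead_coeff (s n)) (lead_monom (s n))"
  have a: "?a n \<noteq> 0" for n using lead_monom_in[OF s0] by (simp add: in_keys_iff)
  define t where "t = Poly_Mapping.single \<delta> (?a j / ?a i)"
  define q where "q = s j - Polynomial.smult t (s i)"
  have qM: "q \<in> M"
    unfolding q_def using sM by (intro vect.subspace_diff[OF M] vect.subspace_scale[OF M])
  have "q \<notin> vect.span (T j)"
  proof
    assume "q \<in> vect.span (T j)"
    moreover have "Polynomial.smult t (s i) \<in> vect.span (T j)"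
      by (intro vect.span_scale vect.span_base in_T ij)
    ultimately have "q + Polynomial.smult t (s i) \<in> vect.span (T j)" by (rule vect.span_add)
    then show False using sT by (simp add: q_def)
  qed
  then have nR: "(q, s j) \<notin> R" and q0: "q \<noteq> 0"
    using good[of j] qM vect.span_zero[of "T j"] by (auto simp: good_def)
  have "Polynomial.degree q \<le> ?deg j"
    unfolding q_def using deg_eq by (intro degree_diff_le degree_smult_le[THEN order_trans]) auto
  with nR have degq: "Polynomial.degree q = ?deg j" by (auto simp: R_def)
  have lcq: "lead_coeff q = lead_coeff (s j) - t * lead_coeff (s i)"
    unfolding degq by (simp add: q_def deg_eq)
  have "\<alpha> < lead_monom (s j)" if \<alpha>: "\<alpha> \<in> Poly_Mapping.keys (lead_coeff q)" for \<alpha>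
  proof -
    have "Poly_Mapping.lookup (lead_coeff q) (lead_monom (s j)) = ?a j - (?a j / ?a i) * ?a i"
      unfolding lcq lookup_minus t_def by (simp add: \<delta> lookup_single_mult)
    then have "\<alpha> \<noteq> lead_monom (s j)" using \<alpha> a by (auto simp: in_keys_iff)
    moreover have "\<alpha> \<le> lead_monom (s j)"
    proof -
      have "\<alpha> \<in> Poly_Mapping.keys (lead_coeff (s j)) \<or> \<alpha> \<in> Poly_Mapping.keys (t * lead_coeff (s i))"
        using \<alpha> unfolding lcq by (auto simp: in_keys_iff lookup_minus)
      then show ?thesis
      proof
        assume "\<alpha> \<in> Poly_Mapping.keys (lead_coeff (s j))"
        then show ?thesis unfolding lead_monom_def by (intro Max_ge) auto
      next
        assume "\<alpha> \<in> Poly_Mapping.keys (t * lead_coeff (s i))"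
        then obtain \<gamma> where "\<alpha> = \<delta> + \<gamma>" "\<gamma> \<in> Poly_Mapping.keys (lead_coeff (s i))"
          using keys_mult[of t "lead_coeff (s i)"] by (auto simp: t_def split: if_splits)
        moreover from this(2) have "\<gamma> \<le> lead_monom (s i)"
          unfolding lead_monom_def by (intro Max_ge) auto
        ultimately show ?thesis by (simp add: \<delta> add_left_mono)
      qed
    qed
    ultimately show ?thesis by simp
  qed
  then have "lead_monom q < lead_monom (s j)" using lead_monom_in[OF q0] by blast
  then show False using nR degq by (simp add: R_def)
qed

section \<open>Existence of the syzygy matrix\<close>

lemma coeff_poly_of_fun: "k \<le> N \<Longrightarrow> poly.coeff (\<Sum>k\<le>N. Polynomial.monom (s k) k) k = s k"
  by (simp add: coeff_sum)

lemma degree_poly_of_fun: "Polynomial.degree (\<Sum>k\<le>N. Polynomial.monom (s k) k) \<le> N"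
  by (intro degree_sum_le) (auto intro: order_trans[OF degree_monom_le])

lemma coeff_map_part: "poly.coeff (map_poly (part w e) p) k = part w e (poly.coeff p k)"
  by (simp add: coeff_map_poly)

context
  fixes m N :: nat and r :: "nat \<Rightarrow> nat" and x :: "nat \<Rightarrow> nat \<Rightarrow> 'v::linorder"
    and f :: "nat \<Rightarrow> ('v, 'k::field) mpol" and d :: "nat \<Rightarrow> nat"
  assumes vars: "multi_vars m r x"
    and homog: "\<And>k. k \<le> N \<Longrightarrow> multi_homogeneous m r x d (f k)"
begin

text \<open>
  The module of syzygies that vanish at the coordinates in \<open>Z\<close> is finitely generated and graded.
  So the homogeneous components of finitely many generators generate it, and among the subsets of
  these that still generate one of least cardinality is minimal.
\<close>
lemma minimal_generators:
  fixes Z :: "nat set"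
  defines "Syz \<equiv> {s \<in> syzygies N f. \<forall>k\<in>Z. k \<le> N \<longrightarrow> s $ k = 0}"
  shows "\<exists>\<phi>. dim_row \<phi> = N + 1 \<and> (\<forall>c<dim_col \<phi>. \<exists>d. multi_homogeneous_vec m r x d (col \<phi> c)) \<and>
    cols_generate \<phi> {..<dim_col \<phi>} Syz \<and>
    (\<forall>S. S \<subset> {..<dim_col \<phi>} \<longrightarrow> \<not> cols_generate \<phi> S Syz)"
proof -
  let ?w = "mdeg m r x"
  define M where "M = {p :: ('v, 'k) mpol poly. Polynomial.degree p \<le> N \<and>
    (\<Sum>k\<le>N. poly.coeff p k * f k) = 0 \<and> (\<forall>k\<in>Z. k \<le> N \<longrightarrow> poly.coeff p k = 0)}"
  have to_M: "(\<Sum>k\<le>N. Polynomial.monom (s $ k) k) \<in> M" if "s \<in> Syz" for s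
    using that degree_poly_of_fun[of "\<lambda>k. s $ k" N]
    by (auto simp: M_def Syz_def syzygies_def coeff_poly_of_fun)
  have of_M: "vec (N + 1) (poly.coeff p) \<in> Syz" if "p \<in> M" for p
    using that by (auto simp: M_def Syz_def syzygies_def)
  have sub: "vect.subspace M"
  proof (rule vect.subspaceI)
    show "p + q \<in> M" if "p \<in> M" "q \<in> M" for p q
      using that by (auto simp: M_def distrib_right sum.distrib intro: degree_add_le)
    show "Polynomial.smult c p \<in> M" if "p \<in> M" for c p
      using that by (auto simp: M_def mult.assoc intro: order_trans[OF degree_smult_le]
          simp flip: sum_distrib_left)
  qed (simp add: M_def)
  have graded_M: "map_poly (part ?w e) p \<in> M" if "p \<in> M" for e p
  proof -
    have "(\<Sum>k\<le>N. part ?w e (poly.coeff p k) * f k) = 0"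
      using that by (intro part_syzygy_mdeg[OF vars homog]) (auto simp: M_def)
    moreover have "Polynomial.degree (map_poly (part ?w e) p) \<le> N"
      using that map_poly_degree_leq[of "part ?w e" p] by (auto simp: M_def)
    ultimately show ?thesis using that by (auto simp: M_def coeff_map_part)
  qed
  obtain T where T: "finite T" "T \<subseteq> M" "vect.span T = M"
    using submodule_finitely_generated[OF multi_vars_finite[OF vars] sub, of N]
    by (auto simp: M_def)
  define E where "E = (\<lambda>p :: ('v, 'k) mpol poly. ?w ` (\<Union>k\<le>N. Poly_Mapping.keys (poly.coeff p k)))"
  have finE: "finite (E p)" for p by (simp add: E_def)
  define T' where "T' = (\<Union>t\<in>T. (\<lambda>e. map_poly (part ?w e) t) ` E t)"
  have T': "finite T'" "T' \<subseteq> M" using T(1,2) finE graded_M by (auto simp: T'_def)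
  have "t \<in> vect.span T'" if "t \<in> T" for t
  proof -
    have deg: "Polynomial.degree t \<le> N" using that T(2) by (auto simp: M_def)
    have "t = (\<Sum>e\<in>E t. map_poly (part ?w e) t)"
    proof (rule poly_eqI)
      fix k
      show "poly.coeff t k = poly.coeff (\<Sum>e\<in>E t. map_poly (part ?w e) t) k"
      proof (cases "k \<le> N")
        case True
        then have "?w ` Poly_Mapping.keys (poly.coeff t k) \<subseteq> E t" by (auto simp: E_def)
        from sum_parts[OF finE this] show ?thesis by (simp add: coeff_sum coeff_map_part)
      next
        case False
        then show ?thesis using deg by (simp add: coeff_sum coeff_map_part coeff_eq_0)
      qed
    qed
    also have "\<dots> \<in> vect.span T'"
      using that by (intro vect.span_sum vect.span_base) (auto simp: T'_def)
    finally show ?thesis .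
  qed
  then have spanT': "vect.span T' = M"
    using T(3) vect.span_minimal[of T "vect.span T'"] vect.span_minimal[OF T'(2) sub]
      vect.subspace_span[of T'] by blast
  have "\<exists>T0. (T0 \<subseteq> T' \<and> vect.span T0 = M) \<and>
      (\<forall>T1. T1 \<subseteq> T' \<and> vect.span T1 = M \<longrightarrow> card T0 \<le> card T1)"
    by (rule ex_has_least_nat[of _ T' card]) (simp add: spanT')
  then obtain T0 where T0: "T0 \<subseteq> T'" "vect.span T0 = M"
      "\<forall>T1. T1 \<subseteq> T' \<and> vect.span T1 = M \<longrightarrow> card T0 \<le> card T1"
    by (elim exE conjE) (rule that)
  have finT0: "finite T0" using T0(1) T'(1) finite_subset by blast
  obtain ts where ts: "set ts = T0" "distinct ts" using finite_distinct_list[OF finT0] by blast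
  define \<phi> where "\<phi> = mat (N + 1) (length ts) (\<lambda>(k, c). poly.coeff (ts ! c) k)"
  have tsM: "ts ! c \<in> M" if "c < length ts" for c
    using that ts(1) T0(1) T'(2) nth_mem by blast
  have col: "col \<phi> c = vec (N + 1) (poly.coeff (ts ! c))" if "c < length ts" for c
    using that by (auto simp: \<phi>_def)
  show ?thesis
  proof (intro exI[of _ \<phi>] conjI allI impI notI)
    show "dim_row \<phi> = N + 1" by (simp add: \<phi>_def)
  next
    fix c assume "c < dim_col \<phi>"
    then have c: "c < length ts" by (simp add: \<phi>_def)
    then have "ts ! c \<in> T'" using ts(1) T0(1) nth_mem by blast
    then obtain t \<alpha> where t: "ts ! c = map_poly (part ?w (?w \<alpha>)) t"
      by (auto simp: T'_def E_def)
    have "multi_homogeneous m r x (\<lambda>i. \<Sum>j\<le>r i. Poly_Mapping.lookup \<alpha> (x i j)) (poly.coeff (ts ! c) k)" for k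
      unfolding multi_homogeneous_iff_graded t coeff_map_part mdeg_altdef[symmetric]
      by (rule graded_part)
    then show "\<exists>d. multi_homogeneous_vec m r x d (col \<phi> c)"
      unfolding multi_homogeneous_vec_def col[OF c] by auto
  next
    show "cols_generate \<phi> {..<dim_col \<phi>} Syz"
      unfolding cols_generate_def
    proof (intro conjI ballI)
      fix c assume "c \<in> {..<dim_col \<phi>}"
      then show "col \<phi> c \<in> Syz" using of_M tsM by (auto simp: col \<phi>_def)
    next
      fix s assume s: "s \<in> Syz"
      obtain u where u: "(\<Sum>k\<le>N. Polynomial.monom (s $ k) k) = (\<Sum>t\<in>T0. Polynomial.smult (u t) t)"
        using to_M[OF s] vect.span_finite[OF finT0] unfolding T0(2) by auto
      show "\<exists>a. \<forall>k<dim_row \<phi>. s $ k = (\<Sum>c<dim_col \<phi>. a c * \<phi> $$ (k, c))"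
      proof (intro exI[of _ "\<lambda>c. u (ts ! c)"] allI impI)
        fix k assume "k < dim_row \<phi>"
        then have k: "k \<le> N" by (simp add: \<phi>_def)
        have "s $ k = poly.coeff (\<Sum>t\<in>T0. Polynomial.smult (u t) t) k"
          using coeff_poly_of_fun[OF k, of "\<lambda>k. s $ k"] u by simp
        also have "\<dots> = (\<Sum>t\<in>T0. u t * poly.coeff t k)" by (simp add: coeff_sum)
        also have "\<dots> = (\<Sum>c<length ts. u (ts ! c) * poly.coeff (ts ! c) k)"
          using sum.reindex_bij_betw[OF bij_betw_nth[OF ts(2) refl ts(1)[symmetric]],
              of "\<lambda>t. u t * poly.coeff t k"] by simp
        also have "\<dots> = (\<Sum>c<dim_col \<phi>. u (ts ! c) * \<phi> $$ (k, c))"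
          using k by (intro sum.cong) (auto simp: \<phi>_def)
        finally show "s $ k = (\<Sum>c<dim_col \<phi>. u (ts ! c) * \<phi> $$ (k, c))" .
      qed
    qed
  next
    fix S assume S: "S \<subset> {..<dim_col \<phi>}" and gen: "cols_generate \<phi> S Syz"
    have S': "S \<subset> {..<length ts}" using S by (simp add: \<phi>_def)
    define T1 where "T1 = (!) ts ` S"
    have "M \<subseteq> vect.span T1"
    proof
      fix p assume p: "p \<in> M"
      obtain a where a: "\<forall>k<dim_row \<phi>. vec (N + 1) (poly.coeff p) $ k = (\<Sum>c\<in>S. a c * \<phi> $$ (k, c))"
        using gen of_M[OF p] unfolding cols_generate_def by blast
      have "p = (\<Sum>c\<in>S. Polynomial.smult (a c) (ts ! c))"
      proof (rule poly_eqI)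
        fix k
        show "poly.coeff p k = poly.coeff (\<Sum>c\<in>S. Polynomial.smult (a c) (ts ! c)) k"
        proof (cases "k \<le> N")
          case True
          then have "poly.coeff p k = (\<Sum>c\<in>S. a c * \<phi> $$ (k, c))" using a by (auto simp: \<phi>_def)
          also have "\<dots> = (\<Sum>c\<in>S. a c * poly.coeff (ts ! c) k)"
            using True S' by (intro sum.cong) (auto simp: \<phi>_def)
          finally show ?thesis by (simp add: coeff_sum)
        next
          case False
          have "poly.coeff (ts ! c) k = 0" if "c \<in> S" for c
            using tsM[of c] that S' False by (intro coeff_eq_0) (auto simp: M_def)
          moreover have "poly.coeff p k = 0"
            using p False by (intro coeff_eq_0) (auto simp: M_def)
          ultimately show ?thesis by (simp add: coeff_sum)
        qed
      qed
      also have "\<dots> \<in> vect.span T1"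
        by (intro vect.span_sum vect.span_scale vect.span_base) (auto simp: T1_def)
      finally show "p \<in> vect.span T1" .
    qed
    moreover have "T1 \<subseteq> M" using S' tsM by (auto simp: T1_def)
    ultimately have "vect.span T1 = M" using vect.span_minimal[OF _ sub] by blast
    moreover have "T1 \<subseteq> T0" using S' ts(1) nth_mem by (auto simp: T1_def)
    ultimately have "card T0 \<le> card T1" using T0(1) T0(3)[rule_format, of T1] by auto
    moreover have "card T1 \<le> card S"
      unfolding T1_def by (rule card_image_le) (rule finite_subset[OF psubset_imp_subset[OF S']], simp)
    moreover have "card S < length ts" using psubset_card_mono[OF _ S'] by simp
    moreover have "card T0 = length ts" using ts distinct_card by metis
    ultimately show False by simp
  qed
qed

lemma exists_syzygy_matrix: "\<exists>\<phi>. syzygy_matrix m r x N f \<phi>"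
  using minimal_generators[of "{}"] unfolding syzygy_matrix_def by simp

text \<open>
  If \<open>f\<^sub>l\<close> is a combination of the other forms then the syzygies are generated by those that
  vanish at \<open>l\<close> and a constant one. With this choice row \<open>l\<close> of the linear part is zero.
\<close>
lemma syzygy_matrix_of_dependent:
  assumes dep: "\<not> lin_indep_forms N f" and nz: "\<exists>k\<le>N. f k \<noteq> 0"
  shows "\<exists>\<phi>. syzygy_matrix m r x N f \<phi> \<and> fract_rank (linear_part m r x \<phi>) < N"
proof -
  interpret C: comm_ring_hom "Const :: 'k \<Rightarrow> ('v, 'k) mpol" by (rule hom_Const)
  obtain c l where c: "(\<Sum>k\<le>N. Const (c k) * f k) = 0" and l: "l \<le> N" "c l \<noteq> 0"
    using dep by (auto simp: lin_indep_forms_def)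
  define \<sigma> where "\<sigma> = (\<lambda>k. Const (c k / c l) :: ('v, 'k) mpol)"
  have \<sigma>l: "\<sigma> l = 1" using l by (simp add: \<sigma>_def C.hom_one)
  have \<sigma>: "(\<Sum>k\<le>N. \<sigma> k * f k) = 0"
  proof -
    have "(\<Sum>k\<le>N. \<sigma> k * f k) = Const (1 / c l) * (\<Sum>k\<le>N. Const (c k) * f k)"
      unfolding sum_distrib_left mult.assoc[symmetric] \<sigma>_def C.hom_mult[symmetric] by simp
    then show ?thesis using c by simp
  qed
  have "\<exists>k1\<le>N. k1 \<noteq> l \<and> f k1 \<noteq> 0"
  proof (rule ccontr)
    assume none: "\<not> (\<exists>k1\<le>N. k1 \<noteq> l \<and> f k1 \<noteq> 0)"
    then have "(\<Sum>k\<le>N. \<sigma> k * f k) = f l"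
    proof -
      have "(\<Sum>k\<in>{..N} - {l}. \<sigma> k * f k) = 0" using none by (intro sum.neutral) auto
      then show ?thesis using l \<sigma>l by (subst sum.remove[of "{..N}" l]) simp_all
    qed
    then have "f l = 0" using \<sigma> by simp
    then show False using none nz by blast
  qed
  then obtain k1 where k1: "k1 \<le> N" "k1 \<noteq> l" "f k1 \<noteq> 0" by blast
  define Syz where "Syz = {s \<in> syzygies N f. \<forall>k\<in>{l}. k \<le> N \<longrightarrow> s $ k = 0}"
  obtain \<psi> where \<psi>: "dim_row \<psi> = N + 1"
      "\<forall>c<dim_col \<psi>. \<exists>d. multi_homogeneous_vec m r x d (col \<psi> c)"
      "cols_generate \<psi> {..<dim_col \<psi>} Syz"
      "\<forall>S. S \<subset> {..<dim_col \<psi>} \<longrightarrow> \<not> cols_generate \<psi> S Syz"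
    using minimal_generators[of "{l}", folded Syz_def] by blast
  define n where "n = dim_col \<psi>"
  define \<phi> where "\<phi> = mat (N + 1) (n + 1) (\<lambda>(k, c). if c < n then \<psi> $$ (k, c) else \<sigma> k)"
  have dims: "dim_row \<phi> = N + 1" "dim_col \<phi> = n + 1" by (auto simp: \<phi>_def)
  have entry: "\<phi> $$ (k, c) = \<psi> $$ (k, c)" if "k \<le> N" "c < n" for k c
    using that by (simp add: \<phi>_def)
  have entry_n: "\<phi> $$ (k, n) = \<sigma> k" if "k \<le> N" for k
    using that by (simp add: \<phi>_def)
  have col: "col \<phi> c = col \<psi> c" if "c < n" for c
    using that \<psi>(1) by (intro eq_vecI) (auto simp: \<phi>_def n_def)
  have col_n: "col \<phi> n = vec (N + 1) \<sigma>"
    by (intro eq_vecI) (auto simp: \<phi>_def)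
  have \<psi>l: "\<psi> $$ (l, c) = 0" if "c < n" for c
  proof -
    have "col \<psi> c \<in> Syz" using \<psi>(3) that by (auto simp: cols_generate_def n_def)
    then show ?thesis using l that \<psi>(1) by (simp add: Syz_def n_def)
  qed
  have syz: "syzygy_matrix m r x N f \<phi>"
    unfolding syzygy_matrix_def
  proof (intro conjI allI impI notI)
    show "dim_row \<phi> = N + 1" by (fact dims)
  next
    fix c assume "c < dim_col \<phi>"
    then consider "c < n" | "c = n" using dims by linarith
    then show "\<exists>d. multi_homogeneous_vec m r x d (col \<phi> c)"
    proof cases
      case 1
      then show ?thesis using \<psi>(2) col by (simp add: n_def)
    next
      case 2
      have "multi_homogeneous_vec m r x (\<lambda>_. 0) (vec (N + 1) \<sigma>)"
        by (auto simp: multi_homogeneous_vec_def multi_homogeneous_def \<sigma>_def Const_def)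
      then show ?thesis using 2 col_n by auto
    qed
  next
    show "cols_generate \<phi> {..<dim_col \<phi>} (syzygies N f)"
      unfolding cols_generate_def
    proof (intro conjI ballI)
      fix c assume "c \<in> {..<dim_col \<phi>}"
      then consider "c < n" | "c = n" using dims by fastforce
      then show "col \<phi> c \<in> syzygies N f"
      proof cases
        case 1
        then have "col \<psi> c \<in> Syz" using \<psi>(3) by (auto simp: cols_generate_def n_def)
        then show ?thesis using 1 col by (simp add: Syz_def)
      next
        case 2
        then show ?thesis using \<sigma> col_n by (simp add: syzygies_def)
      qed
    next
      fix s assume s: "s \<in> syzygies N f"
      define s' where "s' = vec (N + 1) (\<lambda>k. s $ k - s $ l * \<sigma> k)"
      have "(\<Sum>k\<le>N. (s $ k - s $ l * \<sigma> k) * f k) =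
          (\<Sum>k\<le>N. s $ k * f k) - s $ l * (\<Sum>k\<le>N. \<sigma> k * f k)"
        by (simp add: left_diff_distrib sum_subtractf sum_distrib_left mult.assoc)
      then have "s' \<in> Syz"
        using s \<sigma> \<sigma>l l by (simp add: Syz_def syzygies_def s'_def)
      then obtain a where a: "\<And>k. k \<le> N \<Longrightarrow> s' $ k = (\<Sum>c<n. a c * \<psi> $$ (k, c))"
        using \<psi>(1,3) unfolding cols_generate_def n_def by force
      show "\<exists>a. \<forall>k<dim_row \<phi>. s $ k = (\<Sum>c<dim_col \<phi>. a c * \<phi> $$ (k, c))"
      proof (intro exI[of _ "\<lambda>c. if c < n then a c else s $ l"] allI impI)
        fix k assume "k < dim_row \<phi>"
        then have k: "k \<le> N" using dims by simp
        have "(\<Sum>c<dim_col \<phi>. (if c < n then a c else s $ l) * \<phi> $$ (k, c)) =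
            (\<Sum>c<n. a c * \<psi> $$ (k, c)) + s $ l * \<sigma> k"
          using k by (simp add: dims entry entry_n)
        also have "\<dots> = s $ k" using a[OF k, symmetric] k by (simp add: s'_def)
        finally show "s $ k = (\<Sum>c<dim_col \<phi>. (if c < n then a c else s $ l) * \<phi> $$ (k, c))" ..
      qed
    qed
  next
    fix S assume S: "S \<subset> {..<dim_col \<phi>}" and gen: "cols_generate \<phi> S (syzygies N f)"
    have finS: "finite S" using S finite_subset by blast
    define S' where "S' = S - {n}"
    have S'n: "S' \<subseteq> {..<n}" using S dims by (auto simp: S'_def)
    have sum_S: "(\<Sum>c\<in>S. a c * \<phi> $$ (k, c)) =
        (\<Sum>c\<in>S'. a c * \<psi> $$ (k, c)) + (if n \<in> S then a n * \<sigma> k else 0)" if k: "k \<le> N" for a k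
    proof -
      have "(\<Sum>c\<in>S'. a c * \<phi> $$ (k, c)) = (\<Sum>c\<in>S'. a c * \<psi> $$ (k, c))"
        using S'n entry[OF k] by (intro sum.cong) auto
      then show ?thesis
        using finS entry_n[OF k] by (cases "n \<in> S") (simp_all add: S'_def sum.remove[of S n])
    qed
    have row_l: "(\<Sum>c\<in>S'. a c * \<psi> $$ (l, c)) = 0" for a
      using S'n \<psi>l by (intro sum.neutral) auto
    have "vec (N + 1) \<sigma> \<in> syzygies N f" using \<sigma> by (simp add: syzygies_def)
    then obtain a where a: "\<forall>k<dim_row \<phi>. vec (N + 1) \<sigma> $ k = (\<Sum>c\<in>S. a c * \<phi> $$ (k, c))"
      using gen unfolding cols_generate_def by blast
    then have "1 = (\<Sum>c\<in>S. a c * \<phi> $$ (l, c))" using l \<sigma>l dims by auto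
    then have nS: "n \<in> S" using sum_S[OF l(1)] row_l by (auto split: if_splits)
    have "cols_generate \<psi> S' Syz"
      unfolding cols_generate_def
    proof (intro conjI ballI)
      fix c assume "c \<in> S'"
      then show "col \<psi> c \<in> Syz" using \<psi>(3) S'n by (auto simp: cols_generate_def n_def)
    next
      fix s assume s: "s \<in> Syz"
      then obtain a where "\<forall>k<dim_row \<phi>. s $ k = (\<Sum>c\<in>S. a c * \<phi> $$ (k, c))"
        using gen unfolding cols_generate_def Syz_def by blast
      then have a: "s $ k = (\<Sum>c\<in>S'. a c * \<psi> $$ (k, c)) + a n * \<sigma> k" if "k \<le> N" for k
        using that dims sum_S[OF that] nS by simp
      have "a n = 0" using a[OF l(1)] row_l s l \<sigma>l by (simp add: Syz_def)
      then show "\<exists>a. \<forall>k<dim_row \<psi>. s $ k = (\<Sum>c\<in>S'. a c * \<psi> $$ (k, c))"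
        using a \<psi>(1) by (intro exI[of _ a]) simp
    qed
    moreover have "S' \<subset> {..<dim_col \<psi>}"
      using S dims nS S'n unfolding n_def[symmetric] S'_def by (auto simp: less_Suc_eq)
    ultimately show False using \<psi>(4) by blast
  qed
  have zero: "linear_part m r x \<phi> $$ (l, c) = 0" if c: "c < dim_col (linear_part m r x \<phi>)" for c
  proof -
    obtain c' i where c': "c' < dim_col \<phi>" "i \<in> {1..m}"
        "multi_homogeneous_vec m r x (unit_degree i) (col \<phi> c')"
        "\<forall>k<dim_row \<phi>. linear_part m r x \<phi> $$ (k, c) = \<phi> $$ (k, c')"
      using c by (rule linear_part_column)
    have "c' \<noteq> n"
    proof
      assume "c' = n"
      then have "multi_homogeneous m r x (unit_degree i) (\<sigma> l)"
        using c'(3) l col_n by (simp add: multi_homogeneous_vec_def)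
      then have "unit_degree i i = 0" using c'(2) by (auto simp: \<sigma>l multi_homogeneous_def)
      then show False by (simp add: unit_degree_def)
    qed
    then have "c' < n" using c'(1) dims by simp
    then show ?thesis using c'(4)[rule_format, of l] l dims entry \<psi>l by simp
  qed
  have rows: "dim_row (linear_part m r x \<phi>) = N + 1" by (simp add: dims)
  have "fract_rank (linear_part m r x \<phi>) + card {l} \<le> N"
    by (rule fract_rank_le[where f = f, OF rows k1(1,3) linear_part_syzygy[OF syz]])
      (use zero l k1 in auto)
  then have "fract_rank (linear_part m r x \<phi>) < N" by simp
  then show ?thesis using syz by blast
qed

end

theorem theorem4p9:
  fixes m N :: nat
    and r :: "nat \<Rightarrow> nat"
    and x :: "nat \<Rightarrow> nat \<Rightarrow> 'v::linorder"
    and f :: "nat \<Rightarrow> ('v, 'k::field) mpol"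
  assumes "multi_vars m r x"
    and "N = (\<Sum>i=1..m. r i)"
    and "\<exists>d. \<forall>k\<le>N. multi_homogeneous m r x d (f k)"
    and "\<exists>k\<le>N. f k \<noteq> 0"
    and "linear_type (ideal_gen UNIV (f ` {..N}))"
  shows "(birational m r x N f \<longleftrightarrow>
           (\<forall>\<phi>. syzygy_matrix m r x N f \<phi> \<longrightarrow> fract_rank (linear_part m r x \<phi>) = N))
       \<and> (lin_indep_forms N f \<longrightarrow>
           (\<forall>\<phi>. syzygy_matrix m r x N f \<phi> \<longrightarrow>
             (birational m r x N f \<longleftrightarrow> fract_rank (linear_part m r x \<phi>) = N)))"
proof -
  obtain d where homog: "\<And>k. k \<le> N \<Longrightarrow> multi_homogeneous m r x d (f k)" using assms(3) by blast
  have rank: "fract_rank (linear_part m r x \<phi>) = N"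
    if "birational m r x N f" "syzygy_matrix m r x N f \<phi>" for \<phi>
    by (rule rank_of_birational[OF assms(1) homog assms(5,4) that(2,1)])
  have bir: "birational m r x N f"
    if "lin_indep_forms N f" "syzygy_matrix m r x N f \<phi>" "fract_rank (linear_part m r x \<phi>) = N" for \<phi>
    by (rule birational_of_rank[OF assms(1) homog assms(5,4) that(1) assms(2) that(2,3)])
  have "birational m r x N f"
    if all: "\<forall>\<phi>. syzygy_matrix m r x N f \<phi> \<longrightarrow> fract_rank (linear_part m r x \<phi>) = N"
  proof -
    have "lin_indep_forms N f"
      using syzygy_matrix_of_dependent[where f = f and N = N, OF assms(1) homog _ assms(4)] all by force
    moreover obtain \<phi> where "syzygy_matrix m r x N f \<phi>"
      using exists_syzygy_matrix[where f = f and N = N, OF assms(1) homog] by blast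
    ultimately show ?thesis using bir all by blast
  qed
  then show ?thesis using rank bir by blast
qed

end
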